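(* Consider the Nash equilibrium problem (P) and its data as specified in the context. Let $\eta\in(0,+\infty)$ and $\varepsilon\in(0,1)$ be such that $1/\varepsilon>\max\{\alpha_i+\eta,\beta_k+\eta,\chi_i+\eta\}_{i\in I,k\in K}$, let $(\lambda_n)_{n\in\mathbb{N}}$ be in $[\varepsilon,2-\varepsilon]$, and let $D\in\mathbb{N}$. Suppose that the following are satisfied: [a] For every $i\in I$ and every $n\in\mathbb{N}$, $\tau_i(n)\in\mathbb{N}$ satisfies $n-D\leq\tau_i(n)\leq n$, $\gamma_{i,n}\in[\varepsilon,1/(\alpha_i+\eta)]$, $\mu_{i,n}\in[\varepsilon,1/(\chi_i+\eta)]$, $\sigma_{i,n}\in[\varepsilon,1/\varepsilon]$, $x_{i,0}\in\mathcal{H}_i$, $y_{i,0}\in\mathcal{K}_i$, and $u_{i,0}^*\in\mathcal{K}_i$. [b] For every $k\in K$ and every $n\in\mathbb{N}$, $\delta_k(n)\in\mathbb{N}$ satisfies $n-D\leq\delta_k(n)\leq n$, $\nu_{k,n}\in[\varepsilon,1/(\beta_k+\eta)]$, $\varrho_{k,n}\in[\varepsilon,1/\varepsilon]$, $z_{k,0}\in\mathcal{G}_k$, and $v_{k,0}^*\in\mathcal{G}_k$. [c] $(I_n)_{n\in\mathbb{N}}$ are nonempty subsets of $I$ and $(K_n)_{n\in\mathbb{N}}$ are nonempty subsets of $K$ such that, for some $P\in\mathbb{N}$, $I_0=I$, $K_0=K$, and, for every $n\in\mathbb{N}$, $\bigcup_{j=n}^{n+P}I_j=I$ and $\bigcup_{j=n}^{n+P}K_j=K$.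 For $n=0,1,\ldots$ perform the following steps (here $\boldsymbol{y}_n=(y_{i,n})_{i\in I}$, $\boldsymbol{q}_n=(q_{i,n})_{i\in I}$, $\boldsymbol{x}_n=(x_{i,n})_{i\in I}$). 1. For every $i\in I_n$, writing $t=\tau_i(n)$: $$\begin{aligned} q_{i,n}&=y_{i,t}+\mu_{i,t}\big(u_{i,t}^*-\nabla_i\boldsymbol{f}_i(\boldsymbol{y}_t)\big);\\ c_{i,n}^*&=u_{i,t}^*+\sigma_{i,t}\big(M_ix_{i,t}-y_{i,t}\big);\\ x_{i,n}^*&=x_{i,t}-\gamma_{i,t}\Big(\nabla\psi_i(x_{i,t})+M_i^*u_{i,t}^*+\sum_{k\in K}L_{k,i}^*v_{k,t}^*\Big);\\ a_{i,n}&=\operatorname{prox}_{\gamma_{i,t}\varphi_i}x_{i,n}^*;\\ s_{i,n}^*&=\gamma_{i,t}^{-1}(x_{i,n}^*-a_{i,n})+\nabla\psi_i(a_{i,n})+M_i^*c_{i,n}^*;\\ c_{i,n}&=q_{i,n}-M_ia_{i,n}. \end{aligned}$$ 2. For every $i\in I\smallsetminus I_n$: $q_{i,n}=q_{i,n-1}$, $c_{i,n}^*=c_{i,n-1}^*$, $a_{i,n}=a_{i,n-1}$, $s_{i,n}^*=s_{i,n-1}^*$, $c_{i,n}=c_{i,n-1}$. 3. For every $k\in K_n$, writing $d=\delta_k(n)$: $$\begin{aligned} d_{k,n}^*&=z_{k,d}+\nu_{k,d}\big(v_{k,d}^*-\nabla h_k(z_{k,d})\big);\\ b_{k,n}&=\operatorname{prox}_{\nu_{k,d}g_k}d_{k,n}^*;\\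 e_{k,n}^*&=v_{k,d}^*+\varrho_{k,d}\Big(\sum_{i\in I}L_{k,i}x_{i,d}-z_{k,d}\Big);\\ b_{k,n}^*&=\nu_{k,d}^{-1}(d_{k,n}^*-b_{k,n})+\nabla h_k(b_{k,n})-e_{k,n}^*;\\ e_{k,n}&=b_{k,n}-\sum_{i\in I}L_{k,i}a_{i,n}. \end{aligned}$$ 4. For every $k\in K\smallsetminus K_n$: $b_{k,n}=b_{k,n-1}$, $e_{k,n}^*=e_{k,n-1}^*$, $b_{k,n}^*=b_{k,n-1}^*$, $e_{k,n}=b_{k,n}-\sum_{i\in I}L_{k,i}a_{i,n}$. 5. For every $i\in I$: $a_{i,n}^*=s_{i,n}^*+\sum_{k\in K}L_{k,i}^*e_{k,n}^*$ and $q_{i,n}^*=\nabla_i\boldsymbol{f}_i(\boldsymbol{q}_n)-c_{i,n}^*$. 6. Set $$\begin{aligned}\pi_n=&\sum_{i\in I}\big(\langle a_{i,n}-x_{i,n}\mid a_{i,n}^*\rangle+\langle q_{i,n}-y_{i,n}\mid q_{i,n}^*\rangle+\langle c_{i,n}\mid c_{i,n}^*-u_{i,n}^*\rangle\big)\\&+\sum_{k\in K}\big(\langle b_{k,n}-z_{k,n}\mid b_{k,n}^*\rangle+\langle e_{k,n}\mid e_{k,n}^*-v_{k,n}^*\rangle\big).\end{aligned}$$ 7. If $\pi_n<0$, set $$\theta_n=\frac{\lambda_n\pi_n}{\sum_{i\in I}\big(\|a_{i,n}^*\|^2+\|q_{i,n}^*\|^2+\|c_{i,n}\|^2\big)+\sum_{k\in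 K}\big(\|b_{k,n}^*\|^2+\|e_{k,n}\|^2\big)},$$ and, for every $i\in I$, $x_{i,n+1}=x_{i,n}+\theta_na_{i,n}^*$, $y_{i,n+1}=y_{i,n}+\theta_nq_{i,n}^*$, $u_{i,n+1}^*=u_{i,n}^*+\theta_nc_{i,n}$, and, for every $k\in K$, $z_{k,n+1}=z_{k,n}+\theta_nb_{k,n}^*$, $v_{k,n+1}^*=v_{k,n}^*+\theta_ne_{k,n}$. Otherwise, for every $i\in I$, $x_{i,n+1}=x_{i,n}$, $y_{i,n+1}=y_{i,n}$, $u_{i,n+1}^*=u_{i,n}^*$, and, for every $k\in K$, $z_{k,n+1}=z_{k,n}$, $v_{k,n+1}^*=v_{k,n}^*$. Furthermore, suppose that there exist $\widehat{\boldsymbol{x}}=(\widehat{x}_i)_{i\in I}\in\boldsymbol{\mathcal{H}}$, $\widehat{\boldsymbol{u}}^*=(\widehat{u}_i^* )_{i\in I}\in\boldsymbol{\mathcal{K}}$, and $\widehat{\boldsymbol{v}}^*=(\widehat{v}_k^* )_{k\in K}\in\boldsymbol{\mathcal{G}}$ such that $$\begin{cases} (\forall i\in I)\;\;\widehat{u}_i^*=\nabla_i\boldsymbol{f}_i(\boldsymbol{M}\widehat{\boldsymbol{x}})\\ (\forall k\in K)\;\;\widehat{v}_k^*\in(\partial g_k+\nabla h_k)\big(\sum_{j\in I}L_{k,j}\widehat{x}_j\big)\\ (\forall i\in I)\;\;-M_i^*\widehat{u}_i^*-\sum_{k\in K}L_{k,i}^*\widehat{v}_k^*\in\partial\varphi_i(\widehat{x}_i)+\nabla\psi_i(\widehat{x}_i).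 \end{cases}$$ Then $(\boldsymbol{x}_n)_{n\in\mathbb{N}}$ converges weakly in $\boldsymbol{\mathcal{H}}$ to a solution to problem (P).
   Context: Setting. Let $I=\{1,\ldots,m\}$ and let $K$ be a finite index set. Let $(\mathcal{H}_i)_{i\in I}$, $(\mathcal{K}_i)_{i\in I}$, and $(\mathcal{G}_k)_{k\in K}$ be finite families of real Hilbert spaces, and set (Hilbert direct sums) $\boldsymbol{\mathcal{H}}=\bigoplus_{i\in I}\mathcal{H}_i$, $\boldsymbol{\mathcal{K}}=\bigoplus_{i\in I}\mathcal{K}_i$, $\boldsymbol{\mathcal{G}}=\bigoplus_{k\in K}\mathcal{G}_k$. For a vector $\boldsymbol{y}=(y_j)_{j\in I}$ in a direct sum indexed by $I$, $\boldsymbol{y}_{\smallsetminus i}=(y_j)_{j\in I\smallsetminus\{i\}}$, and $(x_i;\boldsymbol{y}_{\smallsetminus i})=(y_1,\ldots,y_{i-1},x_i,y_{i+1},\ldots,y_m)$. Suppose that the following are satisfied: [a] For every $i\in I$, $\varphi_i\colon\mathcal{H}_i\to(-\infty,+\infty]$ is proper, lower semicontinuous, and convex, $\alpha_i\in[0,+\infty)$, and $\psi_i\colon\mathcal{H}_i\to\mathbb{R}$ is convex and differentiable with an $\alpha_i$-Lipschitzian gradient. [b] For every $i\in I$, $\boldsymbol{f}_i\colon\boldsymbol{\mathcal{K}}\to\mathbb{R}$ is such that, for every $\boldsymbol{y}\in\boldsymbol{\mathcal{K}}$, $\boldsymbol{f}_i(\,\cdot\,;\boldsymbol{y}_{\smallsetminus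 i})\colon\mathcal{K}_i\to\mathbb{R}$ is convex and Gâteaux differentiable, and its gradient at $y_i\in\mathcal{K}_i$ is denoted by $\nabla_i\boldsymbol{f}_i(\boldsymbol{y})$. Further, the operator $\boldsymbol{Q}\colon\boldsymbol{\mathcal{K}}\to\boldsymbol{\mathcal{K}}\colon\boldsymbol{y}\mapsto(\nabla_i\boldsymbol{f}_i(\boldsymbol{y}))_{i\in I}$ is monotone and Lipschitzian. Finally, $(\chi_i)_{i\in I}$ are positive numbers such that, for all $\boldsymbol{y},\boldsymbol{y}'\in\boldsymbol{\mathcal{K}}$, $\langle\boldsymbol{y}-\boldsymbol{y}'\mid\boldsymbol{Q}\boldsymbol{y}-\boldsymbol{Q}\boldsymbol{y}'\rangle\leq\sum_{i\in I}\chi_i\|y_i-y_i'\|^2$. [c] For every $k\in K$, $g_k\colon\mathcal{G}_k\to(-\infty,+\infty]$ is proper, lower semicontinuous, and convex, $\beta_k\in[0,+\infty)$, and $h_k\colon\mathcal{G}_k\to\mathbb{R}$ is convex and differentiable with a $\beta_k$-Lipschitzian gradient. [d] For every $i\in I$ and every $k\in K$, $M_i\colon\mathcal{H}_i\to\mathcal{K}_i$ and $L_{k,i}\colon\mathcal{H}_i\to\mathcal{G}_k$ are linear and bounded, and, for every $\boldsymbol{x}\in\boldsymbol{\mathcal{H}}$, $\boldsymbol{L}_{k,\smallsetminus i}\boldsymbol{x}_{\smallsetminus i}=\sum_{j\in I\smallsetminus\{i\}}L_{k,j}x_j$ and $\boldsymbol{M}\boldsymbol{x}=(M_jx_j)_{j\in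 I}$. Problem (P): find $\overline{\boldsymbol{x}}\in\boldsymbol{\mathcal{H}}$ such that, for every $i\in I$, $$\overline{x}_i\in\operatorname*{Argmin}_{x_i\in\mathcal{H}_i}\Big(\varphi_i(x_i)+\psi_i(x_i)+\boldsymbol{f}_i\big(M_ix_i;(\boldsymbol{M}\overline{\boldsymbol{x}})_{\smallsetminus i}\big)+\sum_{k\in K}(g_k+h_k)\big(L_{k,i}x_i+\boldsymbol{L}_{k,\smallsetminus i}\overline{\boldsymbol{x}}_{\smallsetminus i}\big)\Big).$$ Notation. $M_i^*$ and $L_{k,i}^*$ are adjoints. For a proper lower semicontinuous convex function $\varphi$ on a real Hilbert space $\mathcal{H}$, $\operatorname{prox}_\varphi x$ is the unique minimizer of $\varphi+\tfrac12\|\cdot-x\|^2$, and $\partial\varphi(x)=\{x^*\in\mathcal{H}: (\forall y\in\mathcal{H})\ \langle y-x\mid x^*\rangle+\varphi(x)\leq\varphi(y)\}$. *)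

theory Defs
  imports "HOL-Analysis.Analysis"
begin

(* The members of a finite family of (possibly different) real Hilbert spaces cannot have
   different types within one family. They are therefore complete linear subspaces of one common
   inner product space; every finite family arises like this up to isometry, inside its Hilbert
   direct sum. All notions below are relative to such a carrier S: functions are
   total in HOL, but their values outside the carrier are never used. *)
definition hilbert_subspace :: "'a::real_inner set \<Rightarrow> bool" where
  "hilbert_subspace S \<longleftrightarrow> subspace S \<and> complete S"

(* The Hilbert direct sum: the inner product and the norm are those of the type 'a ^ 'i. *)
definition direct_sum :: "('i::finite \<Rightarrow> 'a::real_inner set) \<Rightarrow> ('a ^ 'i) set" where
  "direct_sum H = {x. \<forall>i. x $ i \<in> H i}"

(* (t; y_{-i}), i.e. y with its i-th component replaced by t *)
definition subst_comp :: "'i::finite \<Rightarrow> 'a \<Rightarrow> 'a ^ 'i \<Rightarrow> 'a ^ 'i" where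
  "subst_comp i t y = (\<chi> j. if j = i then t else y $ j)"

definition bounded_linear_between ::
    "'a::real_normed_vector set \<Rightarrow> 'b::real_normed_vector set \<Rightarrow> ('a \<Rightarrow> 'b) \<Rightarrow> bool" where
  "bounded_linear_between S T A \<longleftrightarrow>
     A ` S \<subseteq> T \<and>
     (\<forall>x\<in>S. \<forall>y\<in>S. A (x + y) = A x + A y) \<and>
     (\<forall>c. \<forall>x\<in>S. A (c *\<^sub>R x) = c *\<^sub>R A x) \<and>
     (\<exists>B. \<forall>x\<in>S. norm (A x) \<le> B * norm x)"

(* The adjoint of A : S \<rightarrow> T at y \<in> T. *)
definition adjoint_on :: "'a::real_inner set \<Rightarrow> ('a \<Rightarrow> 'b::real_inner) \<Rightarrow> 'b \<Rightarrow> 'a" where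
  "adjoint_on S A y = (THE z. z \<in> S \<and> (\<forall>x\<in>S. inner (A x) y = inner x z))"

(* Frechet gradient in the Hilbert space S; for S = UNIV this is the relation
   GDERIV f x :> g of the library. *)
definition gradient_on :: "'a::real_inner set \<Rightarrow> ('a \<Rightarrow> real) \<Rightarrow> 'a \<Rightarrow> 'a" where
  "gradient_on S f x =
     (THE g. g \<in> S \<and> (f has_derivative (\<lambda>d. inner d g)) (at x within S))"

definition has_gateaux_derivative_on ::
    "'a::real_inner set \<Rightarrow> ('a \<Rightarrow> real) \<Rightarrow> ('a \<Rightarrow> real) \<Rightarrow> 'a \<Rightarrow> bool" where
  "has_gateaux_derivative_on S f f' x \<longleftrightarrow>
     bounded_linear_between S UNIV f' \<and>
     (\<forall>d\<in>S. ((\<lambda>t. (f (x + t *\<^sub>R d) - f x) / t) \<longlongrightarrow> f' d) (at_right 0))"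

definition gateaux_differentiable_on :: "'a::real_inner set \<Rightarrow> ('a \<Rightarrow> real) \<Rightarrow> bool" where
  "gateaux_differentiable_on S f \<longleftrightarrow> (\<forall>x\<in>S. \<exists>f'. has_gateaux_derivative_on S f f' x)"

definition gateaux_gradient_on :: "'a::real_inner set \<Rightarrow> ('a \<Rightarrow> real) \<Rightarrow> 'a \<Rightarrow> 'a" where
  "gateaux_gradient_on S f x =
     (THE g. g \<in> S \<and> has_gateaux_derivative_on S f (\<lambda>d. inner d g) x)"

(* The gradient of f(\<cdot> ; y_{-i}) at the point y_i. *)
definition partial_gradient ::
    "('i::finite \<Rightarrow> 'a::real_inner set) \<Rightarrow> 'i \<Rightarrow> ('a ^ 'i \<Rightarrow> real) \<Rightarrow> 'a ^ 'i \<Rightarrow> 'a" where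
  "partial_gradient Y i f y = gateaux_gradient_on (Y i) (\<lambda>t. f (subst_comp i t y)) (y $ i)"

definition monotone_operator_on :: "'a::real_inner set \<Rightarrow> ('a \<Rightarrow> 'a) \<Rightarrow> bool" where
  "monotone_operator_on S A \<longleftrightarrow> (\<forall>x\<in>S. \<forall>y\<in>S. 0 \<le> inner (x - y) (A x - A y))"

(* Proper, lower semicontinuous, convex functions S \<rightarrow> ]-\<infinity>,+\<infinity>]. Since -\<infinity> is not
   a value, the convexity inequality involves no undefined sum. *)
definition proper_lsc_convex :: "'a::real_inner set \<Rightarrow> ('a \<Rightarrow> ereal) \<Rightarrow> bool" where
  "proper_lsc_convex S f \<longleftrightarrow>
     (\<forall>x\<in>S. f x \<noteq> -\<infinity>) \<and>
     (\<exists>x\<in>S. f x \<noteq> \<infinity>) \<and>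
     (\<forall>x\<in>S. f x \<le> Liminf (at x within S) f) \<and>
     (\<forall>x\<in>S. \<forall>y\<in>S. \<forall>t::real. 0 < t \<and> t < 1 \<longrightarrow>
        f ((1 - t) *\<^sub>R x + t *\<^sub>R y) \<le> ereal (1 - t) * f x + ereal t * f y)"

definition prox_on :: "'a::real_inner set \<Rightarrow> ('a \<Rightarrow> ereal) \<Rightarrow> 'a \<Rightarrow> 'a" where
  "prox_on S f x =
     (THE p. is_arg_min (\<lambda>y. f y + ereal (1 / 2 * (norm (y - x))\<^sup>2)) (\<lambda>y. y \<in> S) p)"

definition subdifferential_on :: "'a::real_inner set \<Rightarrow> ('a \<Rightarrow> ereal) \<Rightarrow> 'a \<Rightarrow> 'a set" where
  "subdifferential_on S f x =
     {u \<in> S. \<forall>y\<in>S. ereal (inner (y - x) u) + f x \<le> f y}"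

definition weakly_converges_in :: "'a::real_inner set \<Rightarrow> (nat \<Rightarrow> 'a) \<Rightarrow> 'a \<Rightarrow> bool" where
  "weakly_converges_in S X l \<longleftrightarrow>
     (\<forall>n. X n \<in> S) \<and> l \<in> S \<and> (\<forall>w\<in>S. (\<lambda>n. inner (X n) w) \<longlonglongrightarrow> inner l w)"

(* xbar is a Nash equilibrium: the strategy of each player i minimizes the loss of player i when the
   strategies of the others are those of xbar. L k i maps the strategy space H i to the k-th
   coupling space, and M i maps it to the i-th component of the domain of the functions f j. *)
definition nash_equilibrium ::
    "('i::finite \<Rightarrow> 'h::real_inner set) \<Rightarrow>
     ('i \<Rightarrow> 'h \<Rightarrow> ereal) \<Rightarrow> ('i \<Rightarrow> 'h \<Rightarrow> real) \<Rightarrow>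
     ('i \<Rightarrow> 'y::real_inner ^ 'i \<Rightarrow> real) \<Rightarrow>
     ('k::finite \<Rightarrow> 'g::real_inner \<Rightarrow> ereal) \<Rightarrow> ('k \<Rightarrow> 'g \<Rightarrow> real) \<Rightarrow>
     ('i \<Rightarrow> 'h \<Rightarrow> 'y) \<Rightarrow> ('k \<Rightarrow> 'i \<Rightarrow> 'h \<Rightarrow> 'g) \<Rightarrow> 'h ^ 'i \<Rightarrow> bool" where
  "nash_equilibrium H \<phi> \<psi> f g h M L xbar \<longleftrightarrow>
     xbar \<in> direct_sum H \<and>
     (\<forall>i. is_arg_min
        (\<lambda>\<xi>. \<phi> i \<xi> + ereal (\<psi> i \<xi>)
             + ereal (f i (subst_comp i (M i \<xi>) (\<chi> j. M j (xbar $ j))))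
             + (\<Sum>k\<in>UNIV.
                  let w = L k i \<xi> + (\<Sum>j\<in>UNIV - {i}. L k j (xbar $ j))
                  in g k w + ereal (h k w)))
        (\<lambda>\<xi>. \<xi> \<in> H i) (xbar $ i))"

end

theory Submission
  imports Defs "HOL-Library.Diagonal_Subsequence"
begin

text \<open>
  The Kuhn-Tucker conditions are the inclusion \<open>- T p \<in> \<partial>F p\<close> for \<open>p = ((x, z), (y, u\<^sup>*, v\<^sup>*))\<close>, where
  \<open>F p = (\<Sum>i. \<phi> i (x i)) + (\<Sum>k. g k (z k))\<close> and \<open>T\<close> is a monotone Lipschitz operator made of the
  gradients, of \<open>Q\<close> and of a skew linear part. The algorithm produces at step \<open>n\<close> a point \<open>(p, s)\<close> of the
  graph of \<open>\<partial>F + T\<close>; monotonicity says that all solutions \<open>r\<close> lie in the half-space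
  \<open>\<langle>p - r, s\<rangle> \<ge> 0\<close>, and the iterate \<open>w\<close> is moved by a relaxed projection onto it. Hence \<open>w\<close> is Fejer monotone,
  its steps tend to 0, and the bounded delays become negligible. The skew part cancels in the
  gap \<open>\<langle>w - p, s\<rangle>\<close>, which therefore dominates the squared residuals up to a null sequence; this forces
  \<open>p - w\<close> and \<open>s\<close> to tend to 0 strongly. A Minty argument shows that weak cluster points are solutions, and
  Opial's lemma gives weak convergence. Finally, evaluating the inclusion at unilateral deviations
  of player \<open>i\<close> yields the equilibrium inequalities.
\<close>

section \<open>Minimization over complete convex sets\<close>

text \<open>The data live on complete subspaces of ambient types that need not be complete, so
  projections, Riesz representation, adjoints and weak sequential compactness are all derived
  relative to a carrier. The auxiliary variables \<open>y\<close> and \<open>z\<close> stand for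
  \<open>M x\<close> and \<open>L x\<close>, with multipliers \<open>u\<close> and \<open>v\<close>.
  They decouple the compositions: \<open>\<phi> i\<close> and \<open>g k\<close> enter through their
  own proximity operators, the smooth terms through explicit steps. The price is a coupling by
  \<open>M\<close> and \<open>L\<close>, which is skew and costs nothing in monotonicity. The
  margins explain the step sizes. In the gap, a step of at most
  \<open>1 / (\<alpha> i + \<eta>)\<close> yields at least \<open>\<alpha> i + \<eta>\<close> times
  a squared residual, the gradient takes back at most \<open>\<alpha> i\<close>, and
  \<open>\<eta>\<close> remains; \<open>\<beta> k\<close> and \<open>X i\<close> play the same role,
  but for \<open>Q\<close> the bound is available only after summation over the players. Proximal
  points exist because the Kuhn-Tucker point supplies subgradients, hence affine minorants, of all
  \<open>\<phi> i\<close> and \<open>g k\<close>.\<close>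

lemma nonpos_if_le_small:
  fixes a b :: real
  assumes "\<And>t. 0 < t \<Longrightarrow> t < 1 \<Longrightarrow> a \<le> t * b"
  shows "a \<le> 0"
proof (rule tendsto_lowerbound)
  have "((\<lambda>t. t * b) \<longlongrightarrow> 0 * b) (at_right 0)" by (intro tendsto_intros)
  thus "((\<lambda>t. t * b) \<longlongrightarrow> 0) (at_right 0)" by simp
  show "\<forall>\<^sub>F t in at_right 0. a \<le> t * b"
    unfolding eventually_at_right_field using assms by (intro exI[of _ 1]) auto
qed simp

text \<open>Assumption \<open>mid\<close> is strong convexity with modulus 1 at midpoints. It makes
  minimizing sequences Cauchy, so completeness alone gives a minimizer, before any weak compactness
  is available. Phrasing the assumptions with real upper bounds keeps extended-real arithmetic out
  of the argument. Projection, Riesz representation and the proximity operator are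
  instances.\<close>

lemma strongly_convex_ex1_arg_min:
  fixes J :: "'a::real_inner \<Rightarrow> ereal"
  assumes C: "complete C"
    and p0: "p0 \<in> C" "J p0 \<noteq> \<infinity>"
    and lower: "\<And>x. x \<in> C \<Longrightarrow> ereal m \<le> J x"
    and mid: "\<And>x y r s. x \<in> C \<Longrightarrow> y \<in> C \<Longrightarrow> J x \<le> ereal r \<Longrightarrow> J y \<le> ereal s \<Longrightarrow>
      (1/2) *\<^sub>R (x + y) \<in> C \<and>
      J ((1/2) *\<^sub>R (x + y)) \<le> ereal ((r + s) / 2 - (norm (x - y))\<^sup>2 / 8)"
    and lsc: "\<And>u x r. (\<And>n. u n \<in> C) \<Longrightarrow> u \<longlonglongrightarrow> x \<Longrightarrow> x \<in> C \<Longrightarrow>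
      (\<And>n. J (u n) \<le> ereal r) \<Longrightarrow> J x \<le> ereal r"
  shows "\<exists>!p. is_arg_min J (\<lambda>x. x \<in> C) p"
proof -
  define I where "I = (INF x\<in>C. J x)"
  have "ereal m \<le> I" "I \<le> J p0"
    using lower p0 by (auto simp: I_def intro: INF_greatest INF_lower)
  with p0 have fin: "\<bar>I\<bar> \<noteq> \<infinity>" by auto
  then obtain i where i: "I = ereal i" by (cases I) auto
  have Ile: "ereal i \<le> J x" if "x \<in> C" for x
    using that unfolding i[symmetric] I_def by (rule INF_lower)
  have close: "(norm (x - y))\<^sup>2 \<le> 4 * (r + s)"
    if "x \<in> C" "y \<in> C" "J x \<le> ereal (i + r)" "J y \<le> ereal (i + s)" for x y r s
  proof -
    have "ereal i \<le> ereal ((i + r + (i + s)) / 2 - (norm (x - y))\<^sup>2 / 8)"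
      using mid[OF that] Ile order_trans by blast
    thus ?thesis by (simp add: field_simps)
  qed
  define v where "v n = inverse (real (Suc n))" for n
  have v: "0 < v n" "k \<le> n \<Longrightarrow> v n \<le> v k" for n k
    by (auto simp: v_def intro!: le_imp_inverse_le)
  have v_small: "\<exists>n. v n < e" if "0 < e" for e
    using reals_Archimedean[OF that] by (simp add: v_def)
  have "\<exists>x\<in>C. J x \<le> ereal (i + v n)" for n
  proof -
    have "I < ereal (i + v n)" by (simp add: i v)
    thus ?thesis unfolding I_def INF_less_iff by (auto intro: less_imp_le)
  qed
  then obtain u where u: "\<And>n. u n \<in> C" "\<And>n. J (u n) \<le> ereal (i + v n)"
    by metis
  have "Cauchy u"
  proof (rule metric_CauchyI)
    fix e :: real assume "0 < e"
    \<comment> \<open>With both excesses below \<open>e\<^sup>2 / 8\<close>, \<open>close\<close>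
      bounds the squared distance by
      \<open>4 * (e\<^sup>2 / 8 + e\<^sup>2 / 8) = e\<^sup>2\<close>.\<close>
    then obtain N where N: "v N < e\<^sup>2 / 8" using v_small[of "e\<^sup>2 / 8"] by auto
    have "dist (u k) (u l) < e" if "k \<ge> N" "l \<ge> N" for k l
    proof -
      have "(norm (u k - u l))\<^sup>2 < e\<^sup>2"
        using N close[OF u(1) u(1) u(2) u(2), of k l] v(2)[OF that(1)] v(2)[OF that(2)]
        unfolding distrib_left by linarith
      with \<open>0 < e\<close> show ?thesis by (simp add: dist_norm power2_less_imp_less)
    qed
    thus "\<exists>N. \<forall>k\<ge>N. \<forall>l\<ge>N. dist (u k) (u l) < e" by blast
  qed
  with C u(1) obtain p where p: "p \<in> C" "u \<longlonglongrightarrow> p"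
    unfolding complete_def by metis
  have "J p \<le> ereal (i + e)" if "0 < e" for e
  proof -
    obtain N where N: "v N < e" using v_small \<open>0 < e\<close> by blast
    \<comment> \<open>Dropping the first \<open>N\<close> terms puts the whole sequence under one
      level, as \<open>lsc\<close> requires.\<close>
    have "J (u (n + N)) \<le> ereal (i + e)" for n
      using N v(2)[of N "n + N"] by (intro order_trans[OF u(2)]) simp
    thus ?thesis by (rule lsc[OF u(1) LIMSEQ_ignore_initial_segment[OF p(2)] p(1)])
  qed
  hence Jp: "J p \<le> ereal i"
    using ereal_le_epsilon2[of "J p" "ereal i"] by (simp only: plus_ereal.simps)
  have "\<not> J y < J p" if "y \<in> C" for y
    using order_trans[OF Jp Ile[OF that]] by (simp only: not_less)
  with p(1) have "is_arg_min J (\<lambda>x. x \<in> C) p" by (simp add: is_arg_min_def)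
  moreover have "r = p" if "is_arg_min J (\<lambda>x. x \<in> C) r" for r
  proof -
    have r: "r \<in> C" "J r \<le> J p"
      using that p(1) by (auto simp: is_arg_min_def not_less)
    hence "J r \<le> ereal (i + 0)" "J p \<le> ereal (i + 0)"
      using Jp order_trans[of "J r" "J p" "ereal i"] by (simp_all only: add_0_right)
    have "(norm (r - p))\<^sup>2 \<le> 4 * (0 + 0)"
      using r(1) p(1) by (rule close) fact+
    thus ?thesis by simp
  qed
  ultimately show ?thesis by (rule ex1I)
qed

text \<open>The parallelogram law in midpoint form; half of its last term is the \<open>/ 8\<close>
  demanded by \<open>mid\<close>.\<close>

lemma norm_midpoint_sq:
  fixes x y :: "'a::real_inner"
  shows "(norm ((1/2) *\<^sub>R (x + y)))\<^sup>2 = ((norm x)\<^sup>2 + (norm y)\<^sup>2) / 2 - (norm (x - y))\<^sup>2 / 4"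
  by (simp add: power2_norm_eq_inner inner_simps inner_commute field_simps)

text \<open>Half the squared distance has convexity modulus exactly 1. The inequality comes from
  moving the minimizer a fraction \<open>t\<close> towards \<open>y\<close>, dividing by
  \<open>t\<close> and letting \<open>t\<close> tend to 0.\<close>

lemma closest_point_variational:
  fixes C :: "'a::real_inner set"
  assumes "complete C" "convex C" "C \<noteq> {}"
  shows "\<exists>p\<in>C. \<forall>y\<in>C. inner (y - p) (x - p) \<le> 0"
proof -
  let ?J = "\<lambda>y. ereal (1/2 * (norm (y - x))\<^sup>2)"
  obtain p0 where "p0 \<in> C" using assms by auto
  have "\<exists>!p. is_arg_min ?J (\<lambda>y. y \<in> C) p"
  proof (rule strongly_convex_ex1_arg_min[OF assms(1) \<open>p0 \<in> C\<close>, of _ 0])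
    fix a b r s
    assume ab: "a \<in> C" "b \<in> C" and "?J a \<le> ereal r" "?J b \<le> ereal s"
    hence "1/2 * (norm (a - x))\<^sup>2 \<le> r" "1/2 * (norm (b - x))\<^sup>2 \<le> s" by auto
    moreover have "(1/2) *\<^sub>R (a + b) - x = (1/2) *\<^sub>R ((a - x) + (b - x))"
      by (simp add: algebra_simps flip: scaleR_add_left)
    ultimately have "1/2 * (norm ((1/2) *\<^sub>R (a + b) - x))\<^sup>2 \<le> (r + s) / 2 - (norm (a - b))\<^sup>2 / 8"
      using norm_midpoint_sq[of "a - x" "b - x"] by (simp add: algebra_simps)
    moreover have "(1/2) *\<^sub>R (a + b) \<in> C"
      using convexD[OF assms(2) ab, of "1/2" "1/2"] by (simp add: scaleR_add_right)
    ultimately show "(1/2) *\<^sub>R (a + b) \<in> C \<and>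
        ?J ((1/2) *\<^sub>R (a + b)) \<le> ereal ((r + s) / 2 - (norm (a - b))\<^sup>2 / 8)" by simp
  next
    fix u y r assume "u \<longlonglongrightarrow> y" and le: "\<And>n. ?J (u n) \<le> ereal r"
    hence "(\<lambda>n. 1/2 * (norm (u n - x))\<^sup>2) \<longlonglongrightarrow> 1/2 * (norm (y - x))\<^sup>2"
      by (intro tendsto_intros)
    moreover from le have "\<exists>N. \<forall>n\<ge>N. 1/2 * (norm (u n - x))\<^sup>2 \<le> r" by simp
    ultimately show "?J y \<le> ereal r" unfolding ereal_less_eq by (rule LIMSEQ_le_const2)
  qed auto
  then obtain p where p: "p \<in> C" and min: "\<And>y. y \<in> C \<Longrightarrow> (norm (p - x))\<^sup>2 \<le> (norm (y - x))\<^sup>2"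
    by (auto simp: is_arg_min_def not_less)
  have "inner (y - p) (x - p) \<le> 0" if y: "y \<in> C" for y
  proof -
    have "2 * inner (y - p) (x - p) \<le> 0"
    proof (rule nonpos_if_le_small)
      fix t :: real assume t: "0 < t" "t < 1"
      have "(1 - t) *\<^sub>R p + t *\<^sub>R y \<in> C" using t p y assms(2) by (intro convexD) auto
      from min[OF this] have "(norm (p - x))\<^sup>2 \<le> (norm ((p - x) + t *\<^sub>R (y - p)))\<^sup>2"
        by (simp add: algebra_simps)
      also have "\<dots> = (norm (p - x))\<^sup>2 - t * (2 * inner (y - p) (x - p) - t * (norm (y - p))\<^sup>2)"
        by (simp only: power2_norm_eq_inner) (simp add: inner_simps inner_commute algebra_simps)
      finally have "t * (2 * inner (y - p) (x - p) - t * (norm (y - p))\<^sup>2) \<le> 0" by simp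
      thus "2 * inner (y - p) (x - p) \<le> t * (norm (y - p))\<^sup>2"
        using t by (simp add: mult_le_0_iff)
    qed
    thus ?thesis by simp
  qed
  with p show ?thesis by blast
qed

section \<open>Complete subspaces: orthogonal projection and Riesz representation\<close>

lemma hilbert_subspaceD:
  assumes "hilbert_subspace S"
  shows "subspace S" "complete S" "convex S" "closed S" "S \<noteq> {}"
  using assms unfolding hilbert_subspace_def
  by (auto simp: subspace_imp_convex complete_imp_closed dest: subspace_0)

lemma subspace_scale_add:
  assumes "subspace S" "x \<in> S" "y \<in> S"
  shows "x + t *\<^sub>R y \<in> S"
  using assms by (simp add: subspace_add subspace_scale)

lemma orthogonal_projection_exists:
  assumes "subspace S" "complete S"
  shows "\<exists>p\<in>S. \<forall>y\<in>S. inner y (x - p) = 0"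
proof -
  obtain p where p: "p \<in> S" "\<And>y. y \<in> S \<Longrightarrow> inner (y - p) (x - p) \<le> 0"
    using closest_point_variational[OF assms(2) subspace_imp_convex[OF assms(1)]] assms
    by (metis empty_iff subspace_0)
  have "inner y (x - p) = 0" if "y \<in> S" for y
    using p(2)[of "p + y"] p(2)[of "p - y"] that p(1) assms
    by (simp add: subspace_add subspace_diff)
  with p(1) show ?thesis by blast
qed

lemma bounded_linear_betweenD:
  assumes "bounded_linear_between S T A"
  shows "\<And>x. x \<in> S \<Longrightarrow> A x \<in> T"
    and "\<And>x y. x \<in> S \<Longrightarrow> y \<in> S \<Longrightarrow> A (x + y) = A x + A y"
    and "\<And>c x. x \<in> S \<Longrightarrow> A (c *\<^sub>R x) = c *\<^sub>R A x"
    and "\<exists>B. \<forall>x\<in>S. norm (A x) \<le> B * norm x"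
  using assms unfolding bounded_linear_between_def by auto

lemma bounded_linear_between_diff:
  assumes "bounded_linear_between S T A" "subspace S" "x \<in> S" "y \<in> S"
  shows "A (x - y) = A x - A y"
proof -
  have "A (x + (-1) *\<^sub>R y) = A x + (-1) *\<^sub>R A y"
    using assms bounded_linear_betweenD(2,3)[OF assms(1)] subspace_scale by metis
  thus ?thesis by simp
qed

lemma bounded_linear_between_lipschitz:
  assumes "bounded_linear_between S T A" "subspace S"
  shows "\<exists>B. B-lipschitz_on S A"
proof -
  obtain B where B: "\<And>x. x \<in> S \<Longrightarrow> norm (A x) \<le> B * norm x"
    using bounded_linear_betweenD(4)[OF assms(1)] by blast
  \<comment> \<open>The absolute value is taken because \<open>B\<close> may be negative when the
    carrier is trivial.\<close>
  have "dist (A x) (A y) \<le> \<bar>B\<bar> * dist x y" if "x \<in> S" "y \<in> S" for x y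
  proof -
    have "dist (A x) (A y) \<le> B * norm (x - y)"
      using B[of "x - y"] that assms by (simp add: dist_norm bounded_linear_between_diff subspace_diff)
    also have "\<dots> \<le> \<bar>B\<bar> * dist x y" by (simp add: dist_norm mult_right_mono)
    finally show ?thesis .
  qed
  thus ?thesis by (intro exI lipschitz_onI) auto
qed

text \<open>The representing vector minimizes \<open>(norm x)\<^sup>2 / 2 - A x\<close>.\<close>

theorem riesz_representation:
  fixes A :: "'a::real_inner \<Rightarrow> real"
  assumes S: "hilbert_subspace S" and A: "bounded_linear_between S UNIV A"
  shows "\<exists>!g. g \<in> S \<and> (\<forall>x\<in>S. A x = inner x g)"
proof -
  note S' = hilbert_subspaceD[OF S]
  note A' = bounded_linear_betweenD[OF A]
  obtain B where B: "\<And>x. x \<in> S \<Longrightarrow> \<bar>A x\<bar> \<le> B * norm x" using A'(4) by auto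
  let ?J = "\<lambda>x. ereal (1/2 * (norm x)\<^sup>2 - A x)"
  have "\<exists>!p. is_arg_min ?J (\<lambda>y. y \<in> S) p"
  \<comment> \<open>The lower bound \<open>- B\<^sup>2 / 2\<close> is the minimum of
    \<open>r\<^sup>2 / 2 - B * r\<close> over real \<open>r\<close>.\<close>
  proof (rule strongly_convex_ex1_arg_min[OF S'(2) subspace_0[OF S'(1)], of _ "- B\<^sup>2 / 2"])
    fix x assume "x \<in> S"
    have "0 \<le> (norm x - B)\<^sup>2" by simp
    hence "- B\<^sup>2 / 2 \<le> 1/2 * (norm x)\<^sup>2 - B * norm x" by (simp add: power2_eq_square algebra_simps)
    with B[OF \<open>x \<in> S\<close>] show "ereal (- B\<^sup>2 / 2) \<le> ?J x" by simp
  next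
    fix a b r s assume ab: "a \<in> S" "b \<in> S" and "?J a \<le> ereal r" "?J b \<le> ereal s"
    thus "(1/2) *\<^sub>R (a + b) \<in> S \<and>
        ?J ((1/2) *\<^sub>R (a + b)) \<le> ereal ((r + s) / 2 - (norm (a - b))\<^sup>2 / 8)"
      using S'(1) norm_midpoint_sq[of a b]
      by (simp add: subspace_add subspace_scale A'(2,3) algebra_simps)
  next
    fix u y r assume u: "\<And>n. u n \<in> S" "u \<longlonglongrightarrow> y" "y \<in> S" and le: "\<And>n. ?J (u n) \<le> ereal r"
    obtain K where "K-lipschitz_on S A" using bounded_linear_between_lipschitz[OF A S'(1)] by blast
    hence "continuous_on S A" by (rule lipschitz_on_continuous_on)
    with u have "(\<lambda>n. A (u n)) \<longlonglongrightarrow> A y" by (intro continuous_on_tendsto_compose[of S A]) auto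
    with u have "(\<lambda>n. 1/2 * (norm (u n))\<^sup>2 - A (u n)) \<longlonglongrightarrow> 1/2 * (norm y)\<^sup>2 - A y"
      by (intro tendsto_intros)
    moreover from le have "\<exists>N. \<forall>n\<ge>N. 1/2 * (norm (u n))\<^sup>2 - A (u n) \<le> r" by simp
    ultimately show "?J y \<le> ereal r" unfolding ereal_less_eq by (rule LIMSEQ_le_const2)
  qed auto
  then obtain g where g: "g \<in> S" and min: "\<And>y. y \<in> S \<Longrightarrow> 1/2 * (norm g)\<^sup>2 - A g \<le> 1/2 * (norm y)\<^sup>2 - A y"
    by (auto simp: is_arg_min_def not_less)
  have "A d = inner d g" if d: "d \<in> S" for d
  proof -
    have *: "0 \<le> t * (inner d g - A d) + t\<^sup>2 * ((norm d)\<^sup>2 / 2)" for t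
    proof -
      have "1/2 * (norm g)\<^sup>2 - A g \<le> 1/2 * (norm (g + t *\<^sub>R d))\<^sup>2 - A (g + t *\<^sub>R d)"
        using g d S'(1) by (intro min subspace_scale_add)
      also have "A (g + t *\<^sub>R d) = A g + t * A d"
        using g d S'(1) by (simp add: A'(2,3) subspace_scale)
      also have "(norm (g + t *\<^sub>R d))\<^sup>2 = (norm g)\<^sup>2 + 2 * t * inner d g + t\<^sup>2 * (norm d)\<^sup>2"
        by (simp only: power2_norm_eq_inner)
           (simp add: inner_simps inner_commute power2_eq_square algebra_simps)
      finally show ?thesis by (simp add: algebra_simps)
    qed
    define c where "c = inner d g - A d"
    \<comment> \<open>The trial value \<open>t = - c / k\<close> leaves exactly
      \<open>- c\<^sup>2 / k\<^sup>2\<close>; the summand 1 keeps \<open>k\<close> positive even for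
      \<open>d = 0\<close>.\<close>
    define k where "k = (norm d)\<^sup>2 / 2 + 1"
    have "k > 0" by (simp add: k_def add_nonneg_pos)
    have "0 \<le> (- c / k) * c + (- c / k)\<^sup>2 * (k - 1)"
      using *[of "- c / k"] by (simp add: c_def k_def)
    also have "\<dots> = - c\<^sup>2 / k\<^sup>2" using \<open>k > 0\<close> by (simp add: field_simps power2_eq_square)
    finally have "c\<^sup>2 / k\<^sup>2 \<le> 0" by simp
    hence "c = 0" using \<open>k > 0\<close> by (simp add: divide_le_0_iff)
    thus ?thesis by (simp add: c_def)
  qed
  note gA = this
  have "g' = g" if g': "g' \<in> S" "\<And>x. x \<in> S \<Longrightarrow> A x = inner x g'" for g'
  proof -
    have "g' - g \<in> S" using g g'(1) S'(1) by (simp add: subspace_diff)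
    from gA[OF this] g'(2)[OF this] have "inner (g' - g) (g' - g) = 0"
      by (simp only: inner_diff_right)
    thus ?thesis by simp
  qed
  with g gA show ?thesis by blast
qed

section \<open>Subdifferentials and proximity operators\<close>

lemma subdifferential_onD:
  assumes "u \<in> subdifferential_on S f x"
  shows "u \<in> S" "\<And>y. y \<in> S \<Longrightarrow> ereal (inner (y - x) u) + f x \<le> f y"
  using assms by (auto simp: subdifferential_on_def)

text \<open>An infinite value at a point that has a subgradient would propagate to the whole
  carrier.\<close>

lemma subdifferential_on_finite:
  assumes "\<exists>z\<in>S. f z \<noteq> \<infinity>" "f x \<noteq> -\<infinity>" "u \<in> subdifferential_on S f x"
  shows "\<bar>f x\<bar> \<noteq> \<infinity>"
proof -
  from assms obtain z where z: "z \<in> S" "f z \<noteq> \<infinity>" by blast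
  have "f x \<noteq> \<infinity>" using subdifferential_onD(2)[OF assms(3) z(1)] z(2) by auto
  with assms(2) show ?thesis by auto
qed

lemma subdifferential_on_monotone:
  assumes f: "\<exists>z\<in>S. f z \<noteq> \<infinity>" "f x \<noteq> -\<infinity>" "f y \<noteq> -\<infinity>"
    and u: "u \<in> subdifferential_on S f x" "v \<in> subdifferential_on S f y"
    and "x \<in> S" "y \<in> S"
  shows "0 \<le> inner (x - y) (u - v)"
proof -
  obtain r s where "f x = ereal r" "f y = ereal s"
    using subdifferential_on_finite[OF f(1,2) u(1)] subdifferential_on_finite[OF f(1,3) u(2)]
    by (cases "f x"; cases "f y") auto
  thus ?thesis
    using subdifferential_onD(2)[OF u(1) \<open>y \<in> S\<close>] subdifferential_onD(2)[OF u(2) \<open>x \<in> S\<close>]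
    by (simp add: inner_diff_left inner_diff_right)
qed

lemma proper_lsc_convexD:
  assumes "proper_lsc_convex S f"
  shows "\<And>x. x \<in> S \<Longrightarrow> f x \<noteq> -\<infinity>" "\<exists>x\<in>S. f x \<noteq> \<infinity>"
    "\<And>x. x \<in> S \<Longrightarrow> f x \<le> Liminf (at x within S) f"
    "\<And>x y t. x \<in> S \<Longrightarrow> y \<in> S \<Longrightarrow> 0 < t \<Longrightarrow> t < 1 \<Longrightarrow>
       f ((1 - t) *\<^sub>R x + t *\<^sub>R y) \<le> ereal (1 - t) * f x + ereal t * f y"
  using assms unfolding proper_lsc_convex_def by auto

lemma closed_sublevel_if_lsc:
  fixes f :: "'a::metric_space \<Rightarrow> ereal"
  assumes "closed S" and lsc: "\<And>x. x \<in> S \<Longrightarrow> f x \<le> Liminf (at x within S) f"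
  shows "closed {x \<in> S. f x \<le> c}"
proof (unfold closed_sequential_limits, intro allI impI, elim conjE)
  fix u l assume u: "\<forall>n. u n \<in> {x \<in> S. f x \<le> c}" and ul: "u \<longlonglongrightarrow> l"
  have l: "l \<in> S" using \<open>closed S\<close> u ul closed_sequentially by blast
  have "f l \<le> c"
  proof (rule ccontr)
    assume neg: "\<not> f l \<le> c"
    hence "\<forall>\<^sub>F x in at l within S. c < f x"
      using lsc[OF l] by (auto intro: less_LiminfD)
    then obtain d where d: "d > 0" "\<And>x. x \<in> S \<Longrightarrow> x \<noteq> l \<Longrightarrow> dist x l < d \<Longrightarrow> c < f x"
      unfolding eventually_at by blast
    then obtain n where "dist (u n) l < d" using ul metric_LIMSEQ_D by blast
    moreover have "u n \<in> S" "f (u n) \<le> c" using u by auto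
    \<comment> \<open>The neighbourhood obtained from \<open>Liminf\<close> is punctured, so the
      case \<open>u n = l\<close> is refuted separately, by \<open>neg\<close> itself.\<close>
    ultimately show False using d(2)[of "u n"] neg by (cases "u n = l") (auto simp: not_less)
  qed
  with l show "l \<in> {x \<in> S. f x \<le> c}" by simp
qed

lemma convex_sublevel:
  assumes f: "proper_lsc_convex S f" and "convex S"
  shows "convex {x \<in> S. f x \<le> ereal c}"
  unfolding convex_alt
proof (intro ballI allI impI)
  fix x y and t :: real
  assume x: "x \<in> {x \<in> S. f x \<le> ereal c}" and y: "y \<in> {x \<in> S. f x \<le> ereal c}"
    and t: "0 \<le> t \<and> t \<le> 1"
  show "(1 - t) *\<^sub>R x + t *\<^sub>R y \<in> {x \<in> S. f x \<le> ereal c}"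
  proof (cases "t = 0 \<or> t = 1")
    case False
    with t have t': "0 < t" "t < 1" by auto
    have "f ((1 - t) *\<^sub>R x + t *\<^sub>R y) \<le> ereal (1 - t) * f x + ereal t * f y"
      using x y t' by (intro proper_lsc_convexD(4)[OF f]) auto
    also have "\<dots> \<le> ereal (1 - t) * ereal c + ereal t * ereal c"
      using x y t' by (intro add_mono ereal_mult_left_mono) auto
    also have "\<dots> = ereal c" by (simp add: algebra_simps)
    finally show ?thesis using x y t \<open>convex S\<close> by (auto simp: convex_alt)
  qed (use x y in auto)
qed

section \<open>Weak lower semicontinuity of convex functions\<close>

lemma weakly_converges_in_tendsto:
  assumes "weakly_converges_in S X l"
  shows "\<And>n. X n \<in> S" "l \<in> S" "\<And>w. w \<in> S \<Longrightarrow> (\<lambda>n. inner (X n) w) \<longlonglongrightarrow> inner l w"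
  using assms by (auto simp: weakly_converges_in_def)

lemma weakly_converges_in_strong:
  assumes "\<And>n. X n \<in> S" "l \<in> S" "X \<longlonglongrightarrow> l"
  shows "weakly_converges_in S X l"
  using assms by (auto simp: weakly_converges_in_def intro: tendsto_intros)

text \<open>The weak limit is its own projection onto every closed convex set that the sequence
  visits infinitely often.\<close>

lemma weak_lsc:
  assumes S: "hilbert_subspace S" and f: "proper_lsc_convex S f"
    and X: "weakly_converges_in S X l"
  shows "f l \<le> liminf (\<lambda>n. f (X n))"
proof (rule ccontr)
  note S' = hilbert_subspaceD[OF S] and X' = weakly_converges_in_tendsto[OF X]
  assume "\<not> f l \<le> liminf (\<lambda>n. f (X n))"
  then obtain c where c: "liminf (\<lambda>n. f (X n)) < ereal c" "ereal c < f l"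
    using ereal_dense2 by (auto simp: not_le)
  let ?C = "{x \<in> S. f x \<le> ereal c}"
  \<comment> \<open>Infinitely many terms below \<open>c\<close> suffice: if \<open>l\<close>
    differed from its projection \<open>p\<close>, the projection inequality would exclude a whole
    tail of the sequence from the sublevel set.\<close>
  have freq: "\<exists>\<^sub>F n in sequentially. f (X n) \<le> ereal c"
  proof (rule ccontr)
    assume "\<not> (\<exists>\<^sub>F n in sequentially. f (X n) \<le> ereal c)"
    hence "\<forall>\<^sub>F n in sequentially. ereal c \<le> f (X n)"
      by (auto simp: not_frequently elim: eventually_mono)
    from Liminf_bounded[OF this] c show False by simp
  qed
  then obtain n where "X n \<in> ?C" using X'(1) by (auto dest: frequently_ex)
  moreover have "closed ?C" by (rule closed_sublevel_if_lsc[OF S'(4) proper_lsc_convexD(3)[OF f]])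
  hence "complete ?C"
    using complete_closed_subset[OF _ _ S'(2)] by blast
  ultimately obtain p where p: "p \<in> ?C" "\<And>y. y \<in> ?C \<Longrightarrow> inner (y - p) (l - p) \<le> 0"
    using closest_point_variational[of ?C l] convex_sublevel[OF f S'(3)] by blast
  have "(\<lambda>n. inner (X n) (l - p) - inner p (l - p)) \<longlonglongrightarrow> inner l (l - p) - inner p (l - p)"
    using p(1) X' S'(1) by (intro tendsto_intros X'(3)) (simp add: subspace_diff)
  hence lim: "(\<lambda>n. inner (X n - p) (l - p)) \<longlonglongrightarrow> inner (l - p) (l - p)"
    by (simp add: inner_diff_left)
  have "\<not> 0 < inner (l - p) (l - p)"
  proof
    assume "0 < inner (l - p) (l - p)"
    from order_tendstoD(1)[OF lim this] have "\<forall>\<^sub>F n in sequentially. \<not> f (X n) \<le> ereal c"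
    proof eventually_elim
      case (elim n)
      with p(2)[of "X n"] X'(1)[of n] show ?case by auto
    qed
    with freq show False by (simp add: frequently_def)
  qed
  hence "l = p" by simp
  with p(1) c(2) show False by auto
qed

text \<open>The subgradient \<open>u0\<close> at \<open>x0\<close> provides an affine minorant of
  \<open>f\<close>; adding the quadratic term makes the objective bounded below, which gives
  existence of the proximal point. The inclusion is then the first-order optimality
  condition.\<close>

theorem prox_on_subgradient:
  assumes S: "hilbert_subspace S" and f: "proper_lsc_convex S f" and "0 < c" and x: "x \<in> S"
    and u0: "u0 \<in> subdifferential_on S f x0" "x0 \<in> S"
  defines "p \<equiv> prox_on S (\<lambda>t. ereal c * f t) x"
  shows "p \<in> S" "inverse c *\<^sub>R (x - p) \<in> subdifferential_on S f p"
proof -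
  note S' = hilbert_subspaceD[OF S] and f' = proper_lsc_convexD[OF f]
  let ?J = "\<lambda>y. ereal c * f y + ereal (1/2 * (norm (y - x))\<^sup>2)"
  have J_le: "f y \<le> ereal ((r - 1/2 * (norm (y - x))\<^sup>2) / c)" if "y \<in> S" "?J y \<le> ereal r" for y r
    using that f'(1)[OF that(1)] \<open>0 < c\<close> by (cases "f y") (auto simp: field_simps)
  obtain f0 where f0: "f x0 = ereal f0"
    using subdifferential_on_finite[OF f'(2) f'(1)[OF u0(2)] u0(1)] by auto
  have ex1: "\<exists>!p. is_arg_min ?J (\<lambda>y. y \<in> S) p"
  \<comment> \<open>The value of \<open>m\<close> is the minimum over \<open>y\<close> of the scaled
    affine minorant plus the quadratic term. Completing the square shows it, with equality at
    \<open>y - x = - c *\<^sub>R u0\<close>.\<close>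
  proof (rule strongly_convex_ex1_arg_min[OF S'(2) u0(2), where m = "c * (f0 + inner (x - x0) u0) - c\<^sup>2 * (norm u0)\<^sup>2 / 2"])
    show "?J x0 \<noteq> \<infinity>" by (simp add: f0)
  next
    fix y assume y: "y \<in> S"
    have "0 \<le> (norm (y - x + c *\<^sub>R u0))\<^sup>2" by simp
    also have "\<dots> = (norm (y - x))\<^sup>2 + 2 * c * inner (y - x) u0 + c\<^sup>2 * (norm u0)\<^sup>2"
      by (simp only: power2_norm_eq_inner)
         (simp add: inner_add inner_commute power2_eq_square algebra_simps)
    finally have "c * (f0 + inner (x - x0) u0) - c\<^sup>2 * (norm u0)\<^sup>2 / 2
        \<le> c * (inner (y - x0) u0 + f0) + 1/2 * (norm (y - x))\<^sup>2"
      by (simp add: inner_diff_left algebra_simps)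
    moreover have "ereal (inner (y - x0) u0 + f0) \<le> f y"
      using subdifferential_onD(2)[OF u0(1) y] f0 by simp
    ultimately show "ereal (c * (f0 + inner (x - x0) u0) - c\<^sup>2 * (norm u0)\<^sup>2 / 2) \<le> ?J y"
      using \<open>0 < c\<close> by (cases "f y") (auto intro: order_trans add_mono mult_left_mono)
  next
    fix a b r s assume ab: "a \<in> S" "b \<in> S" and J: "?J a \<le> ereal r" "?J b \<le> ereal s"
    have mid: "(1/2) *\<^sub>R (a + b) \<in> S" using ab S'(1) by (simp add: subspace_add subspace_scale)
    obtain fa fb where fab: "f a = ereal fa" "f b = ereal fb"
      using J_le[OF ab(1) J(1)] J_le[OF ab(2) J(2)] f'(1) ab
      by (metis ereal_infty_less_eq(1) MInfty_neq_ereal(1) ereal_cases PInfty_neq_ereal(2))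
    have "f ((1/2) *\<^sub>R (a + b)) \<le> ereal ((fa + fb) / 2)"
      using f'(4)[OF ab, of "1/2"] by (simp add: fab scaleR_add_right add_divide_distrib)
    moreover have "f ((1/2) *\<^sub>R (a + b)) \<noteq> -\<infinity>" using f'(1) mid by blast
    ultimately obtain fm where fm: "f ((1/2) *\<^sub>R (a + b)) = ereal fm" "fm \<le> (fa + fb) / 2"
      by (cases "f ((1/2) *\<^sub>R (a + b))") auto
    have "(1/2) *\<^sub>R (a + b) - x = (1/2) *\<^sub>R ((a - x) + (b - x))"
      by (simp add: algebra_simps flip: scaleR_add_left)
    moreover have "c * fm \<le> c * ((fa + fb) / 2)" using \<open>0 < c\<close> fm(2) by (simp only: mult_left_mono)
    moreover have "c * fa + 1/2 * (norm (a - x))\<^sup>2 \<le> r" "c * fb + 1/2 * (norm (b - x))\<^sup>2 \<le> s"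
      using J by (simp_all add: fab)
    ultimately have "c * fm + 1/2 * (norm ((1/2) *\<^sub>R (a + b) - x))\<^sup>2 \<le> (r + s) / 2 - (norm (a - b))\<^sup>2 / 8"
      using norm_midpoint_sq[of "a - x" "b - x"] by (simp add: algebra_simps)
    with mid show "(1/2) *\<^sub>R (a + b) \<in> S \<and>
        ?J ((1/2) *\<^sub>R (a + b)) \<le> ereal ((r + s) / 2 - (norm (a - b))\<^sup>2 / 8)"
      by (simp add: fm)
  next
    fix u y r assume u: "\<And>n. u n \<in> S" "u \<longlonglongrightarrow> y" "y \<in> S" and J: "\<And>n. ?J (u n) \<le> ereal r"
    \<comment> \<open>Norm convergence is weak convergence, and it also gives the quadratic term a
      limit, so the bound on \<open>?J\<close> can be read as a bound on \<open>f\<close> alone and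
      passed to the limit.\<close>
    have "f y \<le> liminf (\<lambda>n. f (u n))"
      using weak_lsc[OF S f weakly_converges_in_strong[OF u(1,3,2)]] .
    also have "\<dots> \<le> liminf (\<lambda>n. ereal ((r - 1/2 * (norm (u n - x))\<^sup>2) / c))"
      using J_le[OF u(1) J] by (intro Liminf_mono) auto
    also have "\<dots> = ereal ((r - 1/2 * (norm (y - x))\<^sup>2) / c)"
      using \<open>0 < c\<close> by (intro lim_imp_Liminf tendsto_intros u(2)) auto
    finally show "?J y \<le> ereal r"
      using \<open>0 < c\<close> f'(1)[OF u(3)] by (cases "f y") (auto simp: field_simps)
  qed
  hence argmin: "is_arg_min ?J (\<lambda>y. y \<in> S) p"
    unfolding p_def prox_on_def by (rule theI')
  thus pS: "p \<in> S" by (simp add: is_arg_min_def)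
  have min: "?J p \<le> ?J y" if "y \<in> S" for y
    using argmin that by (simp add: is_arg_min_def not_less)
  obtain fp where fp: "f p = ereal fp"
    using min[OF u0(2)] f'(1)[OF pS] f0 \<open>0 < c\<close> by (cases "f p") auto
  show "inverse c *\<^sub>R (x - p) \<in> subdifferential_on S f p"
    unfolding subdifferential_on_def
  proof (intro CollectI conjI ballI)
    show "inverse c *\<^sub>R (x - p) \<in> S" using x pS S'(1) by (simp add: subspace_diff subspace_scale)
    fix y assume y: "y \<in> S"
    show "ereal (inner (y - p) (inverse c *\<^sub>R (x - p))) + f p \<le> f y"
    proof (cases "f y")
      case (real fy)
      \<comment> \<open>The minimality of \<open>p\<close> is tested on the segment towards
        \<open>y\<close>. Convexity makes the change of \<open>f\<close> linear in \<open>t\<close>,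
        while the leftover of the quadratic is of second order.\<close>
      have "c * (fp - fy) + inner (y - p) (x - p) \<le> 0"
      proof (rule nonpos_if_le_small)
        fix t :: real assume t: "0 < t" "t < 1"
        let ?z = "(1 - t) *\<^sub>R p + t *\<^sub>R y"
        have zS: "?z \<in> S" using pS y S'(1) by (simp add: subspace_add subspace_scale)
        have le: "f ?z \<le> ereal ((1 - t) * fp + t * fy)"
          using f'(4)[OF pS y t] by (simp add: fp real)
        then obtain fz where fz: "f ?z = ereal fz" "fz \<le> (1 - t) * fp + t * fy"
          using f'(1)[OF zS] by (cases "f ?z") auto
        have "c * fp + 1/2 * (norm (p - x))\<^sup>2 \<le> c * fz + 1/2 * (norm (?z - x))\<^sup>2"
          using min[OF zS] by (simp add: fp fz)
        also have "\<dots> \<le> c * ((1 - t) * fp + t * fy) + 1/2 * (norm (?z - x))\<^sup>2"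
          using fz(2) \<open>0 < c\<close> by simp
        also have "?z - x = (p - x) + t *\<^sub>R (y - p)" by (simp add: algebra_simps)
        also have "(norm \<dots>)\<^sup>2 = (norm (p - x))\<^sup>2 - 2 * t * inner (y - p) (x - p) + t\<^sup>2 * (norm (y - p))\<^sup>2"
          by (simp only: power2_norm_eq_inner)
             (simp add: inner_add inner_diff inner_commute power2_eq_square algebra_simps)
        finally have "t * (c * (fp - fy) + inner (y - p) (x - p)) \<le> t * (t * (norm (y - p))\<^sup>2 / 2)"
          by (simp add: algebra_simps power2_eq_square)
        with t show "c * (fp - fy) + inner (y - p) (x - p) \<le> t * ((norm (y - p))\<^sup>2 / 2)" by simp
      qed
      with \<open>0 < c\<close> have "fp + inner (y - p) (x - p) / c \<le> fy" by (simp add: field_simps)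
      thus ?thesis by (simp add: fp real divide_inverse_commute add.commute)
    qed (use f'(1)[OF y] in auto)
  qed
qed

section \<open>Gradients and adjoints\<close>

lemma has_gateaux_derivative_onD:
  assumes "has_gateaux_derivative_on S f f' x"
  shows "bounded_linear_between S UNIV f'"
    "\<And>d. d \<in> S \<Longrightarrow> ((\<lambda>t. (f (x + t *\<^sub>R d) - f x) / t) \<longlongrightarrow> f' d) (at_right 0)"
  using assms by (auto simp: has_gateaux_derivative_on_def)

lemma bounded_linear_between_inner:
  "bounded_linear_between S UNIV (\<lambda>d. inner d g)"
proof -
  have "\<bar>inner d g\<bar> \<le> norm g * norm d" for d
    using Cauchy_Schwarz_ineq2[of d g] by (simp add: mult.commute)
  thus ?thesis
    unfolding bounded_linear_between_def by (auto simp: inner_add_left)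
qed

lemma bounded_linear_imp_between:
  assumes "bounded_linear A"
  shows "bounded_linear_between S UNIV A"
proof -
  interpret bounded_linear A by fact
  show ?thesis
    unfolding bounded_linear_between_def
    using bounded by (auto simp: add scaleR mult.commute)
qed

lemma has_gateaux_derivative_on_unique:
  assumes "has_gateaux_derivative_on S f f' x" "has_gateaux_derivative_on S f f'' x" "d \<in> S"
  shows "f' d = f'' d"
  using tendsto_unique[OF _ has_gateaux_derivative_onD(2)[OF assms(1,3)]
      has_gateaux_derivative_onD(2)[OF assms(2,3)]] by simp

lemma eq_if_inner_eq_on_subspace:
  assumes "subspace S" "g \<in> S" "g' \<in> S" "\<And>d. d \<in> S \<Longrightarrow> inner d g = inner d g'"
  shows "g = g'"
proof -
  have "inner (g - g') g = inner (g - g') g'" using assms by (simp add: subspace_diff)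
  hence "inner (g - g') (g - g') = 0" by (simp only: inner_diff_right)
  thus ?thesis by simp
qed

text \<open>Riesz representation turns the derivative into a vector of the carrier, and the
  directional limits determine that vector, so the definite description denotes it.\<close>

lemma gateaux_gradient_on:
  assumes S: "hilbert_subspace S" and f: "has_gateaux_derivative_on S f f' x"
  shows "gateaux_gradient_on S f x \<in> S"
    "has_gateaux_derivative_on S f (\<lambda>d. inner d (gateaux_gradient_on S f x)) x"
proof -
  obtain g where g: "g \<in> S" "\<And>d. d \<in> S \<Longrightarrow> f' d = inner d g"
    using riesz_representation[OF S has_gateaux_derivative_onD(1)[OF f]] by blast
  have 1: "g \<in> S \<and> has_gateaux_derivative_on S f (\<lambda>d. inner d g) x"
    using g f by (auto simp: has_gateaux_derivative_on_def bounded_linear_between_inner)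
  have "gateaux_gradient_on S f x \<in> S \<and>
        has_gateaux_derivative_on S f (\<lambda>d. inner d (gateaux_gradient_on S f x)) x"
    unfolding gateaux_gradient_on_def
  proof (rule theI[of _ g])
    fix g' assume 2: "g' \<in> S \<and> has_gateaux_derivative_on S f (\<lambda>d. inner d g') x"
    have "inner d g' = inner d g" if "d \<in> S" for d
      using has_gateaux_derivative_on_unique[OF conjunct2[OF 2] conjunct2[OF 1] that] .
    thus "g' = g"
      using 1 2 hilbert_subspaceD(1)[OF S] by (intro eq_if_inner_eq_on_subspace[of S]) auto
  qed (rule 1)
  thus "gateaux_gradient_on S f x \<in> S"
    "has_gateaux_derivative_on S f (\<lambda>d. inner d (gateaux_gradient_on S f x)) x" by auto
qed

lemma has_derivative_imp_gateaux:
  assumes S: "subspace S" and x: "x \<in> S" and f: "(f has_derivative A) (at x within S)"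
  shows "has_gateaux_derivative_on S f A x"
  unfolding has_gateaux_derivative_on_def
proof (intro conjI ballI)
  show "bounded_linear_between S UNIV A"
    using has_derivative_bounded_linear[OF f] by (rule bounded_linear_imp_between)
  fix d assume d: "d \<in> S"
  have "((\<lambda>t::real. x + t *\<^sub>R d) has_derivative (\<lambda>t. t *\<^sub>R d)) (at 0)"
    by (auto intro!: derivative_eq_intros)
  moreover have "(f has_derivative A) (at (x + 0 *\<^sub>R d) within range (\<lambda>t::real. x + t *\<^sub>R d))"
    using f x d S by (auto intro!: has_derivative_subset[OF f] subspace_scale_add)
  ultimately have "((\<lambda>t. f (x + t *\<^sub>R d)) has_derivative (\<lambda>t. A (t *\<^sub>R d))) (at 0)"
    by (rule has_derivative_in_compose)
  also have "(\<lambda>t. A (t *\<^sub>R d)) = (\<lambda>t. A d * t)"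
    using has_derivative_bounded_linear[OF f] by (simp add: bounded_linear.linear linear_scale mult.commute)
  finally have "((\<lambda>t. f (x + t *\<^sub>R d)) has_field_derivative A d) (at 0)"
    by (simp add: has_field_derivative_def)
  hence "((\<lambda>t. (f (x + t *\<^sub>R d) - f x) / t) \<longlongrightarrow> A d) (at 0)"
    by (simp add: DERIV_def)
  thus "((\<lambda>t. (f (x + t *\<^sub>R d) - f x) / t) \<longlongrightarrow> A d) (at_right 0)"
    by (rule tendsto_within_subset) simp
qed

lemma gradient_on:
  assumes S: "hilbert_subspace S" and x: "x \<in> S" and f: "f differentiable_on S"
  shows "gradient_on S f x \<in> S"
    "(f has_derivative (\<lambda>d. inner d (gradient_on S f x))) (at x within S)"
proof -
  note S' = hilbert_subspaceD[OF S]
  obtain A where A: "(f has_derivative A) (at x within S)"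
    using f x by (auto simp: differentiable_on_def differentiable_def)
  obtain g where g: "g \<in> S" "\<And>d. d \<in> S \<Longrightarrow> A d = inner d g"
    using riesz_representation[OF S bounded_linear_imp_between[OF has_derivative_bounded_linear[OF A]]]
    by blast
  \<comment> \<open>The derivative \<open>A\<close> is linear on the ambient type but agrees with
    the inner product against \<open>g\<close> only on \<open>S\<close>. A derivative within
    \<open>S\<close> sees only differences in \<open>S\<close>, so the two may be exchanged.\<close>
  have "(f has_derivative (\<lambda>d. inner d g)) (at x within S)"
    unfolding has_derivative_within
  proof
    show "((\<lambda>y. (1 / norm (y - x)) *\<^sub>R (f y - (f x + inner (y - x) g))) \<longlongrightarrow> 0) (at x within S)"
    proof (rule Lim_transform_eventually)
      show "((\<lambda>y. (1 / norm (y - x)) *\<^sub>R (f y - (f x + A (y - x)))) \<longlongrightarrow> 0) (at x within S)"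
        using A unfolding has_derivative_within by blast
      show "\<forall>\<^sub>F y in at x within S. (1 / norm (y - x)) *\<^sub>R (f y - (f x + A (y - x)))
          = (1 / norm (y - x)) *\<^sub>R (f y - (f x + inner (y - x) g))"
        using g(2) x S'(1) by (auto simp: eventually_at_filter subspace_diff)
    qed
  qed (rule bounded_linear_inner_left)
  with g(1) have 1: "g \<in> S \<and> (f has_derivative (\<lambda>d. inner d g)) (at x within S)" by simp
  have "gradient_on S f x \<in> S \<and> (f has_derivative (\<lambda>d. inner d (gradient_on S f x))) (at x within S)"
    unfolding gradient_on_def
  proof (rule theI[of _ g])
    fix g' assume 2: "g' \<in> S \<and> (f has_derivative (\<lambda>d. inner d g')) (at x within S)"
    have "inner d g' = inner d g" if "d \<in> S" for d
      using has_gateaux_derivative_on_unique[OF has_derivative_imp_gateaux[OF S'(1) x conjunct2[OF 2]]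
          has_derivative_imp_gateaux[OF S'(1) x conjunct2[OF 1]] that] .
    thus "g' = g" using 1 2 S'(1) by (intro eq_if_inner_eq_on_subspace[of S]) auto
  qed (rule 1)
  thus "gradient_on S f x \<in> S"
    "(f has_derivative (\<lambda>d. inner d (gradient_on S f x))) (at x within S)" by auto
qed

text \<open>Convexity bounds every difference quotient with \<open>0 < t < 1\<close> by the one at
  \<open>t = 1\<close>, and the bound survives the one-sided limit.\<close>

lemma convex_on_gateaux_above_tangent:
  assumes f: "convex_on S f" and S: "subspace S" and x: "x \<in> S" "y \<in> S"
    and f': "has_gateaux_derivative_on S f f' x"
  shows "f x + f' (y - x) \<le> f y"
proof -
  have "f' (y - x) \<le> f y - f x"
  proof (rule tendsto_upperbound)
    show "((\<lambda>t. (f (x + t *\<^sub>R (y - x)) - f x) / t) \<longlongrightarrow> f' (y - x)) (at_right 0)"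
      using x S by (intro has_gateaux_derivative_onD(2)[OF f']) (simp add: subspace_diff)
    have "(f (x + t *\<^sub>R (y - x)) - f x) / t \<le> f y - f x" if t: "0 < t" "t < 1" for t
    proof -
      have "f ((1 - t) *\<^sub>R x + t *\<^sub>R y) \<le> (1 - t) * f x + t * f y"
        using f x t by (simp add: convex_on_def)
      moreover have "(1 - t) *\<^sub>R x + t *\<^sub>R y = x + t *\<^sub>R (y - x)" by (simp add: algebra_simps)
      ultimately show ?thesis using t by (simp add: field_simps)
    qed
    thus "\<forall>\<^sub>F t in at_right 0. (f (x + t *\<^sub>R (y - x)) - f x) / t \<le> f y - f x"
      unfolding eventually_at_right_field by (intro exI[of _ 1]) auto
  qed simp
  thus ?thesis by simp
qed

lemma convex_on_above_gradient:
  assumes S: "hilbert_subspace S" and "f differentiable_on S" "convex_on S f" "x \<in> S" "y \<in> S"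
  shows "f x + inner (y - x) (gradient_on S f x) \<le> f y"
  using convex_on_gateaux_above_tangent[OF assms(3) hilbert_subspaceD(1)[OF S] assms(4,5)
      has_derivative_imp_gateaux[OF hilbert_subspaceD(1)[OF S] assms(4) gradient_on(2)[OF S assms(4,2)]]] .

lemma gradient_on_monotone:
  assumes "hilbert_subspace S" "f differentiable_on S" "convex_on S f" "x \<in> S" "y \<in> S"
  shows "0 \<le> inner (x - y) (gradient_on S f x - gradient_on S f y)"
  using convex_on_above_gradient[OF assms] convex_on_above_gradient[OF assms(1-3,5,4)]
  by (simp add: inner_diff_left inner_diff_right)

text \<open>This is the loss that an explicit gradient step causes in the gap, and the second-order
  error in Minty's trick.\<close>

lemma inner_lipschitz_le:
  assumes "c-lipschitz_on S A" "x \<in> S" "y \<in> S"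
  shows "inner (x - y) (A x - A y) \<le> c * (norm (x - y))\<^sup>2"
proof -
  have "inner (x - y) (A x - A y) \<le> norm (x - y) * norm (A x - A y)"
    by (rule norm_cauchy_schwarz)
  also have "\<dots> \<le> norm (x - y) * (c * norm (x - y))"
    using lipschitz_on_normD[OF assms] by (rule mult_left_mono) simp
  finally show ?thesis by (simp add: power2_eq_square mult_ac)
qed

section \<open>Adjoints relative to a carrier\<close>

lemma adjoint_on:
  assumes S: "hilbert_subspace S" and A: "bounded_linear_between S T A"
  shows "adjoint_on S A y \<in> S" "\<And>x. x \<in> S \<Longrightarrow> inner (A x) y = inner x (adjoint_on S A y)"
proof -
  obtain B where B: "\<And>x. x \<in> S \<Longrightarrow> norm (A x) \<le> B * norm x"
    using bounded_linear_betweenD(4)[OF A] by blast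
  have "\<bar>inner (A x) y\<bar> \<le> (B * norm y) * norm x" if "x \<in> S" for x
  proof -
    have "\<bar>inner (A x) y\<bar> \<le> norm (A x) * norm y" by (rule Cauchy_Schwarz_ineq2)
    also have "\<dots> \<le> (B * norm x) * norm y" using B[OF that] by (rule mult_right_mono) simp
    finally show ?thesis by (simp add: mult_ac)
  qed
  hence "bounded_linear_between S UNIV (\<lambda>x. inner (A x) y)"
    unfolding bounded_linear_between_def
    by (auto simp: bounded_linear_betweenD(2,3)[OF A] inner_add_left)
  from theI'[OF riesz_representation[OF S this]]
  show "adjoint_on S A y \<in> S" "\<And>x. x \<in> S \<Longrightarrow> inner (A x) y = inner x (adjoint_on S A y)"
    unfolding adjoint_on_def by auto
qed

text \<open>A vector \<open>y\<close> enters the adjoint only through the functional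
  \<open>inner (A x) y\<close>, so the domain \<open>U\<close> is free. It is taken to be the whole
  type for the saddle operator and a single space for the iterates.\<close>

lemma bounded_linear_between_adjoint_on:
  assumes S: "hilbert_subspace S" and A: "bounded_linear_between S T A"
  shows "bounded_linear_between U S (adjoint_on S A)"
proof -
  note S' = hilbert_subspaceD[OF S] and adj = adjoint_on[OF S A]
  obtain B where B: "\<And>x. x \<in> S \<Longrightarrow> norm (A x) \<le> B * norm x"
    using bounded_linear_betweenD(4)[OF A] by blast
  show ?thesis
    unfolding bounded_linear_between_def
  proof (intro conjI ballI allI)
    show "adjoint_on S A ` U \<subseteq> S" using adj(1) by auto
    show "adjoint_on S A (y + z) = adjoint_on S A y + adjoint_on S A z" for y z
      by (rule eq_if_inner_eq_on_subspace[OF S'(1)])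
         (use adj(1) S'(1) in \<open>auto simp: subspace_add inner_add_right simp flip: adj(2)\<close>)
    show "adjoint_on S A (c *\<^sub>R y) = c *\<^sub>R adjoint_on S A y" for c y
      by (rule eq_if_inner_eq_on_subspace[OF S'(1)])
         (use adj(1) S'(1) in \<open>auto simp: subspace_scale simp flip: adj(2)\<close>)
    have "norm (adjoint_on S A y) \<le> \<bar>B\<bar> * norm y" for y
    proof (cases "adjoint_on S A y = 0")
      case False
      let ?z = "adjoint_on S A y"
      have "norm ?z * norm ?z = inner (A ?z) y"
        using adj(2)[OF adj(1), of y y] by (simp flip: power2_norm_eq_inner add: power2_eq_square)
      also have "\<dots> \<le> norm (A ?z) * norm y" by (rule norm_cauchy_schwarz)
      also have "\<dots> \<le> (\<bar>B\<bar> * norm ?z) * norm y"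
      proof (rule mult_right_mono)
        have "norm (A ?z) \<le> B * norm ?z" by (rule B[OF adj(1)])
        also have "\<dots> \<le> \<bar>B\<bar> * norm ?z" by (rule mult_right_mono) auto
        finally show "norm (A ?z) \<le> \<bar>B\<bar> * norm ?z" .
      qed simp
      finally have "norm ?z * norm ?z \<le> norm ?z * (\<bar>B\<bar> * norm y)" by (simp add: mult_ac)
      with False show ?thesis by (simp add: mult_le_cancel_left_pos)
    qed simp
    thus "\<exists>B. \<forall>x\<in>U. norm (adjoint_on S A x) \<le> B * norm x" by blast
  qed
qed

section \<open>Weak convergence\<close>

text \<open>A diagonal subsequence converges weakly when tested against the sequence itself, hence
  against the closed span of the sequence; the orthogonal complement of that span is harmless.\<close>

theorem bounded_imp_weakly_convergent_subseq:
  fixes X :: "nat \<Rightarrow> 'a::real_inner"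
  assumes S: "hilbert_subspace S" and XS: "\<And>n. X n \<in> S" and X: "Bseq X"
  shows "\<exists>r l. strict_mono r \<and> weakly_converges_in S (X \<circ> r) l"
proof -
  note S' = hilbert_subspaceD[OF S]
  obtain B where B: "\<And>n. norm (X n) \<le> B" using X by (auto simp: Bseq_def)
  have "0 \<le> B" using B[of 0] norm_ge_zero[of "X 0"] by linarith
  have bdd: "\<bar>inner (X n) d\<bar> \<le> B * norm d" for n d
    by (rule order_trans[OF Cauchy_Schwarz_ineq2]) (simp add: B mult_right_mono)
  interpret subseqs "\<lambda>m s. convergent (\<lambda>n. inner (X (s n)) (X m))"
  proof unfold_locales
    fix m and s :: "nat \<Rightarrow> nat"
    have "bounded (range (\<lambda>n. inner (X (s n)) (X m)))"
      unfolding bounded_iff using bdd by auto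
    then obtain l r where "strict_mono r" "((\<lambda>n. inner (X (s n)) (X m)) \<circ> r) \<longlonglongrightarrow> l"
      using bounded_imp_convergent_subsequence by blast
    thus "\<exists>r. strict_mono r \<and> convergent (\<lambda>n. inner (X ((s \<circ> r) n)) (X m))"
      by (auto simp: convergent_def o_def)
  qed
  define r where "r = diagseq"
  have conv: "convergent (\<lambda>n. inner (X (r n)) (X m))" for m
  proof -
    \<comment> \<open>Only the part of the diagonal from index \<open>Suc m\<close> on is a
      subsequence of the one chosen for the test vector \<open>X m\<close>; the shift is discarded
      afterwards.\<close>
    have "convergent (\<lambda>n. inner (X ((diagseq \<circ> (+) (Suc m)) n)) (X m))"
    proof (rule diagseq_holds)
      fix r s :: "nat \<Rightarrow> nat" and k :: nat
      assume "strict_mono r" "convergent (\<lambda>n. inner (X (s n)) (X k))"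
      thus "convergent (\<lambda>n. inner (X ((s \<circ> r) n)) (X k))"
        using convergent_subseq_convergent[of "\<lambda>n. inner (X (s n)) (X k)" r] by (simp add: o_def)
    qed
    hence "convergent (\<lambda>n. inner (X (r (n + Suc m))) (X m))"
      by (simp add: r_def add.commute)
    thus ?thesis by (rule convergent_ignore_initial_segment[THEN iffD1])
  qed
  define V where "V = {d \<in> S. convergent (\<lambda>n. inner (X (r n)) d)}"
  have V: "subspace V"
    unfolding V_def using S'(1)
    by (intro subspaceI) (auto simp: subspace_0 subspace_add subspace_scale inner_add_right
        intro: convergent_add convergent_mult convergent_const)
  have "closed V"
    unfolding closed_sequential_limits
  proof (intro allI impI, elim conjE)
    fix u d assume u: "\<forall>n. u n \<in> V" and ud: "u \<longlonglongrightarrow> d"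
    have "d \<in> S" using u ud S'(4) closed_sequentially[of S u d] by (auto simp: V_def)
    moreover have "Cauchy (\<lambda>n. inner (X (r n)) d)"
    proof (rule metric_CauchyI)
      fix e :: real assume "0 < e"
      \<comment> \<open>Replacing \<open>d\<close> by \<open>u k\<close> costs less than
        \<open>e / 4\<close> at each of two indices, leaving \<open>e / 2\<close> for the Cauchy
        property at \<open>u k\<close>. The summand 1 avoids division by 0 when
        \<open>B = 0\<close>.\<close>
      hence "0 < e / (4 * (B + 1))" using \<open>0 \<le> B\<close> by simp
      then obtain k where k: "norm (u k - d) < e / (4 * (B + 1))"
        using LIMSEQ_D[OF ud] by blast
      have close: "\<bar>inner (X n) (u k) - inner (X n) d\<bar> < e / 4" for n
      proof -
        have "\<bar>inner (X n) (u k - d)\<bar> \<le> B * norm (u k - d)" by (rule bdd)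
        also have "\<dots> \<le> (B + 1) * norm (u k - d)" by (simp add: mult_right_mono)
        also have "\<dots> < e / 4" using k \<open>0 \<le> B\<close> by (simp add: field_simps)
        finally show ?thesis by (simp add: inner_diff_right)
      qed
      have "Cauchy (\<lambda>n. inner (X (r n)) (u k))"
        using u by (auto simp: V_def intro: convergent_Cauchy)
      then obtain N where N: "\<And>m n. N \<le> m \<Longrightarrow> N \<le> n \<Longrightarrow>
          \<bar>inner (X (r m)) (u k) - inner (X (r n)) (u k)\<bar> < e / 2"
        using \<open>0 < e\<close> unfolding Cauchy_def dist_real_def by (metis half_gt_zero)
      have "dist (inner (X (r m)) d) (inner (X (r n)) d) < e" if "N \<le> m" "N \<le> n" for m n
        using N[OF that] close[of "r m"] close[of "r n"] unfolding dist_real_def by linarith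
      thus "\<exists>N. \<forall>m\<ge>N. \<forall>n\<ge>N. dist (inner (X (r m)) d) (inner (X (r n)) d) < e" by blast
    qed
    ultimately show "d \<in> V" by (simp add: V_def Cauchy_convergent_iff)
  qed
  hence "complete V" using complete_closed_subset[OF _ _ S'(2), of V] by (auto simp: V_def)
  have SV: "d \<in> V" if d: "d \<in> S" for d
  proof -
    obtain p where p: "p \<in> V" "\<And>y. y \<in> V \<Longrightarrow> inner y (d - p) = 0"
      using orthogonal_projection_exists[OF V \<open>complete V\<close>] by blast
    have "inner (X n) d = inner (X n) p" for n
      using p(2)[of "X n"] XS conv by (simp add: V_def inner_diff_right)
    with p(1) d show ?thesis by (simp add: V_def)
  qed
  hence lim: "(\<lambda>n. inner (X (r n)) d) \<longlonglongrightarrow> lim (\<lambda>n. inner (X (r n)) d)" if "d \<in> S" for d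
    using that by (auto simp: V_def convergent_LIMSEQ_iff)
  \<comment> \<open>Pointwise limits of the uniformly bounded functionals form a bounded functional,
    whose Riesz vector is the weak limit.\<close>
  have "bounded_linear_between S UNIV (\<lambda>d. lim (\<lambda>n. inner (X (r n)) d))"
    unfolding bounded_linear_between_def
  proof (intro conjI ballI allI exI)
    fix x y c assume x: "x \<in> S" and y: "y \<in> S"
    show "lim (\<lambda>n. inner (X (r n)) (x + y)) = lim (\<lambda>n. inner (X (r n)) x) + lim (\<lambda>n. inner (X (r n)) y)"
      unfolding inner_add_right by (intro limI tendsto_intros lim x y)
    show "lim (\<lambda>n. inner (X (r n)) (c *\<^sub>R x)) = c *\<^sub>R lim (\<lambda>n. inner (X (r n)) x)"
      unfolding inner_scaleR_right real_scaleR_def by (intro limI tendsto_intros lim x)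
    have "(\<lambda>n. \<bar>inner (X (r n)) x\<bar>) \<longlonglongrightarrow> \<bar>lim (\<lambda>n. inner (X (r n)) x)\<bar>"
      by (intro tendsto_intros lim x)
    from LIMSEQ_le_const2[OF this] bdd
    show "norm (lim (\<lambda>n. inner (X (r n)) x)) \<le> B * norm x" by auto
  qed auto
  from riesz_representation[OF S this]
  obtain l where l: "l \<in> S" "\<And>d. d \<in> S \<Longrightarrow> lim (\<lambda>n. inner (X (r n)) d) = inner l d"
    by (auto simp: inner_commute)
  have "weakly_converges_in S (X \<circ> r) l"
    unfolding weakly_converges_in_def using XS l lim by auto
  moreover have "strict_mono r" unfolding r_def by (rule subseq_diagseq)
  ultimately show ?thesis by blast
qed

text \<open>Otherwise infinitely many terms stay at distance at least \<open>e\<close> from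
  \<open>l\<close>; enumerating their indices gives a subsequence without any good further
  subsequence.\<close>

lemma tendsto_if_subsubseq:
  fixes f :: "nat \<Rightarrow> 'a::metric_space"
  assumes "\<And>s :: nat \<Rightarrow> nat. strict_mono s \<Longrightarrow> \<exists>r :: nat \<Rightarrow> nat. strict_mono r \<and> (\<lambda>n. f (s (r n))) \<longlonglongrightarrow> l"
  shows "f \<longlonglongrightarrow> l"
proof (rule ccontr)
  assume "\<not> f \<longlonglongrightarrow> l"
  then obtain e where e: "e > 0" "\<exists>\<^sub>F n in sequentially. \<not> dist (f n) l < e"
    by (auto simp: tendsto_iff frequently_def)
  define A where "A = {n. \<not> dist (f n) l < e}"
  have "infinite A"
    using e(2) unfolding A_def by (simp add: cofinite_eq_sequentially[symmetric] frequently_cofinite)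
  define s where "s = enumerate A"
  have s: "strict_mono s" "\<not> dist (f (s n)) l < e" for n
    using \<open>infinite A\<close> enumerate_in_set[of A n]
    by (auto simp: s_def A_def strict_mono_enumerate)
  obtain r where "(\<lambda>n. f (s (r n))) \<longlonglongrightarrow> l" using assms[OF s(1)] by blast
  from metric_LIMSEQ_D[OF this e(1)] s(2) show False by blast
qed

text \<open>For cluster points \<open>l\<close> and \<open>l'\<close> in \<open>Z\<close>, the
  difference of the squared distances from \<open>X n\<close> to them is affine in
  \<open>X n\<close>, so \<open>inner (X n) (l' - l)\<close> converges. Its limit computed along the
  two subsequences is the same, which forces \<open>l' = l\<close>. Boundedness and uniqueness of
  the cluster point then give convergence of the whole sequence.\<close>

theorem opial:
  fixes X :: "nat \<Rightarrow> 'a::real_inner"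
  assumes S: "hilbert_subspace S" and XS: "\<And>n. X n \<in> S"
    and conv: "\<And>z. z \<in> Z \<Longrightarrow> convergent (\<lambda>n. norm (X n - z))" and "Z \<noteq> {}"
    and cluster: "\<And>r l. strict_mono r \<Longrightarrow> weakly_converges_in S (X \<circ> r) l \<Longrightarrow> l \<in> Z"
  shows "\<exists>l\<in>Z. weakly_converges_in S X l"
proof -
  note S' = hilbert_subspaceD[OF S]
  obtain z where "z \<in> Z" using \<open>Z \<noteq> {}\<close> by blast
  hence "Bseq (\<lambda>n. norm (X n - z))" by (intro convergent_imp_Bseq conv)
  then obtain K where K: "\<And>n. norm (X n - z) \<le> K" by (auto simp: Bseq_def)
  have "norm (X n) \<le> K + norm z" for n
    using K[of n] norm_triangle_ineq[of "X n - z" z] by simp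
  hence bseq: "Bseq X" by (rule BseqI')
  obtain r l where rl: "strict_mono r" "weakly_converges_in S (X \<circ> r) l"
    using bounded_imp_weakly_convergent_subseq[OF S XS bseq] by blast
  have l: "l \<in> Z" "l \<in> S" using cluster[OF rl] weakly_converges_in_tendsto(2)[OF rl(2)] by auto
  have unique: "l' = l" if s: "strict_mono s" and sl: "weakly_converges_in S (X \<circ> s) l'" for s l'
  proof -
    have l': "l' \<in> Z" "l' \<in> S" using cluster[OF s sl] weakly_converges_in_tendsto(2)[OF sl] by auto
    have "inner (X n) (l' - l) = ((norm l')\<^sup>2 - (norm l)\<^sup>2 + (norm (X n - l))\<^sup>2 - (norm (X n - l'))\<^sup>2) / 2" for n
      by (simp add: power2_norm_eq_inner inner_diff inner_commute algebra_simps)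
    moreover obtain L L' where "(\<lambda>n. norm (X n - l)) \<longlonglongrightarrow> L" "(\<lambda>n. norm (X n - l')) \<longlonglongrightarrow> L'"
      using conv[OF l(1)] conv[OF l'(1)] by (auto simp: convergent_def)
    hence "(\<lambda>n. ((norm l')\<^sup>2 - (norm l)\<^sup>2 + (norm (X n - l))\<^sup>2 - (norm (X n - l'))\<^sup>2) / 2)
        \<longlonglongrightarrow> ((norm l')\<^sup>2 - (norm l)\<^sup>2 + L\<^sup>2 - L'\<^sup>2) / 2"
      by (intro tendsto_intros) simp_all
    ultimately obtain a where a: "(\<lambda>n. inner (X n) (l' - l)) \<longlonglongrightarrow> a"
      by auto
    have d: "l' - l \<in> S" using l l' S'(1) by (simp add: subspace_diff)
    have "inner l (l' - l) = a"
      using LIMSEQ_unique[OF weakly_converges_in_tendsto(3)[OF rl(2) d]] LIMSEQ_subseq_LIMSEQ[OF a rl(1)]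
      by (simp add: o_def)
    moreover have "inner l' (l' - l) = a"
      using LIMSEQ_unique[OF weakly_converges_in_tendsto(3)[OF sl d]] LIMSEQ_subseq_LIMSEQ[OF a s]
      by (simp add: o_def)
    ultimately have "inner (l' - l) (l' - l) = 0" by (simp add: inner_diff_left)
    thus ?thesis by simp
  qed
  have "weakly_converges_in S X l"
    unfolding weakly_converges_in_def
  proof (intro conjI allI ballI XS l(2))
    fix w assume w: "w \<in> S"
    show "(\<lambda>n. inner (X n) w) \<longlonglongrightarrow> inner l w"
    proof (rule tendsto_if_subsubseq)
      fix s :: "nat \<Rightarrow> nat" assume s: "strict_mono s"
      have "Bseq (X \<circ> s)" using bseq by (auto simp: Bseq_def)
      then obtain s' l' where s': "strict_mono s'" "weakly_converges_in S (X \<circ> s \<circ> s') l'"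
        using bounded_imp_weakly_convergent_subseq[OF S, of "X \<circ> s"] XS by (auto simp: o_assoc)
      have "l' = l" using s' s by (intro unique[of "s \<circ> s'"]) (auto simp: strict_mono_o o_assoc)
      thus "\<exists>s'. strict_mono s' \<and> (\<lambda>n. inner (X (s (s' n))) w) \<longlonglongrightarrow> inner l w"
        using weakly_converges_in_tendsto(3)[OF s'(2) w] s'(1) by auto
    qed
  qed
  with l(1) show ?thesis by blast
qed

section \<open>Monotone inclusions and half-space projections\<close>

text \<open>For convex functions this is equivalent to \<^const>\<open>proper_lsc_convex\<close>, but the weak form of
  lower semicontinuity passes to sums and to compositions with bounded linear maps.\<close>

definition proper_weakly_lsc_convex :: "'a::real_inner set \<Rightarrow> ('a \<Rightarrow> ereal) \<Rightarrow> bool" where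
  "proper_weakly_lsc_convex S f \<longleftrightarrow>
     (\<forall>x\<in>S. f x \<noteq> -\<infinity>) \<and>
     (\<exists>x\<in>S. f x \<noteq> \<infinity>) \<and>
     (\<forall>X l. weakly_converges_in S X l \<longrightarrow> f l \<le> liminf (\<lambda>n. f (X n))) \<and>
     (\<forall>x\<in>S. \<forall>y\<in>S. \<forall>t::real. 0 < t \<and> t < 1 \<longrightarrow>
        f ((1 - t) *\<^sub>R x + t *\<^sub>R y) \<le> ereal (1 - t) * f x + ereal t * f y)"

lemma proper_weakly_lsc_convexD:
  assumes "proper_weakly_lsc_convex S f"
  shows "\<And>x. x \<in> S \<Longrightarrow> f x \<noteq> -\<infinity>" "\<exists>x\<in>S. f x \<noteq> \<infinity>"
    "\<And>X l. weakly_converges_in S X l \<Longrightarrow> f l \<le> liminf (\<lambda>n. f (X n))"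
    "\<And>x y t. x \<in> S \<Longrightarrow> y \<in> S \<Longrightarrow> 0 < t \<Longrightarrow> t < 1 \<Longrightarrow>
       f ((1 - t) *\<^sub>R x + t *\<^sub>R y) \<le> ereal (1 - t) * f x + ereal t * f y"
  using assms unfolding proper_weakly_lsc_convex_def by blast+

lemma proper_weakly_lsc_convex_if_lsc:
  assumes "hilbert_subspace S" "proper_lsc_convex S f"
  shows "proper_weakly_lsc_convex S f"
  using weak_lsc[OF assms] assms(2)
  unfolding proper_weakly_lsc_convex_def proper_lsc_convex_def by blast

lemma tendsto_zero_inner_bounded:
  fixes f g :: "nat \<Rightarrow> 'a::real_inner"
  assumes "Bseq f" "g \<longlonglongrightarrow> 0"
  shows "(\<lambda>n. inner (f n) (g n)) \<longlonglongrightarrow> 0"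
proof -
  obtain B where B: "\<And>n. norm (f n) \<le> B" using assms(1) by (auto simp: Bseq_def)
  show ?thesis
  proof (rule Lim_null_comparison)
    show "\<forall>\<^sub>F n in sequentially. norm (inner (f n) (g n)) \<le> B * norm (g n)"
    proof (intro always_eventually allI)
      fix n
      have "\<bar>inner (f n) (g n)\<bar> \<le> norm (f n) * norm (g n)" by (rule Cauchy_Schwarz_ineq2)
      also have "\<dots> \<le> B * norm (g n)" by (rule mult_right_mono[OF B norm_ge_zero])
      finally show "norm (inner (f n) (g n)) \<le> B * norm (g n)" by simp
    qed
    show "(\<lambda>n. B * norm (g n)) \<longlonglongrightarrow> 0"
      using tendsto_mult_right_zero[OF tendsto_norm_zero[OF assms(2)]] .
  qed
qed

text \<open>By monotonicity the operator may be evaluated at a fixed test point, which makes the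
  weak limit harmless; the operator at the limit is recovered by Minty's trick of
  letting the test point approach the limit along a segment.\<close>

theorem subdifferential_plus_monotone_closed:
  fixes F :: "'a::real_inner \<Rightarrow> ereal"
  assumes S: "hilbert_subspace S" and F: "proper_weakly_lsc_convex S F"
    and T: "monotone_operator_on S T" "K-lipschitz_on S T" "T ` S \<subseteq> S"
    and p: "weakly_converges_in S p l" "Bseq p" and s: "s \<longlonglongrightarrow> 0"
    and sub: "\<And>n. s n - T (p n) \<in> subdifferential_on S F (p n)"
  shows "- T l \<in> subdifferential_on S F l"
proof -
  note S' = hilbert_subspaceD[OF S] and F' = proper_weakly_lsc_convexD[OF F]
    and p' = weakly_converges_in_tendsto[OF p(1)]
  have key: "F l \<le> ereal (r + inner (W - l) (T W))" if W: "W \<in> S" "F W = ereal r" for W r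
  proof -
    have "F (p n) \<le> ereal (r - inner (W - p n) (s n) + inner (W - p n) (T W))" for n
    proof -
      have "\<bar>F (p n)\<bar> \<noteq> \<infinity>"
        using subdifferential_on_finite[OF F'(2) F'(1)[OF p'(1)] sub] .
      then obtain c where c: "F (p n) = ereal c" by auto
      have "inner (W - p n) (s n - T (p n)) + c \<le> r"
        using subdifferential_onD(2)[OF sub[of n] W(1)] by (simp add: W(2) c)
      moreover have "0 \<le> inner (W - p n) (T W - T (p n))"
        using T(1) W(1) p'(1) by (simp add: monotone_operator_on_def)
      ultimately show ?thesis by (simp add: c inner_diff_right)
    qed
    hence "liminf (\<lambda>n. F (p n)) \<le> liminf (\<lambda>n. ereal (r - inner (W - p n) (s n) + inner (W - p n) (T W)))"
      by (intro Liminf_mono) auto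
    also have "\<dots> = ereal (r - 0 + inner (W - l) (T W))"
    proof (rule lim_imp_Liminf)
      have "Bseq (\<lambda>n. W - p n)" using p(2) Bseq_add[of "\<lambda>n. - p n" W] by (simp add: Bseq_minus_iff)
      hence "(\<lambda>n. inner (W - p n) (s n)) \<longlonglongrightarrow> 0" using s by (rule tendsto_zero_inner_bounded)
      moreover have "(\<lambda>n. inner (W - p n) (T W)) \<longlonglongrightarrow> inner (W - l) (T W)"
        unfolding inner_diff_left using T(3) W(1) by (intro tendsto_intros p'(3)) auto
      ultimately show "(\<lambda>n. ereal (r - inner (W - p n) (s n) + inner (W - p n) (T W)))
          \<longlonglongrightarrow> ereal (r - 0 + inner (W - l) (T W))"
        by (intro tendsto_ereal tendsto_add tendsto_diff tendsto_const)
    qed simp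
    finally show ?thesis using order_trans[OF F'(3)[OF p(1)]] by simp
  qed
  \<comment> \<open>A single point of the domain, inserted into \<open>key\<close>, shows that
    \<open>F l\<close> is finite, so that \<open>F l\<close> may be subtracted below.\<close>
  obtain W0 where W0: "W0 \<in> S" "F W0 \<noteq> \<infinity>" using F'(2) by blast
  then obtain r0 where r0: "F W0 = ereal r0" using F'(1)[OF W0(1)] by (cases "F W0") auto
  obtain c where c: "F l = ereal c"
    using key[OF W0(1) r0] F'(1)[OF p'(2)] by (cases "F l") auto
  show ?thesis
    unfolding subdifferential_on_def
  proof (intro CollectI conjI ballI)
    show "- T l \<in> S" using T(3) p'(2) S'(1) by (auto intro: subspace_neg)
    fix W assume W: "W \<in> S"
    show "ereal (inner (W - l) (- T l)) + F l \<le> F W"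
    proof (cases "F W")
      case (real r)
      have "c - r - inner (W - l) (T l) \<le> 0"
      proof (rule nonpos_if_le_small)
        fix t :: real assume t: "0 < t" "t < 1"
        \<comment> \<open>Since \<open>V - l = t *\<^sub>R (W - l)\<close>, a factor
          \<open>t\<close> can be cancelled after applying \<open>key\<close> at \<open>V\<close>.
          By the Lipschitz property, replacing \<open>T V\<close> by \<open>T l\<close> then costs
          an error linear in \<open>t\<close>.\<close>
        define V where "V = (1 - t) *\<^sub>R l + t *\<^sub>R W"
        have V: "V \<in> S" using W p'(2) S'(1) by (simp add: V_def subspace_add subspace_scale)
        have Vl: "V - l = t *\<^sub>R (W - l)" by (simp add: V_def algebra_simps)
        have "F V \<le> ereal ((1 - t) * c + t * r)"
          using F'(4)[OF p'(2) W t] by (simp add: V_def c real)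
        then obtain d where d: "F V = ereal d" "d \<le> (1 - t) * c + t * r"
          using F'(1)[OF V] by (cases "F V") auto
        have "c \<le> d + t * inner (W - l) (T V)"
          using key[OF V d(1)] by (simp add: c Vl)
        with d(2) have "t * (c - r) \<le> t * inner (W - l) (T V)" by (simp add: algebra_simps)
        hence 1: "c - r \<le> inner (W - l) (T V)" using t by simp
        have "t * inner (W - l) (T V - T l) \<le> K * (t * norm (W - l))\<^sup>2"
          using inner_lipschitz_le[OF T(2) V p'(2)] t by (simp add: Vl)
        also have "\<dots> = t * (t * (K * (norm (W - l))\<^sup>2))" by (simp add: power2_eq_square)
        finally have "inner (W - l) (T V - T l) \<le> t * (K * (norm (W - l))\<^sup>2)" using t by simp
        with 1 show "c - r - inner (W - l) (T l) \<le> t * (K * (norm (W - l))\<^sup>2)"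
          by (simp add: inner_diff_right)
      qed
      thus ?thesis by (simp add: c real)
    qed (use F'(1)[OF W] in auto)
  qed
qed

text \<open>How \<open>p\<close> and \<open>s\<close> are computed is left open. Only the graph
  relation \<open>sub\<close> is recorded, so delays and activation sets do not appear at this
  level.\<close>

locale halfspace_projection =
  fixes S :: "'a::real_inner set" and F :: "'a \<Rightarrow> ereal" and T :: "'a \<Rightarrow> 'a" and K :: real
    and w p s :: "nat \<Rightarrow> 'a" and lam :: "nat \<Rightarrow> real" and \<epsilon> :: real
  assumes S: "hilbert_subspace S"
    and F: "proper_weakly_lsc_convex S F"
    and T: "monotone_operator_on S T" "K-lipschitz_on S T" "T ` S \<subseteq> S"
    and w0: "w 0 \<in> S" and pS: "\<And>n. p n \<in> S" and sS: "\<And>n. s n \<in> S"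
    and sub: "\<And>n. s n - T (p n) \<in> subdifferential_on S F (p n)"
    and \<epsilon>: "0 < \<epsilon>" and lam: "\<And>n. lam n \<in> {\<epsilon>..2 - \<epsilon>}"
    and step: "\<And>n. inner (p n - w n) (s n) < 0 \<Longrightarrow>
        w (Suc n) = w n + (lam n * inner (p n - w n) (s n) / (norm (s n))\<^sup>2) *\<^sub>R s n"
    and stay: "\<And>n. \<not> inner (p n - w n) (s n) < 0 \<Longrightarrow> w (Suc n) = w n"
begin

definition Z :: "'a set" where
  "Z = {z \<in> S. - T z \<in> subdifferential_on S F z}"

lemma wS: "w n \<in> S"
proof (induction n)
  case (Suc n)
  have "subspace S" using hilbert_subspaceD(1)[OF S] .
  with Suc step[of n] stay[of n] sS[of n] show ?case
    by (cases "inner (p n - w n) (s n) < 0") (simp_all add: subspace_add subspace_scale)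
qed (rule w0)

lemma Z_halfspace:
  assumes "z \<in> Z"
  shows "0 \<le> inner (p n - z) (s n)"
proof -
  note F' = proper_weakly_lsc_convexD[OF F]
  have z: "z \<in> S" "- T z \<in> subdifferential_on S F z" using assms by (auto simp: Z_def)
  have "0 \<le> inner (p n - z) (s n - T (p n) - - T z)"
    using subdifferential_on_monotone[OF F'(2) F'(1)[OF pS] F'(1)[OF z(1)] sub z(2) pS z(1)] .
  moreover have "0 \<le> inner (p n - z) (T (p n) - T z)"
    using T(1) pS z(1) by (simp add: monotone_operator_on_def)
  ultimately show ?thesis by (simp add: inner_diff_right inner_add_right)
qed

lemma fejer:
  assumes z: "z \<in> Z"
  shows "(norm (w (Suc n) - z))\<^sup>2 \<le> (norm (w n - z))\<^sup>2 - \<epsilon> / 2 * (norm (w (Suc n) - w n))\<^sup>2"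
proof (cases "inner (p n - w n) (s n) < 0")
  case True
  define \<pi> where "\<pi> = inner (p n - w n) (s n)"
  define c where "c = lam n * \<pi> / (norm (s n))\<^sup>2"
  have "\<pi> < 0" using True by (simp add: \<pi>_def)
  hence "s n \<noteq> 0" by (auto simp: \<pi>_def)
  have lam': "\<epsilon> \<le> lam n" "lam n \<le> 2 - \<epsilon>" "0 < lam n" using lam[of n] \<epsilon> by auto
  have ws: "w (Suc n) = w n + c *\<^sub>R s n" using step[OF True] by (simp add: c_def \<pi>_def)
  have "c \<le> 0" using \<open>\<pi> < 0\<close> lam' by (simp add: c_def divide_nonpos_nonneg mult_nonneg_nonpos)
  have "- \<pi> \<le> inner (w n - z) (s n)"
    using Z_halfspace[OF z, of n] by (simp add: \<pi>_def inner_diff_left)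
  \<comment> \<open>The factor \<open>c\<close> is nonpositive, so it reverses the half-space
    inequality into the needed upper bound.\<close>
  hence 1: "c * inner (w n - z) (s n) \<le> c * - \<pi>"
    using \<open>c \<le> 0\<close> by (rule mult_left_mono_neg)
  have "c * (norm (s n))\<^sup>2 = lam n * \<pi>" using \<open>s n \<noteq> 0\<close> by (simp add: c_def)
  hence "\<pi> = c * (norm (s n))\<^sup>2 / lam n" using lam' by simp
  hence 2: "c * - \<pi> = - ((c * norm (s n))\<^sup>2 / lam n)" by (simp add: power2_eq_square)
  have "w (Suc n) - z = (w n - z) + c *\<^sub>R s n" by (simp add: ws)
  hence "(norm (w (Suc n) - z))\<^sup>2 = (norm (w n - z))\<^sup>2 + 2 * (c * inner (w n - z) (s n)) + (c * norm (s n))\<^sup>2"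
    by (simp only: power2_norm_eq_inner power_mult_distrib)
       (simp add: inner_add inner_commute power2_eq_square algebra_simps)
  also have "\<dots> \<le> (norm (w n - z))\<^sup>2 - (2 / lam n - 1) * (c * norm (s n))\<^sup>2"
    using 1 2 by (simp add: algebra_simps)
  also have "\<dots> \<le> (norm (w n - z))\<^sup>2 - \<epsilon> / 2 * (c * norm (s n))\<^sup>2"
  proof -
    \<comment> \<open>The relaxation factor is \<open>2 / lam n - 1 = (2 - lam n) / lam n\<close>,
      whose numerator is at least \<open>\<epsilon>\<close> and whose denominator is at most
      2.\<close>
    have "\<epsilon> * lam n \<le> \<epsilon> * 2" using \<epsilon> lam' by (intro mult_left_mono) auto
    hence "\<epsilon> / 2 \<le> 2 / lam n - 1" using lam' by (simp add: field_simps)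
    hence "\<epsilon> / 2 * (c * norm (s n))\<^sup>2 \<le> (2 / lam n - 1) * (c * norm (s n))\<^sup>2"
      by (rule mult_right_mono) simp
    thus ?thesis by linarith
  qed
  finally show ?thesis by (simp add: ws power_mult_distrib)
qed (use stay in auto)

lemma convergent_norm:
  assumes z: "z \<in> Z"
  shows "convergent (\<lambda>n. norm (w n - z))"
proof -
  have "norm (w (Suc n) - z) \<le> norm (w n - z)" for n
  proof (rule power2_le_imp_le)
    have "0 \<le> \<epsilon> / 2 * (norm (w (Suc n) - w n))\<^sup>2" using \<epsilon> by simp
    with fejer[OF z, of n] show "(norm (w (Suc n) - z))\<^sup>2 \<le> (norm (w n - z))\<^sup>2" by linarith
  qed simp
  hence "decseq (\<lambda>n. norm (w n - z))" by (rule decseq_SucI)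
  from decseq_convergent[OF this, of 0] show ?thesis by (auto simp: convergent_def)
qed

lemma Bseq_w:
  assumes "Z \<noteq> {}"
  shows "Bseq w"
proof -
  obtain z where "z \<in> Z" using assms by blast
  hence "Bseq (\<lambda>n. norm (w n - z))" by (intro convergent_imp_Bseq convergent_norm)
  hence "Bseq (\<lambda>n. w n - z)" by (simp add: Bseq_def)
  thus ?thesis using Bseq_add[of "\<lambda>n. w n - z" z] by simp
qed

lemma successive_difference_null:
  assumes "Z \<noteq> {}"
  shows "(\<lambda>n. w (Suc n) - w n) \<longlonglongrightarrow> 0"
proof -
  obtain z where z: "z \<in> Z" using assms by blast
  obtain L where L: "(\<lambda>n. norm (w n - z)) \<longlonglongrightarrow> L" using convergent_norm[OF z] by (auto simp: convergent_def)
  have "(\<lambda>n. 2 / \<epsilon> * ((norm (w n - z))\<^sup>2 - (norm (w (Suc n) - z))\<^sup>2)) \<longlonglongrightarrow> 2 / \<epsilon> * (L\<^sup>2 - L\<^sup>2)"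
    by (intro tendsto_intros L LIMSEQ_Suc[OF L])
  hence lim: "(\<lambda>n. 2 / \<epsilon> * ((norm (w n - z))\<^sup>2 - (norm (w (Suc n) - z))\<^sup>2)) \<longlonglongrightarrow> 0" by simp
  have bound: "(norm (w (Suc n) - w n))\<^sup>2 \<le> 2 / \<epsilon> * ((norm (w n - z))\<^sup>2 - (norm (w (Suc n) - z))\<^sup>2)" for n
    using fejer[OF z, of n] \<epsilon> by (simp add: field_simps)
  have "(\<lambda>n. (norm (w (Suc n) - w n))\<^sup>2) \<longlonglongrightarrow> 0"
    using bound by (intro Lim_null_comparison[OF always_eventually lim]) simp
  hence "(\<lambda>n. sqrt ((norm (w (Suc n) - w n))\<^sup>2)) \<longlonglongrightarrow> sqrt 0" by (rule tendsto_real_sqrt)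
  thus ?thesis by (simp add: tendsto_norm_zero_iff)
qed

text \<open>A step has length \<open>lam n\<close> times the gap divided by
  \<open>norm (s n)\<close>, and \<open>lam n \<ge> \<epsilon>\<close>; without a step the gap is
  not positive. Vanishing steps thus bound the gap by a null sequence as soon as \<open>s\<close> is
  bounded.\<close>

lemma gap_le:
  "inner (w n - p n) (s n) \<le> norm (w (Suc n) - w n) * norm (s n) / \<epsilon>"
proof (cases "inner (p n - w n) (s n) < 0")
  case True
  let ?\<pi> = "inner (p n - w n) (s n)"
  have "s n \<noteq> 0" using True by auto
  have "norm (w (Suc n) - w n) * norm (s n) = lam n * \<bar>?\<pi>\<bar>"
    using step[OF True] lam[of n] \<epsilon> \<open>s n \<noteq> 0\<close> by (simp add: abs_mult power2_eq_square)
  moreover have "\<epsilon> * \<bar>?\<pi>\<bar> \<le> lam n * \<bar>?\<pi>\<bar>" using lam[of n] by (intro mult_right_mono) auto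
  moreover have "inner (w n - p n) (s n) = - ?\<pi>" by (simp add: inner_diff_left)
  ultimately show ?thesis using \<epsilon> True by (simp add: field_simps)
next
  case False
  hence "inner (w n - p n) (s n) \<le> 0" by (simp add: inner_diff_left)
  also have "0 \<le> norm (w (Suc n) - w n) * norm (s n) / \<epsilon>" using \<epsilon> by simp
  finally show ?thesis .
qed

text \<open>Since \<open>p - w\<close> vanishes strongly, weak cluster points of \<open>w\<close>
  are weak cluster points of \<open>p\<close>, where the graph relation holds and the closedness
  theorem applies.\<close>

theorem weakly_convergent:
  assumes "Z \<noteq> {}" and pw: "(\<lambda>n. p n - w n) \<longlonglongrightarrow> 0" and s: "s \<longlonglongrightarrow> 0"
  shows "\<exists>z\<in>Z. weakly_converges_in S w z"
proof (rule opial[OF S wS convergent_norm \<open>Z \<noteq> {}\<close>])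
  fix r :: "nat \<Rightarrow> nat" and l assume r: "strict_mono r" and l: "weakly_converges_in S (w \<circ> r) l"
  note l' = weakly_converges_in_tendsto[OF l]
  have pr: "weakly_converges_in S (p \<circ> r) l"
    unfolding weakly_converges_in_def
  proof (intro conjI allI ballI l'(2))
    fix d assume "d \<in> S"
    have "(\<lambda>n. inner ((w \<circ> r) n) d + inner (p (r n) - w (r n)) d) \<longlonglongrightarrow> inner l d + inner 0 d"
      using LIMSEQ_subseq_LIMSEQ[OF pw r]
      by (intro tendsto_intros l'(3) \<open>d \<in> S\<close>) (simp add: o_def)
    thus "(\<lambda>n. inner ((p \<circ> r) n) d) \<longlonglongrightarrow> inner l d" by (simp add: inner_diff_left)
  qed (use pS in auto)
  have "Bseq (\<lambda>n. p n - w n)" using pw by (intro convergent_imp_Bseq) (auto simp: convergent_def)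
  then obtain B where B: "norm (p n - w n) \<le> B" for n by (auto simp: Bseq_def)
  obtain C where C: "norm (w n) \<le> C" for n using Bseq_w[OF \<open>Z \<noteq> {}\<close>] by (auto simp: Bseq_def)
  have "norm (p n) \<le> B + C" for n
    using norm_triangle_ineq[of "p n - w n" "w n"] B[of n] C[of n] by simp
  hence "Bseq (p \<circ> r)" by (intro BseqI'[of _ "B + C"]) simp
  moreover have "(s \<circ> r) \<longlonglongrightarrow> 0" using s r by (rule LIMSEQ_subseq_LIMSEQ)
  ultimately have "- T l \<in> subdifferential_on S F l"
    using sub by (intro subdifferential_plus_monotone_closed[OF S F T pr]) (auto simp: o_def)
  with l'(2) show "l \<in> Z" by (simp add: Z_def)
qed

end

section \<open>Direct sums\<close>

lemma mem_direct_sum: "x \<in> direct_sum H \<longleftrightarrow> (\<forall>i. x $ i \<in> H i)"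
  by (simp add: direct_sum_def)

lemma hilbert_subspace_direct_sum:
  fixes H :: "'i::finite \<Rightarrow> 'a::real_inner set"
  assumes "\<And>i. hilbert_subspace (H i)"
  shows "hilbert_subspace (direct_sum H)"
  unfolding hilbert_subspace_def
proof
  note H = hilbert_subspaceD[OF assms]
  show "subspace (direct_sum H)"
    using H(1) by (intro subspaceI) (auto simp: mem_direct_sum subspace_0 subspace_add subspace_scale)
  show "complete (direct_sum H)"
  proof (rule completeI)
    fix X assume X: "\<forall>n. X n \<in> direct_sum H" "Cauchy X"
    have "\<exists>l. l \<in> H i \<and> (\<lambda>n. X n $ i) \<longlonglongrightarrow> l" for i
    proof -
      have m: "\<forall>n. X n $ i \<in> H i" using X(1) by (simp add: mem_direct_sum)
      obtain l where "l \<in> H i" "(\<lambda>n. X n $ i) \<longlonglongrightarrow> l"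
        by (rule completeE[OF H(2) m Cauchy_vec_nth[OF X(2)]])
      thus ?thesis by blast
    qed
    then obtain l where l: "\<And>i. l i \<in> H i" "\<And>i. (\<lambda>n. X n $ i) \<longlonglongrightarrow> l i" by metis
    have "X \<longlonglongrightarrow> (\<chi> i. l i)" using l(2) by (intro vec_tendstoI) simp
    with l(1) show "\<exists>l\<in>direct_sum H. X \<longlonglongrightarrow> l" by (intro bexI) (auto simp: mem_direct_sum)
  qed
qed

lemma hilbert_subspace_Times:
  assumes "hilbert_subspace A" "hilbert_subspace B"
  shows "hilbert_subspace (A \<times> B)"
  unfolding hilbert_subspace_def
proof
  note A = hilbert_subspaceD[OF assms(1)] and B = hilbert_subspaceD[OF assms(2)]
  show "subspace (A \<times> B)" using A(1) B(1) by (rule subspace_Times)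
  show "complete (A \<times> B)"
  proof (rule completeI)
    fix X assume X: "\<forall>n. X n \<in> A \<times> B" "Cauchy X"
    have m: "\<forall>n. fst (X n) \<in> A" "\<forall>n. snd (X n) \<in> B" using X(1) by (auto simp: mem_Times_iff)
    obtain l where l: "l \<in> A" "(\<lambda>n. fst (X n)) \<longlonglongrightarrow> l"
      by (rule completeE[OF A(2) m(1) Cauchy_fst[OF X(2)]])
    obtain m where m: "m \<in> B" "(\<lambda>n. snd (X n)) \<longlonglongrightarrow> m"
      by (rule completeE[OF B(2) m(2) Cauchy_snd[OF X(2)]])
    show "\<exists>l\<in>A \<times> B. X \<longlonglongrightarrow> l"
      using tendsto_Pair[OF l(2) m(2)] l(1) m(1) by (intro bexI[of _ "(l, m)"]) auto
  qed
qed

section \<open>Weakly lower semicontinuous convex functions under linear maps and sums\<close>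

lemma weakly_converges_in_linear_image:
  assumes S: "hilbert_subspace S" and A: "bounded_linear_between S S' A"
    and X: "weakly_converges_in S X l"
  shows "weakly_converges_in S' (\<lambda>n. A (X n)) (A l)"
proof -
  note X' = weakly_converges_in_tendsto[OF X] and adj = adjoint_on[OF S A]
  show ?thesis
    unfolding weakly_converges_in_def
    using bounded_linear_betweenD(1)[OF A] X' adj by auto
qed

text \<open>The point \<open>z\<close> secures properness, since the range of \<open>A\<close> might
  miss the domain of \<open>f\<close>. The weak limit is carried over by the adjoint of
  \<open>A\<close>.\<close>

lemma proper_weakly_lsc_convex_comp:
  assumes S: "hilbert_subspace S" and A: "bounded_linear_between S S' A"
    and f: "proper_weakly_lsc_convex S' f" and z: "z \<in> S" "f (A z) \<noteq> \<infinity>"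
  shows "proper_weakly_lsc_convex S (\<lambda>x. f (A x))"
proof -
  note f' = proper_weakly_lsc_convexD[OF f] and A' = bounded_linear_betweenD(1-3)[OF A]
    and S' = hilbert_subspaceD(1)[OF S]
  have "f (A ((1 - t) *\<^sub>R x + t *\<^sub>R y)) \<le> ereal (1 - t) * f (A x) + ereal t * f (A y)"
    if "x \<in> S" "y \<in> S" "0 < t" "t < 1" for x y t
    using f'(4)[OF A'(1)[OF that(1)] A'(1)[OF that(2)] that(3,4)] that(1,2) S'
    by (simp add: A'(2,3) subspace_scale)
  with z f'(1) A'(1) f'(3)[OF weakly_converges_in_linear_image[OF S A]] show ?thesis
    unfolding proper_weakly_lsc_convex_def by blast
qed

text \<open>Excluding the value \<open>-\<infinity>\<close> for \<open>a\<close> and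
  \<open>b\<close> keeps both lower limits above it, so their sum is never of the form
  \<open>\<infinity> - \<infinity>\<close>.\<close>

lemma liminf_add_ge:
  fixes a b :: ereal
  assumes "a \<le> liminf u" "b \<le> liminf v" "a \<noteq> -\<infinity>" "b \<noteq> -\<infinity>"
  shows "a + b \<le> liminf (\<lambda>n. u n + v n)"
proof -
  have "a + b \<le> liminf u + liminf v" using assms(1,2) by (rule add_mono)
  also have "\<dots> \<le> liminf (\<lambda>n. u n + v n)" using assms by (intro ereal_liminf_add_mono) auto
  finally show ?thesis .
qed

lemma proper_weakly_lsc_convex_add:
  assumes f: "proper_weakly_lsc_convex S f" and g: "proper_weakly_lsc_convex S g"
    and z: "z \<in> S" "f z \<noteq> \<infinity>" "g z \<noteq> \<infinity>"
  shows "proper_weakly_lsc_convex S (\<lambda>x. f x + g x)"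
proof -
  note f' = proper_weakly_lsc_convexD[OF f] and g' = proper_weakly_lsc_convexD[OF g]
  have "f l + g l \<le> liminf (\<lambda>n. f (X n) + g (X n))" if X: "weakly_converges_in S X l" for X l
    using weakly_converges_in_tendsto(2)[OF X] f' g' X by (intro liminf_add_ge) auto
  moreover have "f ((1 - t) *\<^sub>R x + t *\<^sub>R y) + g ((1 - t) *\<^sub>R x + t *\<^sub>R y)
      \<le> ereal (1 - t) * (f x + g x) + ereal t * (f y + g y)"
    if "x \<in> S" "y \<in> S" "0 < t" "t < 1" for x y t
  proof -
    have "f ((1 - t) *\<^sub>R x + t *\<^sub>R y) + g ((1 - t) *\<^sub>R x + t *\<^sub>R y)
        \<le> (ereal (1 - t) * f x + ereal t * f y) + (ereal (1 - t) * g x + ereal t * g y)"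
      using f'(4)[OF that] g'(4)[OF that] by (rule add_mono)
    also have "\<dots> = ereal (1 - t) * (f x + g x) + ereal t * (f y + g y)"
      using that by (simp add: ereal_pos_distrib add_ac)
    finally show ?thesis .
  qed
  moreover have "\<forall>x\<in>S. f x + g x \<noteq> -\<infinity>" using f'(1) g'(1) by auto
  moreover have "\<exists>x\<in>S. f x + g x \<noteq> \<infinity>" using z by auto
  ultimately show ?thesis unfolding proper_weakly_lsc_convex_def by blast
qed

lemma proper_weakly_lsc_convex_sum:
  assumes "finite A" "\<And>i. i \<in> A \<Longrightarrow> proper_weakly_lsc_convex S (f i)"
    and z: "z \<in> S" "\<And>i. i \<in> A \<Longrightarrow> f i z \<noteq> \<infinity>"
  shows "proper_weakly_lsc_convex S (\<lambda>x. \<Sum>i\<in>A. f i x)"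
  using assms(1,2,4)
proof (induction A rule: finite_induct)
  case empty
  show ?case using z(1) by (auto simp: proper_weakly_lsc_convex_def Liminf_const)
next
  case (insert i A)
  have "proper_weakly_lsc_convex S (\<lambda>x. f i x + (\<Sum>i\<in>A. f i x))"
    using insert z(1) by (intro proper_weakly_lsc_convex_add[where z = z]) (auto simp: sum_Pinfty)
  with insert(1,2) show ?case by simp
qed

section \<open>Closure of Lipschitz continuity under composition, with the constants left
  existential\<close>

lemma ex_lipschitz_add:
  fixes f g :: "'a::metric_space \<Rightarrow> 'b::real_normed_vector"
  shows "\<exists>K. K-lipschitz_on S f \<Longrightarrow> \<exists>K. K-lipschitz_on S g \<Longrightarrow> \<exists>K. K-lipschitz_on S (\<lambda>x. f x + g x)"
  by (blast intro: lipschitz_on_add)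

lemma ex_lipschitz_diff:
  fixes f g :: "'a::metric_space \<Rightarrow> 'b::real_normed_vector"
  shows "\<exists>K. K-lipschitz_on S f \<Longrightarrow> \<exists>K. K-lipschitz_on S g \<Longrightarrow> \<exists>K. K-lipschitz_on S (\<lambda>x. f x - g x)"
  by (blast intro: lipschitz_on_diff)

lemma ex_lipschitz_sum:
  fixes f :: "'i \<Rightarrow> 'a::metric_space \<Rightarrow> 'b::real_normed_vector"
  assumes "finite A" "\<And>i. i \<in> A \<Longrightarrow> \<exists>K. K-lipschitz_on S (f i)"
  shows "\<exists>K. K-lipschitz_on S (\<lambda>x. \<Sum>i\<in>A. f i x)"
  using assms
proof (induction A rule: finite_induct)
  case empty
  show ?case using lipschitz_on_constant[of S 0] by auto
next
  case (insert i A)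
  thus ?case by (simp add: ex_lipschitz_add)
qed

lemma ex_lipschitz_compose:
  assumes "\<exists>K. K-lipschitz_on T g" "\<exists>K. K-lipschitz_on S f" "f ` S \<subseteq> T"
  shows "\<exists>K. K-lipschitz_on S (\<lambda>x. g (f x))"
proof -
  obtain K L where "K-lipschitz_on T g" "L-lipschitz_on S f" using assms(1,2) by blast
  thus ?thesis using lipschitz_on_compose2[of L S f K g] lipschitz_on_subset[OF _ assms(3)] by blast
qed

lemma ex_lipschitz_bounded_linear:
  assumes "bounded_linear A"
  shows "\<exists>K. K-lipschitz_on S A"
  using bounded_linear.lipschitz_boundE[OF assms] by blast

lemma ex_lipschitz_Pair:
  assumes "\<exists>K. K-lipschitz_on S f" "\<exists>K. K-lipschitz_on S g"
  shows "\<exists>K. K-lipschitz_on S (\<lambda>x. (f x, g x))"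
  using assms lipschitz_on_Pair by blast

lemma ex_lipschitz_vec:
  fixes f :: "'i::finite \<Rightarrow> 'a::metric_space \<Rightarrow> 'b::real_normed_vector"
  assumes "\<And>i. \<exists>K. K-lipschitz_on S (f i)"
  shows "\<exists>K. K-lipschitz_on S (\<lambda>x. \<chi> i. f i x)"
proof -
  obtain K where K: "\<And>i. (K i)-lipschitz_on S (f i)" using assms by metis
  have "(\<Sum>i\<in>UNIV. K i)-lipschitz_on S (\<lambda>x. \<chi> i. f i x)"
  proof (rule lipschitz_onI)
    fix x y assume xy: "x \<in> S" "y \<in> S"
    have "dist (\<chi> i. f i x) (\<chi> i. f i y) \<le> (\<Sum>i\<in>UNIV. dist (f i x) (f i y))"
      unfolding dist_vec_def by (rule order_trans[OF L2_set_le_sum]) auto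
    also have "\<dots> \<le> (\<Sum>i\<in>UNIV. K i * dist x y)"
      by (intro sum_mono lipschitz_onD[OF K xy])
    finally show "dist (\<chi> i. f i x) (\<chi> i. f i y) \<le> (\<Sum>i\<in>UNIV. K i) * dist x y"
      by (simp add: sum_distrib_right)
  qed (intro sum_nonneg lipschitz_on_nonneg[OF K])
  thus ?thesis by blast
qed

lemma zero_if_inner_nonneg:
  assumes "subspace S" "v \<in> S" "\<And>d. d \<in> S \<Longrightarrow> 0 \<le> inner d v"
  shows "v = 0"
  using assms(3)[of "- v"] subspace_neg[OF assms(1,2)] inner_gt_zero_iff[of v]
  by (force simp flip: not_le)

section \<open>Deviations in a single coordinate\<close>

lemma inner_subst_comp_diff:
  fixes x :: "'a::real_inner ^ 'i::finite"
  shows "inner (subst_comp i t x - x) v = inner (t - x $ i) (v $ i)"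
proof -
  have "inner (subst_comp i t x - x) v = (\<Sum>j\<in>UNIV. if j = i then inner (t - x $ i) (v $ i) else 0)"
    unfolding inner_vec_def by (rule sum.cong) (auto simp: subst_comp_def)
  thus ?thesis by simp
qed

lemma subst_comp_nth: "subst_comp i t x $ j = (if j = i then t else x $ j)"
  by (simp add: subst_comp_def)

lemma subst_comp_self: "subst_comp i (x $ i) x = x"
  by (simp add: vec_eq_iff subst_comp_nth)

section \<open>The saddle operator of the Nash equilibrium problem\<close>

locale nash_problem =
  fixes H :: "'i::finite \<Rightarrow> 'h::real_inner set"
    and Y :: "'i \<Rightarrow> 'y::real_inner set"
    and G :: "'k::finite \<Rightarrow> 'g::real_inner set"
    and \<phi> :: "'i \<Rightarrow> 'h \<Rightarrow> ereal" and \<psi> :: "'i \<Rightarrow> 'h \<Rightarrow> real" and \<alpha> :: "'i \<Rightarrow> real"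
    and f :: "'i \<Rightarrow> 'y ^ 'i \<Rightarrow> real" and Q :: "'y ^ 'i \<Rightarrow> 'y ^ 'i"
    and g :: "'k \<Rightarrow> 'g \<Rightarrow> ereal" and h :: "'k \<Rightarrow> 'g \<Rightarrow> real" and \<beta> :: "'k \<Rightarrow> real"
    and M :: "'i \<Rightarrow> 'h \<Rightarrow> 'y" and L :: "'k \<Rightarrow> 'i \<Rightarrow> 'h \<Rightarrow> 'g"
  assumes H: "\<And>i. hilbert_subspace (H i)"
    and Y: "\<And>i. hilbert_subspace (Y i)"
    and G: "\<And>k. hilbert_subspace (G k)"
    and \<phi>: "\<And>i. proper_lsc_convex (H i) (\<phi> i)"
    and \<psi>: "\<And>i. convex_on (H i) (\<psi> i)"
           "\<And>i. \<psi> i differentiable_on H i"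
           "\<And>i. (\<alpha> i)-lipschitz_on (H i) (gradient_on (H i) (\<psi> i))"
    and f: "\<And>i w. w \<in> direct_sum Y \<Longrightarrow> convex_on (Y i) (\<lambda>t. f i (subst_comp i t w))"
           "\<And>i w. w \<in> direct_sum Y \<Longrightarrow>
              gateaux_differentiable_on (Y i) (\<lambda>t. f i (subst_comp i t w))"
    and Q_def: "\<And>w. Q w = (\<chi> i. partial_gradient Y i (f i) w)"
    and Q: "monotone_operator_on (direct_sum Y) Q"
           "\<exists>B. B-lipschitz_on (direct_sum Y) Q"
    and g: "\<And>k. proper_lsc_convex (G k) (g k)"
    and h: "\<And>k. convex_on (G k) (h k)"
           "\<And>k. h k differentiable_on G k"
           "\<And>k. (\<beta> k)-lipschitz_on (G k) (gradient_on (G k) (h k))"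
    and M: "\<And>i. bounded_linear_between (H i) (Y i) (M i)"
    and L: "\<And>k i. bounded_linear_between (H i) (G k) (L k i)"
begin

abbreviation grad_\<psi> :: "'i \<Rightarrow> 'h \<Rightarrow> 'h" where "grad_\<psi> i \<equiv> gradient_on (H i) (\<psi> i)"
abbreviation grad_h :: "'k \<Rightarrow> 'g \<Rightarrow> 'g" where "grad_h k \<equiv> gradient_on (G k) (h k)"
abbreviation M_adj :: "'i \<Rightarrow> 'y \<Rightarrow> 'h" where "M_adj i \<equiv> adjoint_on (H i) (M i)"
abbreviation L_adj :: "'k \<Rightarrow> 'i \<Rightarrow> 'g \<Rightarrow> 'h" where "L_adj k i \<equiv> adjoint_on (H i) (L k i)"

definition Mv :: "'h ^ 'i \<Rightarrow> 'y ^ 'i" where "Mv x = (\<chi> i. M i (x $ i))"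
definition Lv :: "'h ^ 'i \<Rightarrow> 'g ^ 'k" where "Lv x = (\<chi> k. \<Sum>i\<in>UNIV. L k i (x $ i))"

definition Tx :: "'h ^ 'i \<Rightarrow> 'y ^ 'i \<Rightarrow> 'g ^ 'k \<Rightarrow> 'h ^ 'i" where
  "Tx x u v = (\<chi> i. grad_\<psi> i (x $ i) + M_adj i (u $ i) + (\<Sum>k\<in>UNIV. L_adj k i (v $ k)))"
definition Tz :: "'g ^ 'k \<Rightarrow> 'g ^ 'k \<Rightarrow> 'g ^ 'k" where
  "Tz z v = (\<chi> k. grad_h k (z $ k) - v $ k)"

text \<open>The saddle operator: its points are \<open>((x, z), (y, u, v))\<close>, with the variables of the
  nonsmooth functions in the first component.\<close>

definition T where
  "T = (\<lambda>((x, z), (y, u, v)). ((Tx x u v, Tz z v), (Q y - u, y - Mv x, z - Lv x)))"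
definition F where
  "F = (\<lambda>((x :: 'h ^ 'i, z :: 'g ^ 'k), (_ :: ('y ^ 'i) \<times> ('y ^ 'i) \<times> ('g ^ 'k))).
     (\<Sum>i\<in>UNIV. \<phi> i (x $ i)) + (\<Sum>k\<in>UNIV. g k (z $ k)))"
definition SS where
  "SS = (direct_sum H \<times> direct_sum G) \<times> (direct_sum Y \<times> direct_sum Y \<times> direct_sum G)"

lemma T_apply: "T ((x, z), (y, u, v)) = ((Tx x u v, Tz z v), (Q y - u, y - Mv x, z - Lv x))"
  by (simp add: T_def)

lemma F_apply: "F ((x, z), r) = (\<Sum>i\<in>UNIV. \<phi> i (x $ i)) + (\<Sum>k\<in>UNIV. g k (z $ k))"
  by (cases r) (simp add: F_def)

lemma mem_SS: "((x, z), (y, u, v)) \<in> SS \<longleftrightarrow>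
    x \<in> direct_sum H \<and> z \<in> direct_sum G \<and> y \<in> direct_sum Y \<and> u \<in> direct_sum Y \<and> v \<in> direct_sum G"
  by (auto simp: SS_def)

lemmas subH = hilbert_subspaceD(1)[OF H]
lemmas subY = hilbert_subspaceD(1)[OF Y]
lemmas subG = hilbert_subspaceD(1)[OF G]

lemma DS: "hilbert_subspace (direct_sum H)" "hilbert_subspace (direct_sum Y)" "hilbert_subspace (direct_sum G)"
  by (intro hilbert_subspace_direct_sum H Y G)+

lemma hilbert_SS: "hilbert_subspace SS"
  unfolding SS_def by (intro hilbert_subspace_Times DS)

lemmas adjM = adjoint_on[OF H M] and adjL = adjoint_on[OF H L]
lemmas grad_\<psi>_mem = gradient_on(1)[OF H _ \<psi>(2)]
lemmas grad_h_mem = gradient_on(1)[OF G _ h(2)]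

lemma Mv_mem: "x \<in> direct_sum H \<Longrightarrow> Mv x \<in> direct_sum Y"
  by (simp add: Mv_def mem_direct_sum bounded_linear_betweenD(1)[OF M])

lemma Lv_mem: "x \<in> direct_sum H \<Longrightarrow> Lv x \<in> direct_sum G"
  by (simp add: Lv_def mem_direct_sum bounded_linear_betweenD(1)[OF L] subspace_sum[OF subG])

lemma Mv_diff: "x \<in> direct_sum H \<Longrightarrow> x' \<in> direct_sum H \<Longrightarrow> Mv (x - x') = Mv x - Mv x'"
  by (simp add: Mv_def mem_direct_sum vec_eq_iff bounded_linear_between_diff[OF M subH])

lemma Lv_diff: "x \<in> direct_sum H \<Longrightarrow> x' \<in> direct_sum H \<Longrightarrow> Lv (x - x') = Lv x - Lv x'"
  by (simp add: Lv_def mem_direct_sum vec_eq_iff bounded_linear_between_diff[OF L subH] sum_subtractf)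

text \<open>Moving the adjoints onto \<open>d\<close> exposes the terms
  \<open>inner (Mv d) u\<close> and \<open>inner (Lv d) v\<close>, which cancel against the rows of
  \<open>T\<close> that contain \<open>Mv\<close> and \<open>Lv\<close>.\<close>

lemma inner_Tx:
  assumes "d \<in> direct_sum H"
  shows "inner d (Tx x u v) = (\<Sum>i\<in>UNIV. inner (d $ i) (grad_\<psi> i (x $ i))) + inner (Mv d) u + inner (Lv d) v"
proof -
  have d: "d $ i \<in> H i" for i using assms by (simp add: mem_direct_sum)
  have "inner (Lv d) v = (\<Sum>k\<in>UNIV. \<Sum>i\<in>UNIV. inner (d $ i) (L_adj k i (v $ k)))"
    unfolding inner_vec_def Lv_def by (simp add: inner_sum_left adjL(2) d)
  also have "\<dots> = (\<Sum>i\<in>UNIV. \<Sum>k\<in>UNIV. inner (d $ i) (L_adj k i (v $ k)))" by (rule sum.swap)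
  finally show ?thesis
    by (simp add: Tx_def Mv_def inner_vec_def inner_add_right inner_sum_right sum.distrib adjM(2) d)
qed

lemma Q_nth: "Q w $ i = gateaux_gradient_on (Y i) (\<lambda>t. f i (subst_comp i t w)) (w $ i)"
  by (simp add: Q_def partial_gradient_def)

lemma partial_derivative:
  assumes "w \<in> direct_sum Y"
  shows "Q w $ i \<in> Y i"
    "has_gateaux_derivative_on (Y i) (\<lambda>t. f i (subst_comp i t w)) (\<lambda>d. inner d (Q w $ i)) (w $ i)"
proof -
  have "w $ i \<in> Y i" using assms by (simp add: mem_direct_sum)
  then obtain f' where "has_gateaux_derivative_on (Y i) (\<lambda>t. f i (subst_comp i t w)) f' (w $ i)"
    using f(2)[OF assms, of i] unfolding gateaux_differentiable_on_def by blast
  from gateaux_gradient_on[OF Y this] show "Q w $ i \<in> Y i"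
    "has_gateaux_derivative_on (Y i) (\<lambda>t. f i (subst_comp i t w)) (\<lambda>d. inner d (Q w $ i)) (w $ i)"
    by (simp_all add: Q_nth)
qed

lemma Q_mem: "w \<in> direct_sum Y \<Longrightarrow> Q w \<in> direct_sum Y"
  by (simp add: mem_direct_sum[of "Q w"] partial_derivative(1))

lemma f_above_tangent:
  assumes "w \<in> direct_sum Y" "t \<in> Y i"
  shows "f i w + inner (t - w $ i) (Q w $ i) \<le> f i (subst_comp i t w)"
  using convex_on_gateaux_above_tangent[OF f(1)[OF assms(1)] subY _ assms(2) partial_derivative(2)[OF assms(1)]]
    assms(1) by (simp add: mem_direct_sum subst_comp_self)

lemma Tx_mem: "x \<in> direct_sum H \<Longrightarrow> Tx x u v \<in> direct_sum H"
  by (simp add: Tx_def mem_direct_sum subspace_add[OF subH] subspace_sum[OF subH] adjM(1) adjL(1) grad_\<psi>_mem)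

lemma Tz_mem: "z \<in> direct_sum G \<Longrightarrow> v \<in> direct_sum G \<Longrightarrow> Tz z v \<in> direct_sum G"
  by (simp add: Tz_def mem_direct_sum subspace_diff[OF subG] grad_h_mem)

lemma tuple_cases:
  obtains x z y u v where "p = ((x, z), (y, u, v))"
  by (rule that[of "fst (fst p)" "snd (fst p)" "fst (snd p)" "fst (snd (snd p))" "snd (snd (snd p))"]) simp

lemma T_into: "T ` SS \<subseteq> SS"
proof
  fix p' assume "p' \<in> T ` SS"
  then obtain p where p: "p \<in> SS" "p' = T p" by blast
  obtain x z y u v where [simp]: "p = ((x, z), (y, u, v))" by (rule tuple_cases)
  show "p' \<in> SS"
    using p hilbert_subspaceD(1)[OF DS(2)] hilbert_subspaceD(1)[OF DS(3)]
    by (simp add: T_apply mem_SS Tx_mem Tz_mem Q_mem Mv_mem Lv_mem subspace_diff)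
qed

text \<open>The gradients and \<open>Q\<close> contribute nonnegative terms. Every remaining term
  pairs a primal difference with a multiplier difference and occurs twice with opposite
  signs.\<close>

lemma T_monotone: "monotone_operator_on SS T"
  unfolding monotone_operator_on_def
proof (intro ballI)
  fix p p' assume pp: "p \<in> SS" "p' \<in> SS"
  obtain x z y u v where p: "p = ((x, z), (y, u, v))" by (rule tuple_cases)
  obtain x' z' y' u' v' where p': "p' = ((x', z'), (y', u', v'))" by (rule tuple_cases)
  have m: "x \<in> direct_sum H" "x' \<in> direct_sum H" "z \<in> direct_sum G" "z' \<in> direct_sum G"
      "y \<in> direct_sum Y" "y' \<in> direct_sum Y"
    using pp by (auto simp: p p' mem_SS)
  hence dx: "x - x' \<in> direct_sum H" using hilbert_subspaceD(1)[OF DS(1)] by (simp add: subspace_diff)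
  have 1: "inner (x - x') (Tx x u v - Tx x' u' v')
      = (\<Sum>i\<in>UNIV. inner (x $ i - x' $ i) (grad_\<psi> i (x $ i) - grad_\<psi> i (x' $ i)))
        + inner (Mv x - Mv x') (u - u') + inner (Lv x - Lv x') (v - v')"
    unfolding inner_diff_right[of "x - x'"] inner_Tx[OF dx] Mv_diff[OF m(1,2)] Lv_diff[OF m(1,2)]
    by (simp add: inner_diff_right sum_subtractf)
  have 2: "inner (z - z') (Tz z v - Tz z' v')
      = (\<Sum>k\<in>UNIV. inner (z $ k - z' $ k) (grad_h k (z $ k) - grad_h k (z' $ k))) - inner (z - z') (v - v')"
    by (simp add: Tz_def inner_vec_def inner_diff_right sum_subtractf)
  have "0 \<le> (\<Sum>i\<in>UNIV. inner (x $ i - x' $ i) (grad_\<psi> i (x $ i) - grad_\<psi> i (x' $ i)))"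
    using m by (intro sum_nonneg gradient_on_monotone[OF H \<psi>(2,1)]) (auto simp: mem_direct_sum)
  moreover have "0 \<le> (\<Sum>k\<in>UNIV. inner (z $ k - z' $ k) (grad_h k (z $ k) - grad_h k (z' $ k)))"
    using m by (intro sum_nonneg gradient_on_monotone[OF G h(2,1)]) (auto simp: mem_direct_sum)
  moreover have "0 \<le> inner (y - y') (Q y - Q y')"
    using Q(1) m by (simp add: monotone_operator_on_def)
  moreover have "inner (p - p') (T p - T p')
      = inner (x - x') (Tx x u v - Tx x' u' v') + inner (z - z') (Tz z v - Tz z' v')
        + (inner (y - y') (Q y - Q y') - inner (y - y') (u - u'))
        + inner (u - u') (y - y') - inner (u - u') (Mv x - Mv x')
        + inner (v - v') (z - z') - inner (v - v') (Lv x - Lv x')"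
    by (simp add: p p' T_apply inner_diff_right)
  ultimately show "0 \<le> inner (p - p') (T p - T p')"
    unfolding 1 2 by (simp add: inner_commute)
qed

lemma T_lipschitz: "\<exists>K. K-lipschitz_on SS T"
proof -
  have lip\<psi>: "\<exists>K. K-lipschitz_on (H i) (grad_\<psi> i)" for i using \<psi>(3) by blast
  have liph: "\<exists>K. K-lipschitz_on (G k) (grad_h k)" for k using h(3) by blast
  have proj: "\<exists>K. K-lipschitz_on SS (\<lambda>p. fst (fst p))" "\<exists>K. K-lipschitz_on SS (\<lambda>p. snd (fst p))"
    "\<exists>K. K-lipschitz_on SS (\<lambda>p. fst (snd p))" "\<exists>K. K-lipschitz_on SS (\<lambda>p. fst (snd (snd p)))"
    "\<exists>K. K-lipschitz_on SS (\<lambda>p. snd (snd (snd p)))"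
    by (intro ex_lipschitz_bounded_linear bounded_linear_fst_comp bounded_linear_snd_comp
        bounded_linear_ident)+
  have nth: "\<exists>K. K-lipschitz_on SS (\<lambda>p. A p $ j)" if "\<exists>K. K-lipschitz_on SS A" for A :: "_ \<Rightarrow> 'b::real_inner ^ 'n::finite" and j
    by (rule ex_lipschitz_compose[OF ex_lipschitz_bounded_linear[OF bounded_linear_vec_nth, of UNIV] that]) simp
  have mem: "fst (fst p) $ i \<in> H i" "snd (fst p) $ k \<in> G k" "fst (snd p) \<in> direct_sum Y" if "p \<in> SS" for p i k
    using that by (auto simp: SS_def mem_direct_sum)
  have a: "\<exists>K. K-lipschitz_on SS (\<lambda>p. Tx (fst (fst p)) (fst (snd (snd p))) (snd (snd (snd p))))"
    unfolding Tx_def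
  proof (intro ex_lipschitz_vec ex_lipschitz_add ex_lipschitz_sum)
    fix i k
    show "\<exists>K. K-lipschitz_on SS (\<lambda>p. grad_\<psi> i (fst (fst p) $ i))"
      by (rule ex_lipschitz_compose[OF lip\<psi> nth[OF proj(1)]]) (use mem in auto)
    show "\<exists>K. K-lipschitz_on SS (\<lambda>p. M_adj i (fst (snd (snd p)) $ i))"
      by (rule ex_lipschitz_compose[OF bounded_linear_between_lipschitz[OF
              bounded_linear_between_adjoint_on[OF H M] subspace_UNIV] nth[OF proj(4)]]) simp
    show "\<exists>K. K-lipschitz_on SS (\<lambda>p. L_adj k i (snd (snd (snd p)) $ k))"
      by (rule ex_lipschitz_compose[OF bounded_linear_between_lipschitz[OF
              bounded_linear_between_adjoint_on[OF H L] subspace_UNIV] nth[OF proj(5)]]) simp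
  qed simp
  have b: "\<exists>K. K-lipschitz_on SS (\<lambda>p. Tz (snd (fst p)) (snd (snd (snd p))))"
    unfolding Tz_def
  proof (intro ex_lipschitz_vec ex_lipschitz_diff nth proj)
    show "\<exists>K. K-lipschitz_on SS (\<lambda>p. grad_h k (snd (fst p) $ k))" for k
      by (rule ex_lipschitz_compose[OF liph nth[OF proj(2)]]) (use mem in auto)
  qed
  have c: "\<exists>K. K-lipschitz_on SS (\<lambda>p. Mv (fst (fst p)))"
    unfolding Mv_def
  proof (intro ex_lipschitz_vec)
    show "\<exists>K. K-lipschitz_on SS (\<lambda>p. M i (fst (fst p) $ i))" for i
      by (rule ex_lipschitz_compose[OF bounded_linear_between_lipschitz[OF M subH] nth[OF proj(1)]])
         (use mem in auto)
  qed
  have d: "\<exists>K. K-lipschitz_on SS (\<lambda>p. Lv (fst (fst p)))"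
    unfolding Lv_def
  proof (intro ex_lipschitz_vec ex_lipschitz_sum)
    show "\<exists>K. K-lipschitz_on SS (\<lambda>p. L k i (fst (fst p) $ i))" for k i
      by (rule ex_lipschitz_compose[OF bounded_linear_between_lipschitz[OF L subH] nth[OF proj(1)]])
         (use mem in auto)
  qed simp
  have e: "\<exists>K. K-lipschitz_on SS (\<lambda>p. Q (fst (snd p)))"
    by (rule ex_lipschitz_compose[OF Q(2) proj(3)]) (use mem in auto)
  show ?thesis
    unfolding T_def case_prod_beta
    by (intro ex_lipschitz_Pair ex_lipschitz_diff proj a b c d e)
qed

lemma bounded_linear_between_comp_nth:
  assumes "bounded_linear A" "A ` SS \<subseteq> direct_sum B"
  shows "bounded_linear_between SS (B j) (\<lambda>p. A p $ j)"
proof -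
  interpret A: bounded_linear "\<lambda>p. A p $ j"
    using bounded_linear_compose[OF bounded_linear_vec_nth assms(1)] by (simp add: o_def)
  obtain K where "norm (A p $ j) \<le> norm p * K" for p using A.bounded by blast
  thus ?thesis
    unfolding bounded_linear_between_def
    using assms(2) by (auto simp: A.add A.scaleR mem_direct_sum mult.commute intro!: exI[of _ K])
qed

lemma F_proper_weakly_lsc_convex: "proper_weakly_lsc_convex SS F"
proof -
  have "\<forall>i. \<exists>x. x \<in> H i \<and> \<phi> i x \<noteq> \<infinity>" using proper_lsc_convexD(2)[OF \<phi>] by blast
  from choice[OF this] obtain x where x: "\<And>i. x i \<in> H i" "\<And>i. \<phi> i (x i) \<noteq> \<infinity>" by blast
  have "\<forall>k. \<exists>z. z \<in> G k \<and> g k z \<noteq> \<infinity>" using proper_lsc_convexD(2)[OF g] by blast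
  from choice[OF this] obtain z where z: "\<And>k. z k \<in> G k" "\<And>k. g k (z k) \<noteq> \<infinity>" by blast
  \<comment> \<open>The nonsmooth functions depend on separate coordinates, so domain points chosen
    one by one combine into a common one, as the sum of proper functions requires.\<close>
  define p0 :: "(('h ^ 'i) \<times> ('g ^ 'k)) \<times> ('y ^ 'i) \<times> ('y ^ 'i) \<times> ('g ^ 'k)"
    where "p0 = ((\<chi> i. x i, \<chi> k. z k), 0)"
  have p0: "p0 \<in> SS" "\<And>i. \<phi> i (fst (fst p0) $ i) \<noteq> \<infinity>" "\<And>k. g k (snd (fst p0) $ k) \<noteq> \<infinity>"
    using x z hilbert_subspaceD(1)[OF DS(2)] hilbert_subspaceD(1)[OF DS(3)]
    by (auto simp: p0_def zero_prod_def mem_SS mem_direct_sum subspace_0 subspace_0[OF subY] subspace_0[OF subG])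
  have 1: "proper_weakly_lsc_convex SS (\<lambda>p. \<phi> i (fst (fst p) $ i))" for i
    by (intro proper_weakly_lsc_convex_comp[OF hilbert_SS _ proper_weakly_lsc_convex_if_lsc[OF H \<phi>] p0(1)]
        bounded_linear_between_comp_nth[where A = "\<lambda>p. fst (fst p)"]
        bounded_linear_fst_comp bounded_linear_ident p0) (auto simp: SS_def)
  have 2: "proper_weakly_lsc_convex SS (\<lambda>p. g k (snd (fst p) $ k))" for k
    by (intro proper_weakly_lsc_convex_comp[OF hilbert_SS _ proper_weakly_lsc_convex_if_lsc[OF G g] p0(1)]
        bounded_linear_between_comp_nth[where A = "\<lambda>p. snd (fst p)"]
        bounded_linear_fst_comp bounded_linear_snd_comp bounded_linear_ident p0) (auto simp: SS_def)
  have "F = (\<lambda>p. (\<Sum>i\<in>UNIV. \<phi> i (fst (fst p) $ i)) + (\<Sum>k\<in>UNIV. g k (snd (fst p) $ k)))"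
    by (auto simp: F_def)
  moreover have "proper_weakly_lsc_convex SS \<dots>"
    by (intro proper_weakly_lsc_convex_add[OF _ _ p0(1)] proper_weakly_lsc_convex_sum[OF _ _ p0(1)] 1 2 p0)
       (auto simp: sum_Pinfty p0)
  ultimately show ?thesis by simp
qed

text \<open>\<open>F\<close> is separable and independent of \<open>r\<close>, so the coordinatewise
  subgradient inequalities add up. Both the points of the algorithm and the Kuhn-Tucker point enter
  the inclusion this way.\<close>

lemma subdifferential_F:
  assumes s: "\<And>i. s $ i \<in> subdifferential_on (H i) (\<phi> i) (x $ i)"
    and t: "\<And>k. t $ k \<in> subdifferential_on (G k) (g k) (z $ k)"
  shows "((s, t), (0, 0, 0)) \<in> subdifferential_on SS F ((x, z), r)"
  unfolding subdifferential_on_def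
proof (intro CollectI conjI ballI)
  have "s $ i \<in> H i" "t $ k \<in> G k" for i k using s t by (auto simp: subdifferential_on_def)
  thus "((s, t), (0, 0, 0)) \<in> SS"
    by (simp add: mem_SS mem_direct_sum subspace_0[OF subY] subspace_0[OF subG])
  fix W assume W: "W \<in> SS"
  obtain w wz wr where [simp]: "W = ((w, wz), wr)"
    by (rule that[of "fst (fst W)" "snd (fst W)" "snd W"]) simp
  have m: "w $ i \<in> H i" "wz $ k \<in> G k" for i k using W by (auto simp: SS_def mem_direct_sum)
  have "ereal (inner (W - ((x, z), r)) ((s, t), (0, 0, 0))) + F ((x, z), r)
      = (\<Sum>i\<in>UNIV. ereal (inner (w $ i - x $ i) (s $ i)) + \<phi> i (x $ i))
        + (\<Sum>k\<in>UNIV. ereal (inner (wz $ k - z $ k) (t $ k)) + g k (z $ k))"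
    by (cases r; cases wr) (simp add: F_apply inner_vec_def sum.distrib add_ac flip: plus_ereal.simps(1))
  also have "\<dots> \<le> (\<Sum>i\<in>UNIV. \<phi> i (w $ i)) + (\<Sum>k\<in>UNIV. g k (wz $ k))"
    by (intro add_mono sum_mono subdifferential_onD(2)[OF s] subdifferential_onD(2)[OF t] m)
  finally show "ereal (inner (W - ((x, z), r)) ((s, t), (0, 0, 0))) + F ((x, z), r) \<le> F W"
    by (simp add: F_apply)
qed

text \<open>The components of the inclusion that do not involve \<open>F\<close> are equations.\<close>

lemma zero_imp_nash_equilibrium:
  assumes p: "((x, z), (y, u, v)) \<in> SS"
    and zero: "- T ((x, z), (y, u, v)) \<in> subdifferential_on SS F ((x, z), (y, u, v))"
  shows "nash_equilibrium H \<phi> \<psi> f g h M L x"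
proof -
  let ?p = "((x, z), (y, u, v))"
  note F' = proper_weakly_lsc_convexD[OF F_proper_weakly_lsc_convex]
  note subD = hilbert_subspaceD(1)[OF DS(1)] hilbert_subspaceD(1)[OF DS(2)] hilbert_subspaceD(1)[OF DS(3)]
  have m: "x \<in> direct_sum H" "z \<in> direct_sum G" "y \<in> direct_sum Y" "u \<in> direct_sum Y" "v \<in> direct_sum G"
    using p by (auto simp: mem_SS)
  have ineq: "ereal (inner (W - ?p) (- T ?p)) + F ?p \<le> F W" if "W \<in> SS" for W
    using subdifferential_onD(2)[OF zero that] .
  have Ffin: "\<bar>F ?p\<bar> \<noteq> \<infinity>"
    using subdifferential_on_finite[OF F'(2) F'(1)[OF p] zero] .
  \<comment> \<open>Moving only the last block leaves \<open>F\<close> unchanged, so the finite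
    value cancels and a linear functional of one sign on a subspace remains; it must vanish.\<close>
  have smooth: "0 \<le> inner d (Q y - u, y - Mv x, z - Lv x)"
    if d: "d \<in> direct_sum Y \<times> direct_sum Y \<times> direct_sum G" for d
  proof -
    obtain d1 d2 d3 where d': "d = (d1, d2, d3)" by (cases d)
    have "((x, z), (y + d1, u + d2, v + d3)) \<in> SS"
      using d m subD by (simp add: d' mem_SS subspace_add)
    note le = ineq[OF this]
    have eq: "F ((x, z), (y + d1, u + d2, v + d3)) = F ?p" by (simp add: F_apply)
    obtain c where c: "F ?p = ereal c" using Ffin by auto
    have "inner (((x, z), (y + d1, u + d2, v + d3)) - ?p) (- T ?p) \<le> 0"
      using le unfolding eq c by simp
    thus ?thesis by (simp add: T_apply d' inner_diff_right)
  qed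
  have "(Q y - u, y - Mv x, z - Lv x) = 0"
    by (rule zero_if_inner_nonneg[OF _ _ smooth])
       (use m subD in \<open>auto intro!: subspace_Times subspace_diff Q_mem Mv_mem Lv_mem\<close>)
  hence u: "u = Q (Mv x)" and z: "z = Lv x" by (auto simp: zero_prod_def)
  \<comment> \<open>Test points \<open>(w, Lv w)\<close> preserve the relation
    \<open>z = Lv x\<close>, so the \<open>v\<close> terms of \<open>Tx\<close> and
    \<open>Tz\<close> cancel and an inequality in the strategies alone is left.\<close>
  have main: "F ((x, Lv x), (y, u, v)) \<le> F ((w, Lv w), (y, u, v))
      + ereal ((\<Sum>i\<in>UNIV. inner (w $ i - x $ i) (grad_\<psi> i (x $ i))) + inner (Mv w - Mv x) (Q (Mv x))
          + (\<Sum>k\<in>UNIV. inner (Lv w $ k - Lv x $ k) (grad_h k (Lv x $ k))))"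
    (is "?Fx \<le> ?Fw + ereal ?r") if w: "w \<in> direct_sum H" for w
  proof -
    have W: "((w, Lv w), (y, u, v)) \<in> SS" using w m by (simp add: mem_SS Lv_mem)
    have dx: "w - x \<in> direct_sum H" using w m(1) subD(1) by (simp add: subspace_diff)
    have "inner (((w, Lv w), (y, u, v)) - ?p) (- T ?p)
        = - (inner (w - x) (Tx x u v)) - inner (Lv w - Lv x) (Tz (Lv x) v)"
      by (simp add: T_apply z)
    also have "\<dots> = - ?r"
      unfolding inner_Tx[OF dx] Mv_diff[OF w m(1)] Lv_diff[OF w m(1)] u
      by (simp add: Tz_def inner_vec_def inner_diff_right sum_subtractf)
    finally have "ereal (- ?r) + ?Fx \<le> ?Fw" using ineq[OF W] by (simp add: z)
    thus ?thesis using Ffin F'(1)[OF W] unfolding z by (cases ?Fx; cases ?Fw) auto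
  qed
  have fin: "\<bar>\<phi> i (x $ i)\<bar> \<noteq> \<infinity>" "\<bar>g k (Lv x $ k)\<bar> \<noteq> \<infinity>" for i k
  proof -
    have "\<phi> i (x $ i) \<noteq> -\<infinity>" "g k (Lv x $ k) \<noteq> -\<infinity>" for i k
      using proper_lsc_convexD(1)[OF \<phi>] proper_lsc_convexD(1)[OF g] m(1,2) by (auto simp: mem_direct_sum z)
    moreover have "(\<Sum>i\<in>UNIV. \<phi> i (x $ i)) \<noteq> \<infinity>" "(\<Sum>k\<in>UNIV. g k (Lv x $ k)) \<noteq> \<infinity>"
      using Ffin by (auto simp: F_apply z)
    ultimately show "\<bar>\<phi> i (x $ i)\<bar> \<noteq> \<infinity>" "\<bar>g k (Lv x $ k)\<bar> \<noteq> \<infinity>" by (auto simp: sum_Pinfty)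
  qed
  \<comment> \<open>Real names for the values at \<open>x\<close> allow the terms of the other
    players to be cancelled, which extended-real terms would not permit in general.\<close>
  define r where "r i = real_of_ereal (\<phi> i (x $ i))" for i
  define s where "s k = real_of_ereal (g k (Lv x $ k))" for k
  have rs: "\<phi> i (x $ i) = ereal (r i)" "g k (Lv x $ k) = ereal (s k)" for i k
    using fin by (auto simp: r_def s_def ereal_real)
  show ?thesis
    unfolding nash_equilibrium_def
  proof (intro conjI allI m(1))
    fix i
    have chi_Mv: "(\<chi> j. M j (x $ j)) = Mv x" by (simp add: Mv_def)
    \<comment> \<open>Player \<open>i\<close> deviates alone: the values of the other
      \<open>\<phi> j\<close> stay fixed, whereas every coupling term may change.\<close>
    let ?w = "\<lambda>\<xi>. subst_comp i \<xi> x"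
    have Lw: "L k i \<xi> + (\<Sum>j\<in>UNIV - {i}. L k j (x $ j)) = Lv (?w \<xi>) $ k" for k \<xi>
    proof -
      have "Lv (?w \<xi>) $ k = L k i (?w \<xi> $ i) + (\<Sum>j\<in>UNIV - {i}. L k j (?w \<xi> $ j))"
        unfolding Lv_def by (simp add: sum.remove[of UNIV i])
      also have "(\<Sum>j\<in>UNIV - {i}. L k j (?w \<xi> $ j)) = (\<Sum>j\<in>UNIV - {i}. L k j (x $ j))"
        by (rule sum.cong) (auto simp: subst_comp_nth)
      finally show ?thesis by (simp add: subst_comp_nth)
    qed
    define J where "J \<xi> = \<phi> i \<xi> + ereal (\<psi> i \<xi>) + ereal (f i (subst_comp i (M i \<xi>) (Mv x)))
        + (\<Sum>k\<in>UNIV. g k (Lv (?w \<xi>) $ k) + ereal (h k (Lv (?w \<xi>) $ k)))" for \<xi>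
    have "J (x $ i) \<le> J \<xi>" if \<xi>: "\<xi> \<in> H i" for \<xi>
    proof -
      have w: "?w \<xi> \<in> direct_sum H" using m(1) \<xi> by (simp add: mem_direct_sum subst_comp_nth)
      have xi: "x $ i \<in> H i" using m(1) by (simp add: mem_direct_sum)
      have Mw: "Mv (?w \<xi>) = subst_comp i (M i \<xi>) (Mv x)"
        by (auto simp: Mv_def vec_eq_iff subst_comp_nth)
      have "(\<Sum>j\<in>UNIV. inner (?w \<xi> $ j - x $ j) (grad_\<psi> j (x $ j)))
          = inner (?w \<xi> - x) (\<chi> j. grad_\<psi> j (x $ j))" by (simp add: inner_vec_def)
      also have "\<dots> = inner (\<xi> - x $ i) (grad_\<psi> i (x $ i))" by (simp add: inner_subst_comp_diff)
      also have "\<dots> \<le> \<psi> i \<xi> - \<psi> i (x $ i)"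
        using convex_on_above_gradient[OF H \<psi>(2,1) xi \<xi>] by simp
      finally have 1: "(\<Sum>j\<in>UNIV. inner (?w \<xi> $ j - x $ j) (grad_\<psi> j (x $ j))) \<le> \<psi> i \<xi> - \<psi> i (x $ i)" .
      have 2: "inner (Mv (?w \<xi>) - Mv x) (Q (Mv x)) \<le> f i (subst_comp i (M i \<xi>) (Mv x)) - f i (Mv x)"
        using f_above_tangent[OF Mv_mem[OF m(1)] bounded_linear_betweenD(1)[OF M \<xi>]]
        unfolding Mw inner_subst_comp_diff by simp
      have 3: "(\<Sum>k\<in>UNIV. inner (Lv (?w \<xi>) $ k - Lv x $ k) (grad_h k (Lv x $ k)))
          \<le> (\<Sum>k\<in>UNIV. h k (Lv (?w \<xi>) $ k)) - (\<Sum>k\<in>UNIV. h k (Lv x $ k))"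
        unfolding sum_subtractf[symmetric]
      proof (rule sum_mono)
        fix k
        have "Lv x $ k \<in> G k" "Lv (?w \<xi>) $ k \<in> G k"
          using Lv_mem[OF m(1)] Lv_mem[OF w] by (auto simp: mem_direct_sum)
        from convex_on_above_gradient[OF G h(2,1) this]
        show "inner (Lv (?w \<xi>) $ k - Lv x $ k) (grad_h k (Lv x $ k)) \<le> h k (Lv (?w \<xi>) $ k) - h k (Lv x $ k)"
          by simp
      qed
      have phi_sum: "(\<Sum>j\<in>UNIV. \<phi> j (?w \<xi> $ j)) = \<phi> i \<xi> + ereal (\<Sum>j\<in>UNIV - {i}. r j)"
      proof -
        have "(\<Sum>j\<in>UNIV. \<phi> j (?w \<xi> $ j)) = \<phi> i (?w \<xi> $ i) + (\<Sum>j\<in>UNIV - {i}. \<phi> j (?w \<xi> $ j))"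
          by (simp add: sum.remove[of UNIV i])
        also have "(\<Sum>j\<in>UNIV - {i}. \<phi> j (?w \<xi> $ j)) = (\<Sum>j\<in>UNIV - {i}. ereal (r j))"
          by (rule sum.cong) (auto simp: subst_comp_nth rs)
        finally show ?thesis by (simp add: subst_comp_nth)
      qed
      have r_sum: "(\<Sum>j\<in>UNIV. r j) = r i + (\<Sum>j\<in>UNIV - {i}. r j)" by (simp add: sum.remove[of UNIV i])
      have Jx: "J (x $ i) = ereal (r i + \<psi> i (x $ i) + f i (Mv x) + (\<Sum>k\<in>UNIV. s k + h k (Lv x $ k)))"
      proof -
        have "subst_comp i (M i (x $ i)) (Mv x) = Mv x"
          by (simp add: Mv_def vec_eq_iff subst_comp_nth)
        thus ?thesis unfolding J_def by (simp add: subst_comp_self rs)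
      qed
      have Jxi: "J \<xi> = (\<phi> i \<xi> + (\<Sum>k\<in>UNIV. g k (Lv (?w \<xi>) $ k)))
          + ereal (\<psi> i \<xi> + f i (subst_comp i (M i \<xi>) (Mv x)) + (\<Sum>k\<in>UNIV. h k (Lv (?w \<xi>) $ k)))"
        unfolding J_def by (simp add: sum.distrib add_ac flip: plus_ereal.simps(1) sum_ereal)
      have "\<phi> i \<xi> \<noteq> -\<infinity>" using proper_lsc_convexD(1)[OF \<phi> \<xi>] .
      moreover have "ereal ((\<Sum>j\<in>UNIV. r j) + (\<Sum>k\<in>UNIV. s k))
          \<le> (\<phi> i \<xi> + ereal (\<Sum>j\<in>UNIV - {i}. r j)) + (\<Sum>k\<in>UNIV. g k (Lv (?w \<xi>) $ k))
            + ereal ((\<psi> i \<xi> - \<psi> i (x $ i)) + (f i (subst_comp i (M i \<xi>) (Mv x)) - f i (Mv x))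
              + ((\<Sum>k\<in>UNIV. h k (Lv (?w \<xi>) $ k)) - (\<Sum>k\<in>UNIV. h k (Lv x $ k))))"
      proof -
        have "ereal ((\<Sum>j\<in>UNIV. r j) + (\<Sum>k\<in>UNIV. s k)) = F ((x, Lv x), (y, u, v))"
          by (simp add: F_apply rs)
        also note main[OF w]
        also have "F ((?w \<xi>, Lv (?w \<xi>)), (y, u, v))
            = (\<phi> i \<xi> + ereal (\<Sum>j\<in>UNIV - {i}. r j)) + (\<Sum>k\<in>UNIV. g k (Lv (?w \<xi>) $ k))"
          by (simp only: F_apply phi_sum)
        finally show ?thesis
          using 1 2 3 by (elim order_trans) (intro add_left_mono, simp)
      qed
      \<comment> \<open>If \<open>\<phi> i \<xi>\<close> or the coupling sum is infinite the claim
        is immediate; otherwise all terms are real and the fixed ones cancel.\<close>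
      ultimately show ?thesis
        unfolding Jx Jxi r_sum
        by (cases "\<phi> i \<xi>"; cases "\<Sum>k\<in>UNIV. g k (Lv (?w \<xi>) $ k)") (auto simp: sum.distrib)
    qed
    hence "is_arg_min J (\<lambda>\<xi>. \<xi> \<in> H i) (x $ i)"
      using m(1) by (auto simp: is_arg_min_def not_less mem_direct_sum)
    thus "is_arg_min (\<lambda>\<xi>. \<phi> i \<xi> + ereal (\<psi> i \<xi>) + ereal (f i (subst_comp i (M i \<xi>) (\<chi> j. M j (x $ j))))
        + (\<Sum>k\<in>UNIV. let w = L k i \<xi> + (\<Sum>j\<in>UNIV - {i}. L k j (x $ j)) in g k w + ereal (h k w)))
        (\<lambda>\<xi>. \<xi> \<in> H i) (x $ i)"
      by (simp only: J_def[abs_def] chi_Mv Lw Let_def)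
  qed
qed

end

section \<open>Bounded and null sequences\<close>

abbreviation null :: "(nat \<Rightarrow> 'a::real_normed_vector) \<Rightarrow> bool" where
  "null f \<equiv> f \<longlonglongrightarrow> 0"

lemma Bseq_plus:
  fixes f g :: "nat \<Rightarrow> 'a::real_normed_vector"
  shows "Bseq f \<Longrightarrow> Bseq g \<Longrightarrow> Bseq (\<lambda>n. f n + g n)"
  unfolding Bseq_eq_bounded by (rule bounded_plus_comp)

lemma Bseq_diff:
  fixes f g :: "nat \<Rightarrow> 'a::real_normed_vector"
  shows "Bseq f \<Longrightarrow> Bseq g \<Longrightarrow> Bseq (\<lambda>n. f n - g n)"
  unfolding Bseq_eq_bounded by (rule bounded_minus_comp)

lemma Bseq_sum:
  fixes f :: "'i \<Rightarrow> nat \<Rightarrow> 'a::real_normed_vector"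
  assumes "finite A" "\<And>i. i \<in> A \<Longrightarrow> Bseq (f i)"
  shows "Bseq (\<lambda>n. \<Sum>i\<in>A. f i n)"
  using assms by (induction A rule: finite_induct) (auto simp: Bseq_plus)

lemma Bseq_scaleR:
  fixes f :: "nat \<Rightarrow> 'a::real_normed_vector" and r :: "nat \<Rightarrow> real"
  assumes "Bseq r" "Bseq f"
  shows "Bseq (\<lambda>n. r n *\<^sub>R f n)"
proof -
  obtain K where K: "\<bar>r n\<bar> \<le> K" for n using assms(1) by (auto simp: Bseq_def)
  obtain L where L: "norm (f n) \<le> L" for n using assms(2) by (auto simp: Bseq_def)
  have "norm (r n *\<^sub>R f n) \<le> K * L" for n
    using mult_mono'[OF K[of n] L[of n]] by simp
  thus ?thesis by (rule BseqI')
qed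

lemma Bseq_lag:
  fixes f :: "nat \<Rightarrow> 'a::real_normed_vector" and t :: "nat \<Rightarrow> nat"
  shows "Bseq f \<Longrightarrow> Bseq (\<lambda>n. f (t n))"
  by (auto simp: Bseq_def)

lemma Bseq_lipschitz:
  fixes A :: "'a::real_normed_vector \<Rightarrow> 'b::real_normed_vector"
  assumes A: "\<exists>K. K-lipschitz_on S A" and f: "\<And>n. f n \<in> S" "Bseq f"
  shows "Bseq (\<lambda>n. A (f n))"
proof -
  obtain K where K: "K-lipschitz_on S A" using A by blast
  obtain B where B: "norm (f n) \<le> B" for n using f(2) by (auto simp: Bseq_def)
  have "norm (A (f n)) \<le> K * (B + B) + norm (A (f 0))" for n
  proof -
    have "norm (A (f n)) \<le> norm (A (f n) - A (f 0)) + norm (A (f 0))"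
      using norm_triangle_ineq[of "A (f n) - A (f 0)" "A (f 0)"] by simp
    also have "norm (A (f n) - A (f 0)) \<le> K * norm (f n - f 0)"
      by (rule lipschitz_on_normD[OF K f(1) f(1)])
    also have "\<dots> \<le> K * (B + B)"
      using norm_triangle_ineq4[of "f n" "f 0"] B[of n] B[of 0] lipschitz_on_nonneg[OF K]
      by (intro mult_left_mono) auto
    finally show ?thesis by simp
  qed
  thus ?thesis by (rule BseqI')
qed

lemma Bseq_if_mem_interval:
  fixes r :: "nat \<Rightarrow> real"
  assumes "\<And>n. r n \<in> {a..b}" "0 \<le> a"
  shows "Bseq r"
proof (rule BseqI')
  show "norm (r n) \<le> b" for n using assms(1)[of n] assms(2) by auto
qed

lemma Bseq_inverse_if_ge:
  fixes r :: "nat \<Rightarrow> real"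
  assumes "\<And>n. r n \<in> {a..b n}" "0 < a"
  shows "Bseq (\<lambda>n. inverse (r n))"
proof (rule BseqI')
  show "norm (inverse (r n)) \<le> inverse a" for n
    using assms(1)[of n] assms(2) by (auto intro!: le_imp_inverse_le)
qed

lemma null_scaleR:
  fixes f :: "nat \<Rightarrow> 'a::real_normed_vector" and r :: "nat \<Rightarrow> real"
  assumes "Bseq r" "null f"
  shows "null (\<lambda>n. r n *\<^sub>R f n)"
proof -
  obtain K where K: "\<bar>r n\<bar> \<le> K" for n using assms(1) by (auto simp: Bseq_def)
  have "norm (r n *\<^sub>R f n) \<le> K * norm (f n)" for n
    using mult_right_mono[OF K[of n] norm_ge_zero] by simp
  thus ?thesis
    by (intro Lim_null_comparison[OF always_eventually
        tendsto_mult_right_zero[OF tendsto_norm_zero[OF assms(2)], of K]]) simp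
qed

lemma null_lipschitz:
  fixes A :: "'a::real_normed_vector \<Rightarrow> 'b::real_normed_vector"
  assumes A: "\<exists>K. K-lipschitz_on S A" and f: "\<And>n. f n \<in> S" "\<And>n. g n \<in> S"
    and fg: "null (\<lambda>n. f n - g n)"
  shows "null (\<lambda>n. A (f n) - A (g n))"
proof -
  obtain K where K: "K-lipschitz_on S A" using A by blast
  show ?thesis
    using lipschitz_on_normD[OF K f]
    by (intro Lim_null_comparison[OF always_eventually
        tendsto_mult_right_zero[OF tendsto_norm_zero[OF fg], of K]]) simp
qed

lemma null_if_sq_le:
  fixes f :: "nat \<Rightarrow> 'a::real_normed_vector"
  assumes c: "0 < c" and le: "\<And>n. c * (norm (f n))\<^sup>2 \<le> r n" and r: "null r"
  shows "null f"
proof -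
  have r': "null (\<lambda>n. sqrt (r n / c))"
    using tendsto_real_sqrt[OF tendsto_divide_zero[OF r, of c]] by simp
  have "norm (f n) \<le> sqrt (r n / c)" for n
    using le[of n] c by (intro real_le_rsqrt) (simp add: field_simps)
  thus ?thesis by (intro Lim_null_comparison[OF always_eventually r']) simp
qed

lemma null_lag:
  fixes w :: "nat \<Rightarrow> 'a::real_normed_vector"
  assumes w: "null (\<lambda>n. w (Suc n) - w n)" and t: "\<And>n. n \<le> t n + B" "\<And>n. t n \<le> n"
  shows "null (\<lambda>n. w (t n) - w n)"
proof (rule LIMSEQ_I)
  fix r :: real assume "0 < r"
  \<comment> \<open>At most \<open>B\<close> increments lie between times \<open>t n\<close> and
    \<open>n\<close>; the summand 1 makes the total strictly less than \<open>r\<close> and covers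
    \<open>B = 0\<close>.\<close>
  define c where "c = r / (real B + 1)"
  have "0 < c" using \<open>0 < r\<close> by (simp add: c_def)
  then obtain N where N: "norm (w (Suc m) - w m) < c" if "N \<le> m" for m
    using LIMSEQ_D[OF w, of c] by auto
  have far: "norm (w k - w (k + j)) \<le> real j * c" if "N \<le> k" for k j
  proof (induction j)
    case (Suc j)
    have "norm (w k - w (k + Suc j)) \<le> norm (w k - w (k + j)) + norm (w (Suc (k + j)) - w (k + j))"
      using norm_triangle_ineq4[of "w k - w (k + j)" "w (Suc (k + j)) - w (k + j)"] by simp
    with Suc N[of "k + j"] that show ?case by (simp add: algebra_simps)
  qed simp
  have "norm (w (t n) - w n - 0) < r" if "N + B \<le> n" for n
  proof -
    have "N \<le> t n" using that t(1)[of n] by simp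
    from far[OF this, of "n - t n"] have "norm (w (t n) - w n) \<le> real (n - t n) * c"
      using t(2)[of n] by simp
    also have "\<dots> \<le> real B * c"
      using t(1)[of n] \<open>0 < c\<close> by (intro mult_right_mono) auto
    also have "\<dots> < r" using \<open>0 < r\<close> by (simp add: c_def field_simps)
    finally show ?thesis by simp
  qed
  thus "\<exists>N. \<forall>n\<ge>N. norm (w (t n) - w n - 0) < r" by blast
qed

text \<open>An upper bound on a step size becomes a lower bound on the coefficient
  \<open>inverse r\<close> of the squared residual; with \<open>c = \<alpha> i + \<eta>\<close> this
  leaves the margin \<open>\<eta>\<close>.\<close>

lemma le_inverse_if_mem_interval:
  fixes r c :: real
  assumes "r \<in> {\<epsilon>..1 / c}" "0 < \<epsilon>"
  shows "0 < r" "c \<le> inverse r"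
proof -
  show "0 < r" using assms by auto
  show "c \<le> inverse r"
  proof (cases "0 < c")
    case True
    hence "r * c \<le> 1" using assms(1) by (simp add: field_simps)
    with \<open>0 < r\<close> show ?thesis by (simp add: field_simps)
  next
    case False
    thus ?thesis using \<open>0 < r\<close> positive_imp_inverse_positive[of r] by linarith
  qed
qed

section \<open>The asynchronous iteration\<close>

text \<open>Each component is frozen since its last activation, so that at every step \<open>n\<close> it is given by the update
  formulas at a time \<open>t i n\<close> (resp. \<open>d k n\<close>) that accounts for both the idle period and the delay. The
  step sizes below are indexed by \<open>n\<close> but stand for their values at that time.\<close>

locale nash_iteration = nash_problem H Y G \<phi> \<psi> \<alpha> f Q g h \<beta> M L
  for H :: "'i::finite \<Rightarrow> 'h::real_inner set"
    and Y :: "'i \<Rightarrow> 'y::real_inner set"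
    and G :: "'k::finite \<Rightarrow> 'g::real_inner set"
    and \<phi> \<psi> \<alpha> f Q g h \<beta> M L +
  fixes X :: "'i \<Rightarrow> real" and \<eta> \<epsilon> :: real and lam :: "nat \<Rightarrow> real" and B :: nat
    and t :: "'i \<Rightarrow> nat \<Rightarrow> nat" and \<gamma> \<mu> \<sigma> :: "'i \<Rightarrow> nat \<Rightarrow> real"
    and d :: "'k \<Rightarrow> nat \<Rightarrow> nat" and \<nu> \<rho> :: "'k \<Rightarrow> nat \<Rightarrow> real"
    and x a s_st a_st :: "nat \<Rightarrow> 'h ^ 'i" and x_st :: "'i \<Rightarrow> nat \<Rightarrow> 'h"
    and y q u c_st c q_st :: "nat \<Rightarrow> 'y ^ 'i"
    and z v b e_st b_st e :: "nat \<Rightarrow> 'g ^ 'k" and d_st :: "'k \<Rightarrow> nat \<Rightarrow> 'g"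
    and w p s :: "nat \<Rightarrow> (('h ^ 'i) \<times> ('g ^ 'k)) \<times> ('y ^ 'i) \<times> ('y ^ 'i) \<times> ('g ^ 'k)"
  assumes w_def: "\<And>n. w n = ((x n, z n), (y n, u n, v n))"
    and p_def: "\<And>n. p n = ((a n, b n), (q n, c_st n, e_st n))"
    and s_def: "\<And>n. s n = ((a_st n, b_st n), (q_st n, c n, e n))"
    and X: "\<And>w w'. w \<in> direct_sum Y \<Longrightarrow> w' \<in> direct_sum Y \<Longrightarrow>
              inner (w - w') (Q w - Q w') \<le> (\<Sum>i\<in>UNIV. X i * (norm (w $ i - w' $ i))\<^sup>2)"
    and \<eta>: "0 < \<eta>" and \<epsilon>: "0 < \<epsilon>"
    and lam: "\<And>n. lam n \<in> {\<epsilon>..2 - \<epsilon>}"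
    and t: "\<And>i n. n \<le> t i n + B" "\<And>i n. t i n \<le> n"
    and d: "\<And>k n. n \<le> d k n + B" "\<And>k n. d k n \<le> n"
    and \<gamma>: "\<And>i n. \<gamma> i n \<in> {\<epsilon>..1 / (\<alpha> i + \<eta>)}"
    and \<mu>: "\<And>i n. \<mu> i n \<in> {\<epsilon>..1 / (X i + \<eta>)}"
    and \<sigma>: "\<And>i n. \<sigma> i n \<in> {\<epsilon>..1 / \<epsilon>}"
    and \<nu>: "\<And>k n. \<nu> k n \<in> {\<epsilon>..1 / (\<beta> k + \<eta>)}"
    and \<rho>: "\<And>k n. \<rho> k n \<in> {\<epsilon>..1 / \<epsilon>}"
    and w0: "w 0 \<in> SS"
    and q: "\<And>n i. q n $ i = y (t i n) $ i + \<mu> i n *\<^sub>R (u (t i n) $ i - Q (y (t i n)) $ i)"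
    and c_st: "\<And>n i. c_st n $ i = u (t i n) $ i + \<sigma> i n *\<^sub>R (M i (x (t i n) $ i) - y (t i n) $ i)"
    and x_st: "\<And>n i. x_st i n = x (t i n) $ i - \<gamma> i n *\<^sub>R
        (grad_\<psi> i (x (t i n) $ i) + M_adj i (u (t i n) $ i) + (\<Sum>k\<in>UNIV. L_adj k i (v (t i n) $ k)))"
    and a: "\<And>n i. a n $ i = prox_on (H i) (\<lambda>\<xi>. ereal (\<gamma> i n) * \<phi> i \<xi>) (x_st i n)"
    and s_st: "\<And>n i. s_st n $ i = inverse (\<gamma> i n) *\<^sub>R (x_st i n - a n $ i)
        + grad_\<psi> i (a n $ i) + M_adj i (c_st n $ i)"
    and c: "\<And>n i. c n $ i = q n $ i - M i (a n $ i)"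
    and d_st: "\<And>n k. d_st k n = z (d k n) $ k + \<nu> k n *\<^sub>R (v (d k n) $ k - grad_h k (z (d k n) $ k))"
    and b: "\<And>n k. b n $ k = prox_on (G k) (\<lambda>\<xi>. ereal (\<nu> k n) * g k \<xi>) (d_st k n)"
    and e_st: "\<And>n k. e_st n $ k = v (d k n) $ k + \<rho> k n *\<^sub>R
        ((\<Sum>i\<in>UNIV. L k i (x (d k n) $ i)) - z (d k n) $ k)"
    and b_st: "\<And>n k. b_st n $ k = inverse (\<nu> k n) *\<^sub>R (d_st k n - b n $ k)
        + grad_h k (b n $ k) - e_st n $ k"
    and e: "\<And>n k. e n $ k = b n $ k - (\<Sum>i\<in>UNIV. L k i (a n $ i))"
    and a_st: "\<And>n i. a_st n $ i = s_st n $ i + (\<Sum>k\<in>UNIV. L_adj k i (e_st n $ k))"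
    and q_st: "\<And>n i. q_st n $ i = Q (q n) $ i - c_st n $ i"
    and step: "\<And>n. inner (p n - w n) (s n) < 0 \<Longrightarrow>
        w (Suc n) = w n + (lam n * inner (p n - w n) (s n) / (norm (s n))\<^sup>2) *\<^sub>R s n"
    and stay: "\<And>n. \<not> inner (p n - w n) (s n) < 0 \<Longrightarrow> w (Suc n) = w n"
    and ex_sub_\<phi>: "\<And>i. \<exists>\<xi>\<in>H i. subdifferential_on (H i) (\<phi> i) \<xi> \<noteq> {}"
    and ex_sub_g: "\<And>k. \<exists>\<xi>\<in>G k. subdifferential_on (G k) (g k) \<xi> \<noteq> {}"
    and ex_zero: "\<exists>p0\<in>SS. - T p0 \<in> subdifferential_on SS F p0"
begin

lemma Lv_nth: "Lv \<xi> $ k = (\<Sum>i\<in>UNIV. L k i (\<xi> $ i))"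
  by (simp add: Lv_def)

lemma mem_components:
  assumes "w m \<in> SS"
  shows "x m \<in> direct_sum H" "z m \<in> direct_sum G" "y m \<in> direct_sum Y" "u m \<in> direct_sum Y" "v m \<in> direct_sum G"
    and "x m $ i \<in> H i" "z m $ k \<in> G k" "y m $ i \<in> Y i" "u m $ i \<in> Y i" "v m $ k \<in> G k"
  using assms by (auto simp: w_def mem_SS mem_direct_sum)

lemma step_sizes_pos: "0 < \<gamma> i n" "0 < \<mu> i n" "0 < \<nu> k n"
  using le_inverse_if_mem_interval(1)[OF \<gamma> \<epsilon>] le_inverse_if_mem_interval(1)[OF \<mu> \<epsilon>]
    le_inverse_if_mem_interval(1)[OF \<nu> \<epsilon>] by auto

lemma x_st_mem: "w (t i n) \<in> SS \<Longrightarrow> x_st i n \<in> H i"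
  unfolding x_st
  by (intro subspace_diff[OF subH] subspace_scale[OF subH] subspace_add[OF subH] subspace_sum[OF subH]
      mem_components grad_\<psi>_mem adjM(1) adjL(1))

lemma d_st_mem: "w (d k n) \<in> SS \<Longrightarrow> d_st k n \<in> G k"
  unfolding d_st
  by (intro subspace_diff[OF subG] subspace_scale[OF subG] subspace_add[OF subG]
      mem_components grad_h_mem)

text \<open>Membership is assumed only at the delayed time because it is not yet known for all
  iterates: this lemma feeds the induction that proves it.\<close>

lemma a_subgradient:
  assumes "w (t i n) \<in> SS"
  shows "a n $ i \<in> H i" "inverse (\<gamma> i n) *\<^sub>R (x_st i n - a n $ i) \<in> subdifferential_on (H i) (\<phi> i) (a n $ i)"
proof -
  obtain x0 u0 where "x0 \<in> H i" "u0 \<in> subdifferential_on (H i) (\<phi> i) x0" using ex_sub_\<phi> by blast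
  from prox_on_subgradient[OF H \<phi> step_sizes_pos(1) x_st_mem[OF assms] this(2,1)]
  show "a n $ i \<in> H i" "inverse (\<gamma> i n) *\<^sub>R (x_st i n - a n $ i) \<in> subdifferential_on (H i) (\<phi> i) (a n $ i)"
    by (simp_all add: a)
qed

lemma b_subgradient:
  assumes "w (d k n) \<in> SS"
  shows "b n $ k \<in> G k" "inverse (\<nu> k n) *\<^sub>R (d_st k n - b n $ k) \<in> subdifferential_on (G k) (g k) (b n $ k)"
proof -
  obtain x0 u0 where "x0 \<in> G k" "u0 \<in> subdifferential_on (G k) (g k) x0" using ex_sub_g by blast
  from prox_on_subgradient[OF G g step_sizes_pos(3) d_st_mem[OF assms] this(2,1)]
  show "b n $ k \<in> G k" "inverse (\<nu> k n) *\<^sub>R (d_st k n - b n $ k) \<in> subdifferential_on (G k) (g k) (b n $ k)"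
    by (simp_all add: b)
qed

text \<open>The gradient, adjoint and multiplier terms in the formulas for \<open>s\<close> are
  exactly the rows of \<open>T (p n)\<close>. Only the two proximal residuals survive, and these are
  subgradients.\<close>

lemma s_minus_T:
  "s n - T (p n) = (((\<chi> i. inverse (\<gamma> i n) *\<^sub>R (x_st i n - a n $ i)), (\<chi> k. inverse (\<nu> k n) *\<^sub>R (d_st k n - b n $ k))), (0, 0, 0))"
  by (simp add: s_def p_def T_apply Tx_def Tz_def Mv_def Lv_def vec_eq_iff a_st s_st b_st q_st c e)

lemma graph_point:
  assumes "\<And>m. m \<le> n \<Longrightarrow> w m \<in> SS"
  shows "p n \<in> SS" "s n \<in> SS" "s n - T (p n) \<in> subdifferential_on SS F (p n)"
proof -
  have wt: "w (t i n) \<in> SS" and wd: "w (d k n) \<in> SS" for i k using assms t(2) d(2) by auto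
  have "c_st n $ i \<in> Y i" for i
    unfolding c_st by (intro subspace_add[OF subY] subspace_scale[OF subY] subspace_diff[OF subY]
        mem_components wt bounded_linear_betweenD(1)[OF M])
  moreover have "e_st n $ k \<in> G k" for k
    unfolding e_st by (intro subspace_add[OF subG] subspace_scale[OF subG] subspace_diff[OF subG]
        subspace_sum[OF subG] mem_components wd bounded_linear_betweenD(1)[OF L])
  moreover have "q n $ i \<in> Y i" for i
    unfolding q by (intro subspace_add[OF subY] subspace_scale[OF subY] subspace_diff[OF subY]
        mem_components wt partial_derivative(1))
  ultimately show p: "p n \<in> SS"
    by (simp add: p_def mem_SS mem_direct_sum a_subgradient[OF wt] b_subgradient[OF wd])
  show sub: "s n - T (p n) \<in> subdifferential_on SS F (p n)"
    unfolding s_minus_T unfolding p_def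
    by (rule subdifferential_F) (simp_all add: a_subgradient(2)[OF wt] b_subgradient(2)[OF wd])
  have "T (p n) \<in> SS" using T_into p by blast
  from subspace_add[OF hilbert_subspaceD(1)[OF hilbert_SS] subdifferential_onD(1)[OF sub] this]
  show "s n \<in> SS" by simp
qed

text \<open>The induction is strong because bounded delays make \<open>s m\<close> depend on several
  earlier iterates.\<close>

lemma w_mem: "w n \<in> SS"
proof (induction n rule: less_induct)
  case (less n)
  show ?case
  proof (cases n)
    case (Suc m)
    have wm: "w m \<in> SS" using less Suc by simp
    have "s m \<in> SS" using less Suc by (intro graph_point(2)) simp
    with wm step[of m] stay[of m] hilbert_subspaceD(1)[OF hilbert_SS] Suc show ?thesis
      by (cases "inner (p m - w m) (s m) < 0") (simp_all add: subspace_add subspace_scale)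
  qed (simp add: w0)
qed

lemma ex_halfspace_projection: "\<exists>K. halfspace_projection SS F T K w p s lam \<epsilon>"
proof -
  obtain K where K: "K-lipschitz_on SS T" using T_lipschitz by blast
  have "halfspace_projection SS F T K w p s lam \<epsilon>"
    by unfold_locales
       (fact hilbert_SS F_proper_weakly_lsc_convex T_monotone K T_into w0
          graph_point[OF w_mem] \<epsilon> lam step stay)+
  thus ?thesis by blast
qed

lemmas w_components = mem_components[OF w_mem]
lemmas a_sub = a_subgradient[OF w_mem]
lemmas b_sub = b_subgradient[OF w_mem]

lemma p_components:
  "a n \<in> direct_sum H" "b n \<in> direct_sum G" "q n \<in> direct_sum Y"
  "c_st n $ i \<in> Y i" "e_st n $ k \<in> G k"
  using graph_point(1)[OF w_mem, of n] by (auto simp: p_def mem_SS mem_direct_sum)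

end

section \<open>Boundedness of the points produced by the algorithm\<close>

lemma Bseq_vec:
  fixes f :: "nat \<Rightarrow> 'a::real_normed_vector ^ 'i::finite"
  assumes "\<And>i. Bseq (\<lambda>n. f n $ i)"
  shows "Bseq f"
proof -
  have "Bseq (\<lambda>n. \<Sum>i\<in>UNIV. norm (f n $ i))"
    using assms by (intro Bseq_sum) (simp_all add: Bseq_def)
  then obtain K where K: "\<bar>\<Sum>i\<in>UNIV. norm (f n $ i)\<bar> \<le> K" for n by (auto simp: Bseq_def)
  have "norm (f n) \<le> K" for n
  proof -
    have "norm (f n) \<le> (\<Sum>i\<in>UNIV. norm (f n $ i))"
      unfolding norm_vec_def by (rule L2_set_le_sum) simp
    with K[of n] show ?thesis by linarith
  qed
  thus ?thesis by (rule BseqI')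
qed

lemma Bseq_Pair:
  fixes f :: "nat \<Rightarrow> 'a::real_normed_vector" and g :: "nat \<Rightarrow> 'b::real_normed_vector"
  assumes "Bseq f" "Bseq g"
  shows "Bseq (\<lambda>n. (f n, g n))"
proof -
  obtain K where K: "norm (f n) \<le> K" for n using assms(1) by (auto simp: Bseq_def)
  obtain L where L: "norm (g n) \<le> L" for n using assms(2) by (auto simp: Bseq_def)
  have "norm (f n, g n) \<le> K + L" for n
    using norm_Pair_le[of "f n" "g n"] K[of n] L[of n] by linarith
  thus ?thesis by (rule BseqI')
qed

lemma Bseq_linear_image:
  assumes "bounded_linear A" "Bseq f"
  shows "Bseq (\<lambda>n. A (f n))"
  by (rule Bseq_lipschitz[OF ex_lipschitz_bounded_linear[OF assms(1), of UNIV] _ assms(2)]) simp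

text \<open>The resolvents are nonexpansive, and the step sizes are bounded.\<close>

lemma Bseq_resolvent:
  fixes X A :: "nat \<Rightarrow> 'a::real_inner" and r :: "nat \<Rightarrow> real"
  assumes f: "\<exists>z\<in>S. f z \<noteq> \<infinity>" "\<And>z. z \<in> S \<Longrightarrow> f z \<noteq> -\<infinity>"
    and x0: "x0 \<in> S" "u0 \<in> subdifferential_on S f x0"
    and r: "\<And>n. 0 < r n" "Bseq r" and X: "Bseq X"
    and A: "\<And>n. A n \<in> S" "\<And>n. inverse (r n) *\<^sub>R (X n - A n) \<in> subdifferential_on S f (A n)"
  shows "Bseq A"
proof -
  \<comment> \<open>The fixed point \<open>x0\<close> is the resolvent of
    \<open>x0 + r n *\<^sub>R u0\<close>, so nonexpansiveness compares \<open>X n\<close> with that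
    point.\<close>
  have "Bseq (\<lambda>n. (X n - r n *\<^sub>R u0) + - x0)"
    by (intro Bseq_plus Bseq_diff Bseq_scaleR X r(2) Bfun_const)
  then obtain K where K: "norm ((X n - r n *\<^sub>R u0) + - x0) \<le> K" for n by (auto simp: Bseq_def)
  have "norm (A n) \<le> K + norm x0" for n
  proof -
    have "0 \<le> inner (A n - x0) (inverse (r n) *\<^sub>R (X n - A n) - u0)"
      by (rule subdifferential_on_monotone[OF f(1) f(2)[OF A(1)] f(2)[OF x0(1)] A(2) x0(2) A(1) x0(1)])
    hence "0 \<le> r n * inner (A n - x0) (inverse (r n) *\<^sub>R (X n - A n) - u0)"
      using r(1)[of n] by simp
    also have "\<dots> = inner (A n - x0) (r n *\<^sub>R (inverse (r n) *\<^sub>R (X n - A n) - u0))" by simp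
    also have "r n *\<^sub>R (inverse (r n) *\<^sub>R (X n - A n) - u0) = ((X n - r n *\<^sub>R u0) + - x0) - (A n - x0)"
      using r(1)[of n] by (simp add: scaleR_diff_right)
    finally have "0 \<le> inner (A n - x0) (((X n - r n *\<^sub>R u0) + - x0) - (A n - x0))" .
    hence "norm (A n - x0) * norm (A n - x0) \<le> inner (A n - x0) ((X n - r n *\<^sub>R u0) + - x0)"
      unfolding inner_diff_right[of "A n - x0" "(X n - r n *\<^sub>R u0) + - x0"]
      by (simp only: power2_norm_eq_inner power2_eq_square[symmetric])
    also have "\<dots> \<le> norm (A n - x0) * norm ((X n - r n *\<^sub>R u0) + - x0)" by (rule norm_cauchy_schwarz)
    also have "\<dots> \<le> norm (A n - x0) * K" by (rule mult_left_mono[OF K norm_ge_zero])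
    finally have *: "norm (A n - x0) * norm (A n - x0) \<le> norm (A n - x0) * K" .
    have "norm (A n - x0) \<le> K"
    proof (cases "A n = x0")
      case True
      thus ?thesis using order_trans[OF norm_ge_zero K[of n]] by simp
    next
      case False
      hence "0 < norm (A n - x0)" by simp
      with * show ?thesis by (rule mult_left_le_imp_le)
    qed
    thus ?thesis using norm_triangle_ineq[of "A n - x0" x0] by simp
  qed
  thus ?thesis by (rule BseqI')
qed

context nash_iteration begin

lemma lip_M: "\<exists>K. K-lipschitz_on (H i) (M i)"
  by (rule bounded_linear_between_lipschitz[OF M subH])
lemma lip_L: "\<exists>K. K-lipschitz_on (H i) (L k i)"
  by (rule bounded_linear_between_lipschitz[OF L subH])
lemma lip_M_adj: "\<exists>K. K-lipschitz_on (Y i) (M_adj i)"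
  by (rule bounded_linear_between_lipschitz[OF bounded_linear_between_adjoint_on[OF H M] subY])
lemma lip_L_adj: "\<exists>K. K-lipschitz_on (G k) (L_adj k i)"
  by (rule bounded_linear_between_lipschitz[OF bounded_linear_between_adjoint_on[OF H L] subG])
lemma lip_grad_\<psi>: "\<exists>K. K-lipschitz_on (H i) (grad_\<psi> i)" using \<psi>(3) by blast
lemma lip_grad_h: "\<exists>K. K-lipschitz_on (G k) (grad_h k)" using h(3) by blast

lemma iteration_facts:
  "Bseq w" "null (\<lambda>n. w (Suc n) - w n)"
  "inner (w n - p n) (s n) \<le> norm (w (Suc n) - w n) * norm (s n) / \<epsilon>"
  "(\<lambda>n. p n - w n) \<longlonglongrightarrow> 0 \<Longrightarrow> s \<longlonglongrightarrow> 0 \<Longrightarrow>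
    \<exists>l\<in>SS. - T l \<in> subdifferential_on SS F l \<and> weakly_converges_in SS w l"
proof -
  obtain K where "halfspace_projection SS F T K w p s lam \<epsilon>" using ex_halfspace_projection by blast
  then interpret hp: halfspace_projection SS F T K w p s lam \<epsilon> .
  have Z: "hp.Z \<noteq> {}" using ex_zero unfolding hp.Z_def by blast
  show "Bseq w" by (rule hp.Bseq_w[OF Z])
  show "null (\<lambda>n. w (Suc n) - w n)" by (rule hp.successive_difference_null[OF Z])
  show "inner (w n - p n) (s n) \<le> norm (w (Suc n) - w n) * norm (s n) / \<epsilon>" by (rule hp.gap_le)
  show "\<exists>l\<in>SS. - T l \<in> subdifferential_on SS F l \<and> weakly_converges_in SS w l"
    if "null (\<lambda>n. p n - w n)" "null s"
    using hp.weakly_convergent[OF Z that] by (auto simp: hp.Z_def)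
qed

lemma Bseq_components:
  "Bseq x" "Bseq z" "Bseq y" "Bseq u" "Bseq v"
  "Bseq (\<lambda>n. x n $ i)" "Bseq (\<lambda>n. z n $ k)" "Bseq (\<lambda>n. y n $ i)" "Bseq (\<lambda>n. u n $ i)" "Bseq (\<lambda>n. v n $ k)"
proof -
  have "Bseq (\<lambda>n. fst (fst (w n)))" "Bseq (\<lambda>n. snd (fst (w n)))" "Bseq (\<lambda>n. fst (snd (w n)))"
    "Bseq (\<lambda>n. fst (snd (snd (w n))))" "Bseq (\<lambda>n. snd (snd (snd (w n))))"
    by (intro Bseq_linear_image[OF _ iteration_facts(1)] bounded_linear_fst_comp
        bounded_linear_snd_comp bounded_linear_ident)+
  thus *: "Bseq x" "Bseq z" "Bseq y" "Bseq u" "Bseq v" by (simp_all add: w_def)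
  show "Bseq (\<lambda>n. x n $ i)" "Bseq (\<lambda>n. z n $ k)" "Bseq (\<lambda>n. y n $ i)" "Bseq (\<lambda>n. u n $ i)" "Bseq (\<lambda>n. v n $ k)"
    by (intro Bseq_linear_image[OF bounded_linear_vec_nth *(1)] Bseq_linear_image[OF bounded_linear_vec_nth *(2)]
        Bseq_linear_image[OF bounded_linear_vec_nth *(3)] Bseq_linear_image[OF bounded_linear_vec_nth *(4)]
        Bseq_linear_image[OF bounded_linear_vec_nth *(5)])+
qed

lemma lag_null:
  fixes r :: "nat \<Rightarrow> nat"
  assumes "\<And>n. n \<le> r n + B" "\<And>n. r n \<le> n"
  shows "null (\<lambda>n. y (r n) - y n)" "null (\<lambda>n. x (r n) $ i - x n $ i)" "null (\<lambda>n. z (r n) $ k - z n $ k)"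
    "null (\<lambda>n. y (r n) $ i - y n $ i)" "null (\<lambda>n. u (r n) $ i - u n $ i)" "null (\<lambda>n. v (r n) $ k - v n $ k)"
proof -
  have w: "null (\<lambda>n. w (r n) - w n)" by (rule null_lag[OF iteration_facts(2) assms])
  have *: "null (\<lambda>n. x (r n) - x n)" "null (\<lambda>n. z (r n) - z n)" "null (\<lambda>n. y (r n) - y n)"
    "null (\<lambda>n. u (r n) - u n)" "null (\<lambda>n. v (r n) - v n)"
    using tendsto_fst[OF tendsto_fst[OF w]] tendsto_snd[OF tendsto_fst[OF w]] tendsto_fst[OF tendsto_snd[OF w]]
      tendsto_fst[OF tendsto_snd[OF tendsto_snd[OF w]]] tendsto_snd[OF tendsto_snd[OF tendsto_snd[OF w]]]
    by (simp_all add: w_def)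
  show "null (\<lambda>n. y (r n) - y n)" "null (\<lambda>n. x (r n) $ i - x n $ i)" "null (\<lambda>n. z (r n) $ k - z n $ k)"
    "null (\<lambda>n. y (r n) $ i - y n $ i)" "null (\<lambda>n. u (r n) $ i - u n $ i)" "null (\<lambda>n. v (r n) $ k - v n $ k)"
    using *(3) tendsto_vec_nth[OF *(1), of i] tendsto_vec_nth[OF *(2), of k] tendsto_vec_nth[OF *(3), of i]
      tendsto_vec_nth[OF *(4), of i] tendsto_vec_nth[OF *(5), of k]
    by simp_all
qed

lemma Bseq_step_sizes:
  "Bseq (\<gamma> i)" "Bseq (\<mu> i)" "Bseq (\<sigma> i)" "Bseq (\<nu> k)" "Bseq (\<rho> k)"
  "Bseq (\<lambda>n. inverse (\<gamma> i n))" "Bseq (\<lambda>n. inverse (\<mu> i n))" "Bseq (\<lambda>n. inverse (\<nu> k n))"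
  using Bseq_if_mem_interval[OF \<gamma>] Bseq_if_mem_interval[OF \<mu>] Bseq_if_mem_interval[OF \<sigma>]
    Bseq_if_mem_interval[OF \<nu>] Bseq_if_mem_interval[OF \<rho>] Bseq_inverse_if_ge[OF \<gamma> \<epsilon>]
    Bseq_inverse_if_ge[OF \<mu> \<epsilon>] Bseq_inverse_if_ge[OF \<nu> \<epsilon>] \<epsilon> by auto

lemmas Bseq_rules = Bseq_plus Bseq_diff Bseq_sum Bseq_scaleR Bseq_step_sizes

lemma Bseq_c_st: "Bseq (\<lambda>n. c_st n $ i)"
  unfolding c_st
  by (intro Bseq_rules Bseq_lipschitz[OF lip_M] Bseq_lag[of "\<lambda>n. x n $ i" "t i"] Bseq_lag[of "\<lambda>n. y n $ i" "t i"]
      Bseq_lag[of "\<lambda>n. u n $ i" "t i"] Bseq_components w_components)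

lemma Bseq_e_st: "Bseq (\<lambda>n. e_st n $ k)"
  unfolding e_st
  by (intro Bseq_rules Bseq_lipschitz[OF lip_L] Bseq_lag[of "\<lambda>n. x n $ _" "d k"] Bseq_lag[of "\<lambda>n. z n $ k" "d k"]
      Bseq_lag[of "\<lambda>n. v n $ k" "d k"] Bseq_components w_components finite)

lemma Bseq_q: "Bseq q"
proof (rule Bseq_vec)
  fix i
  have "Bseq (\<lambda>n. Q (y (t i n)) $ i)"
    by (intro Bseq_linear_image[OF bounded_linear_vec_nth] Bseq_lipschitz[OF Q(2)] Bseq_lag[of y "t i"]
        Bseq_components w_components)
  thus "Bseq (\<lambda>n. q n $ i)"
    unfolding q
    by (intro Bseq_rules Bseq_lag[of "\<lambda>n. y n $ i" "t i"] Bseq_lag[of "\<lambda>n. u n $ i" "t i"] Bseq_components)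
qed

lemma Bseq_x_st: "Bseq (x_st i)"
proof -
  have "Bseq (\<lambda>n. grad_\<psi> i (x (t i n) $ i))"
    by (intro Bseq_lipschitz[OF lip_grad_\<psi>] Bseq_lag[of "\<lambda>n. x n $ i" "t i"] Bseq_components w_components)
  moreover have "Bseq (\<lambda>n. M_adj i (u (t i n) $ i))"
    by (intro Bseq_lipschitz[OF lip_M_adj] Bseq_lag[of "\<lambda>n. u n $ i" "t i"] Bseq_components w_components)
  moreover have "Bseq (\<lambda>n. L_adj k i (v (t i n) $ k))" for k
    by (intro Bseq_lipschitz[OF lip_L_adj] Bseq_lag[of "\<lambda>n. v n $ k" "t i"] Bseq_components w_components)
  ultimately have "Bseq (\<lambda>n. x_st i n)"
    unfolding x_st by (intro Bseq_rules Bseq_lag[of "\<lambda>n. x n $ i" "t i"] Bseq_components finite)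
  thus ?thesis .
qed

lemma Bseq_d_st: "Bseq (d_st k)"
proof -
  have "Bseq (\<lambda>n. grad_h k (z (d k n) $ k))"
    by (intro Bseq_lipschitz[OF lip_grad_h] Bseq_lag[of "\<lambda>n. z n $ k" "d k"] Bseq_components w_components)
  hence "Bseq (\<lambda>n. d_st k n)"
    unfolding d_st by (intro Bseq_rules Bseq_lag[of "\<lambda>n. z n $ k" "d k"] Bseq_lag[of "\<lambda>n. v n $ k" "d k"] Bseq_components)
  thus ?thesis .
qed

lemma Bseq_a: "Bseq (\<lambda>n. a n $ i)"
proof -
  obtain x0 u0 where x0: "x0 \<in> H i" "u0 \<in> subdifferential_on (H i) (\<phi> i) x0" using ex_sub_\<phi> by blast
  show ?thesis
    by (rule Bseq_resolvent[OF proper_lsc_convexD(2,1)[OF \<phi>] x0 step_sizes_pos(1) Bseq_step_sizes(1)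
          Bseq_x_st a_sub])
qed

lemma Bseq_b: "Bseq (\<lambda>n. b n $ k)"
proof -
  obtain x0 u0 where x0: "x0 \<in> G k" "u0 \<in> subdifferential_on (G k) (g k) x0" using ex_sub_g by blast
  show ?thesis
    by (rule Bseq_resolvent[OF proper_lsc_convexD(2,1)[OF g] x0 step_sizes_pos(3) Bseq_step_sizes(4)
          Bseq_d_st b_sub])
qed

lemma Bseq_p: "Bseq p"
  unfolding p_def[abs_def]
  by (intro Bseq_Pair Bseq_q Bseq_vec Bseq_a Bseq_b Bseq_c_st Bseq_e_st)

text \<open>As \<open>T\<close> is Lipschitz and \<open>p\<close> bounded, it is enough to bound
  \<open>s - T p\<close>, which consists of the scaled proximal residuals.\<close>

lemma Bseq_s: "Bseq s"
proof -
  have "Bseq (\<lambda>n. inverse (\<gamma> i n) *\<^sub>R (x_st i n - a n $ i))" for i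
    by (rule Bseq_scaleR[OF Bseq_step_sizes(6) Bseq_diff[OF Bseq_x_st Bseq_a]])
  moreover have "Bseq (\<lambda>n. inverse (\<nu> k n) *\<^sub>R (d_st k n - b n $ k))" for k
    by (rule Bseq_scaleR[OF Bseq_step_sizes(8) Bseq_diff[OF Bseq_d_st Bseq_b]])
  ultimately have "Bseq (\<lambda>n. s n - T (p n))"
    unfolding s_minus_T by (intro Bseq_Pair Bseq_vec Bfun_const) simp_all
  moreover have "Bseq (\<lambda>n. T (p n))"
    by (rule Bseq_lipschitz[OF T_lipschitz graph_point(1)[OF w_mem] Bseq_p])
  ultimately have "Bseq (\<lambda>n. (s n - T (p n)) + T (p n))" by (rule Bseq_plus)
  thus ?thesis by simp
qed

section \<open>Removing the delays: the dual formulas rewritten with current data up to null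
  sequences\<close>

lemma x_residual:
  "null (\<lambda>n. a_st n $ i - (inverse (\<gamma> i n) *\<^sub>R (x n $ i - a n $ i) - (grad_\<psi> i (x n $ i) - grad_\<psi> i (a n $ i))
      + M_adj i (c_st n $ i - u n $ i) + (\<Sum>k\<in>UNIV. L_adj k i (e_st n $ k - v n $ k))))"
  (is "null (\<lambda>n. ?r n)")
proof -
  let ?t = "t i"
  have adj_diff: "M_adj i (c_st n $ i - u n $ i) = M_adj i (c_st n $ i) - M_adj i (u n $ i)"
    "L_adj k i (e_st n $ k - v n $ k) = L_adj k i (e_st n $ k) - L_adj k i (v n $ k)" for k n
    using bounded_linear_between_diff[OF bounded_linear_between_adjoint_on[OF H M] subY p_components(4) w_components(9)]
      bounded_linear_between_diff[OF bounded_linear_between_adjoint_on[OF H L] subG p_components(5) w_components(10)]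
    by auto
  \<comment> \<open>After division by the step size, the delayed data occur only in differences
    between times \<open>t i n\<close> and \<open>n\<close>, with bounded coefficients or under
    Lipschitz maps.\<close>
  have r: "?r n = inverse (\<gamma> i n) *\<^sub>R (x (?t n) $ i - x n $ i) - (grad_\<psi> i (x (?t n) $ i) - grad_\<psi> i (x n $ i))
      - (M_adj i (u (?t n) $ i) - M_adj i (u n $ i))
      - (\<Sum>k\<in>UNIV. L_adj k i (v (?t n) $ k) - L_adj k i (v n $ k))" for n
  proof -
    have "inverse (\<gamma> i n) *\<^sub>R x_st i n = inverse (\<gamma> i n) *\<^sub>R x (?t n) $ i
        - (grad_\<psi> i (x (?t n) $ i) + M_adj i (u (?t n) $ i) + (\<Sum>k\<in>UNIV. L_adj k i (v (?t n) $ k)))"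
      using step_sizes_pos(1)[of i n] by (simp add: x_st scaleR_diff_right)
    thus ?thesis
      by (simp add: a_st s_st adj_diff scaleR_diff_right sum_subtractf)
  qed
  have 1: "null (\<lambda>n. inverse (\<gamma> i n) *\<^sub>R (x (?t n) $ i - x n $ i))"
    by (rule null_scaleR[OF Bseq_step_sizes(6) lag_null(2)[OF t]])
  have 2: "null (\<lambda>n. grad_\<psi> i (x (?t n) $ i) - grad_\<psi> i (x n $ i))"
    by (rule null_lipschitz[OF lip_grad_\<psi> w_components(6) w_components(6) lag_null(2)[OF t]])
  have 3: "null (\<lambda>n. M_adj i (u (?t n) $ i) - M_adj i (u n $ i))"
    by (rule null_lipschitz[OF lip_M_adj w_components(9) w_components(9) lag_null(5)[OF t]])
  have 4: "null (\<lambda>n. \<Sum>k\<in>UNIV. L_adj k i (v (?t n) $ k) - L_adj k i (v n $ k))"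
    by (rule tendsto_null_sum, rule null_lipschitz[OF lip_L_adj w_components(10) w_components(10) lag_null(6)[OF t]])
  show ?thesis unfolding r using tendsto_diff[OF tendsto_diff[OF tendsto_diff[OF 1 2] 3] 4] by simp
qed

text \<open>The explicit step evaluates \<open>Q\<close> at the whole delayed vector, so the lag of
  all coordinates matters and not only that of coordinate \<open>i\<close>.\<close>

lemma y_residual:
  "null (\<lambda>n. q_st n $ i - (Q (q n) $ i - Q (y n) $ i + inverse (\<mu> i n) *\<^sub>R (y n $ i - q n $ i)
      - (c_st n $ i - u n $ i)))"
  (is "null (\<lambda>n. ?r n)")
proof -
  let ?t = "t i"
  have r: "?r n = inverse (\<mu> i n) *\<^sub>R (y (?t n) $ i - y n $ i) + (u (?t n) $ i - u n $ i)
      - (Q (y (?t n)) - Q (y n)) $ i" for n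
  proof -
    have "inverse (\<mu> i n) *\<^sub>R q n $ i = inverse (\<mu> i n) *\<^sub>R y (?t n) $ i + (u (?t n) $ i - Q (y (?t n)) $ i)"
      using step_sizes_pos(2)[of i n] by (simp add: q scaleR_add_right)
    thus ?thesis by (simp add: q_st scaleR_diff_right)
  qed
  have 1: "null (\<lambda>n. inverse (\<mu> i n) *\<^sub>R (y (?t n) $ i - y n $ i))"
    by (rule null_scaleR[OF Bseq_step_sizes(7) lag_null(4)[OF t]])
  have 2: "null (\<lambda>n. u (?t n) $ i - u n $ i)" by (rule lag_null(5)[OF t])
  have "null (\<lambda>n. Q (y (?t n)) - Q (y n))"
    by (rule null_lipschitz[OF Q(2) w_components(3) w_components(3) lag_null(1)[OF t]])
  from tendsto_vec_nth[OF this, of i] have 3: "null (\<lambda>n. (Q (y (?t n)) - Q (y n)) $ i)" by simp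
  show ?thesis unfolding r using tendsto_diff[OF tendsto_add[OF 1 2] 3] by simp
qed

lemma z_residual:
  "null (\<lambda>n. b_st n $ k - (inverse (\<nu> k n) *\<^sub>R (z n $ k - b n $ k) - (grad_h k (z n $ k) - grad_h k (b n $ k))
      - (e_st n $ k - v n $ k)))"
  (is "null (\<lambda>n. ?r n)")
proof -
  let ?t = "d k"
  have r: "?r n = inverse (\<nu> k n) *\<^sub>R (z (?t n) $ k - z n $ k) - (grad_h k (z (?t n) $ k) - grad_h k (z n $ k))
      + (v (?t n) $ k - v n $ k)" for n
  proof -
    have "inverse (\<nu> k n) *\<^sub>R d_st k n = inverse (\<nu> k n) *\<^sub>R z (?t n) $ k
        + (v (?t n) $ k - grad_h k (z (?t n) $ k))"
      using step_sizes_pos(3)[of k n] by (simp add: d_st scaleR_add_right)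
    thus ?thesis by (simp add: b_st scaleR_diff_right)
  qed
  have 1: "null (\<lambda>n. inverse (\<nu> k n) *\<^sub>R (z (?t n) $ k - z n $ k))"
    by (rule null_scaleR[OF Bseq_step_sizes(8) lag_null(3)[OF d]])
  have 2: "null (\<lambda>n. grad_h k (z (?t n) $ k) - grad_h k (z n $ k))"
    by (rule null_lipschitz[OF lip_grad_h w_components(7) w_components(7) lag_null(3)[OF d]])
  have 3: "null (\<lambda>n. v (?t n) $ k - v n $ k)" by (rule lag_null(6)[OF d])
  show ?thesis unfolding r using tendsto_add[OF tendsto_diff[OF 1 2] 3] by simp
qed

lemma u_residual:
  "null (\<lambda>n. c_st n $ i - u n $ i - \<sigma> i n *\<^sub>R (M i (x n $ i) - y n $ i))"
  (is "null (\<lambda>n. ?r n)")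
proof -
  let ?t = "t i"
  have r: "?r n = (u (?t n) $ i - u n $ i)
      + \<sigma> i n *\<^sub>R ((M i (x (?t n) $ i) - M i (x n $ i)) - (y (?t n) $ i - y n $ i))" for n
    by (simp add: c_st algebra_simps)
  have 1: "null (\<lambda>n. u (?t n) $ i - u n $ i)" by (rule lag_null(5)[OF t])
  have 2: "null (\<lambda>n. M i (x (?t n) $ i) - M i (x n $ i))"
    by (rule null_lipschitz[OF lip_M w_components(6) w_components(6) lag_null(2)[OF t]])
  have 3: "null (\<lambda>n. y (?t n) $ i - y n $ i)" by (rule lag_null(4)[OF t])
  show ?thesis unfolding r
    using tendsto_add[OF 1 null_scaleR[OF Bseq_step_sizes(3), OF tendsto_diff[OF 2 3, simplified]]] by simp
qed

lemma Lv_null: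
  assumes "\<And>n. f1 n \<in> direct_sum H" "\<And>n. f2 n \<in> direct_sum H" "\<And>i. (\<lambda>n. f1 n $ i - f2 n $ i) \<longlonglongrightarrow> 0"
  shows "null (\<lambda>n. Lv (f1 n) $ k - Lv (f2 n) $ k)"
proof -
  have "null (\<lambda>n. \<Sum>i\<in>UNIV. L k i (f1 n $ i) - L k i (f2 n $ i))"
    using assms(1,2) by (intro tendsto_null_sum null_lipschitz[OF lip_L] assms(3)) (auto simp: mem_direct_sum)
  thus ?thesis by (simp add: Lv_nth sum_subtractf)
qed

lemma v_residual:
  "null (\<lambda>n. e_st n $ k - v n $ k - \<rho> k n *\<^sub>R (Lv (x n) $ k - z n $ k))"
  (is "null (\<lambda>n. ?r n)")
proof -
  let ?t = "d k"
  have r: "?r n = (v (?t n) $ k - v n $ k)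
      + \<rho> k n *\<^sub>R ((Lv (x (?t n)) $ k - Lv (x n) $ k) - (z (?t n) $ k - z n $ k))" for n
    by (simp add: e_st Lv_nth algebra_simps)
  have 1: "null (\<lambda>n. v (?t n) $ k - v n $ k)" by (rule lag_null(6)[OF d])
  have 2: "null (\<lambda>n. Lv (x (?t n)) $ k - Lv (x n) $ k)"
    by (rule Lv_null[OF w_components(1) w_components(1) lag_null(2)[OF d]])
  have 3: "null (\<lambda>n. z (?t n) $ k - z n $ k)" by (rule lag_null(3)[OF d])
  show ?thesis unfolding r
    using tendsto_add[OF 1 null_scaleR[OF Bseq_step_sizes(5), OF tendsto_diff[OF 2 3, simplified]]] by simp
qed

text \<open>The weights are guaranteed margins: \<open>\<eta>\<close> is left over by the step sizes
  \<open>\<gamma>\<close>, \<open>\<mu>\<close>, \<open>\<nu>\<close>, and \<open>\<epsilon>\<close>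
  bounds \<open>\<sigma>\<close> and \<open>\<rho>\<close> from below. The multiplier differences
  are absent because they follow from the two constraint residuals.\<close>

definition sq_gap :: "nat \<Rightarrow> real" where
  "sq_gap n = (\<Sum>i\<in>UNIV. \<eta> * (norm (x n $ i - a n $ i))\<^sup>2 + \<eta> * (norm (y n $ i - q n $ i))\<^sup>2
        + \<epsilon> * (norm (M i (x n $ i) - y n $ i))\<^sup>2)
    + (\<Sum>k\<in>UNIV. \<eta> * (norm (z n $ k - b n $ k))\<^sup>2 + \<epsilon> * (norm (Lv (x n) $ k - z n $ k))\<^sup>2)"

text \<open>The skew part of the saddle operator cancels in the gap up to the quadratic terms
  \<open>\<sigma> \<parallel>M x - y\<parallel>\<^sup>2\<close> and \<open>\<rho> \<parallel>L x - z\<parallel>\<^sup>2\<close>, and the delays only contribute a null sequence.\<close>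

lemma gap_ge: "\<exists>R. R \<longlonglongrightarrow> 0 \<and> (\<forall>n. sq_gap n + R n \<le> inner (w n - p n) (s n))"
proof -
  define C where "C n i = c_st n $ i - u n $ i" for n i
  define E where "E n k = e_st n $ k - v n $ k" for n k
  define rx where "rx i n = a_st n $ i - (inverse (\<gamma> i n) *\<^sub>R (x n $ i - a n $ i)
      - (grad_\<psi> i (x n $ i) - grad_\<psi> i (a n $ i)) + M_adj i (C n i) + (\<Sum>k\<in>UNIV. L_adj k i (E n k)))" for i n
  define ry where "ry i n = q_st n $ i - (Q (q n) $ i - Q (y n) $ i
      + inverse (\<mu> i n) *\<^sub>R (y n $ i - q n $ i) - C n i)" for i n
  define rz where "rz k n = b_st n $ k - (inverse (\<nu> k n) *\<^sub>R (z n $ k - b n $ k)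
      - (grad_h k (z n $ k) - grad_h k (b n $ k)) - E n k)" for k n
  define ru where "ru i n = C n i - \<sigma> i n *\<^sub>R (M i (x n $ i) - y n $ i)" for i n
  define rv where "rv k n = E n k - \<rho> k n *\<^sub>R (Lv (x n) $ k - z n $ k)" for k n
  have null: "null (rx i)" "null (ry i)" "null (rz k)" "null (ru i)" "null (rv k)" for i k
    using x_residual[of i] y_residual[of i] z_residual[of k] u_residual[of i] v_residual[of k]
    unfolding rx_def[abs_def] ry_def[abs_def] rz_def[abs_def] ru_def[abs_def] rv_def[abs_def] C_def E_def
    by simp_all
  \<comment> \<open>Each null residual is paired with a bounded difference, so \<open>R\<close> is
    null even before any difference is known to vanish.\<close>
  define R where "R n = (\<Sum>i\<in>UNIV. inner (x n $ i - a n $ i) (rx i n) + inner (y n $ i - q n $ i) (ry i n)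
        + inner (M i (x n $ i) - y n $ i) (ru i n))
      + (\<Sum>k\<in>UNIV. inner (z n $ k - b n $ k) (rz k n) + inner (Lv (x n) $ k - z n $ k) (rv k n))" for n
  have q_nth: "Bseq (\<lambda>n. q n $ i)" for i by (rule Bseq_linear_image[OF bounded_linear_vec_nth Bseq_q])
  have Bseq_M: "Bseq (\<lambda>n. M i (x n $ i))" for i
    by (rule Bseq_lipschitz[OF lip_M w_components(6) Bseq_components(6)])
  have Bseq_Lv: "Bseq (\<lambda>n. Lv (x n) $ k)" for k
    unfolding Lv_nth
    by (rule Bseq_sum[OF finite], rule Bseq_lipschitz[OF lip_L w_components(6) Bseq_components(6)])
  have "null R"
    unfolding R_def[abs_def]
    by (intro tendsto_add_zero tendsto_null_sum tendsto_zero_inner_bounded null Bseq_diff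
        Bseq_components Bseq_a Bseq_b q_nth Bseq_M Bseq_Lv)
  moreover have "sq_gap n + R n \<le> inner (w n - p n) (s n)" for n
  proof -
    let ?dx = "\<lambda>i. x n $ i - a n $ i" and ?dy = "\<lambda>i. y n $ i - q n $ i" and ?dm = "\<lambda>i. M i (x n $ i) - y n $ i"
    let ?dz = "\<lambda>k. z n $ k - b n $ k" and ?dl = "\<lambda>k. Lv (x n) $ k - z n $ k"
    have m: "x n $ i \<in> H i" "a n $ i \<in> H i" "z n $ k \<in> G k" "b n $ k \<in> G k" for i k
      using w_components a_sub(1) b_sub(1) by auto
    have da: "x n $ i - a n $ i \<in> H i" for i using m subH by (simp add: subspace_diff)
    have sq: "c * (norm D)\<^sup>2 \<le> inner D (r *\<^sub>R D)" if "c \<le> r" for c r :: real and D :: "'b::real_inner"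
      using mult_right_mono[OF that, of "(norm D)\<^sup>2"] by (simp add: power2_norm_eq_inner)
    \<comment> \<open>The proximal term yields \<open>\<alpha> i + \<eta>\<close> times the squared
      norm and the gradient difference consumes at most \<open>\<alpha> i\<close> of it.\<close>
    have X_term: "\<eta> * (norm (?dx i))\<^sup>2 + inner (M i (x n $ i) - M i (a n $ i)) (C n i)
        + (\<Sum>k\<in>UNIV. inner (L k i (x n $ i) - L k i (a n $ i)) (E n k)) + inner (?dx i) (rx i n)
        \<le> inner (?dx i) (a_st n $ i)" for i
    proof -
      let ?D = "?dx i"
      have "a_st n $ i = inverse (\<gamma> i n) *\<^sub>R ?D - (grad_\<psi> i (x n $ i) - grad_\<psi> i (a n $ i))
          + M_adj i (C n i) + (\<Sum>k\<in>UNIV. L_adj k i (E n k)) + rx i n" by (simp add: rx_def)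
      hence "inner ?D (a_st n $ i) = inner ?D (inverse (\<gamma> i n) *\<^sub>R ?D)
          - inner ?D (grad_\<psi> i (x n $ i) - grad_\<psi> i (a n $ i)) + inner ?D (M_adj i (C n i))
          + (\<Sum>k\<in>UNIV. inner ?D (L_adj k i (E n k))) + inner ?D (rx i n)"
        by (simp only: inner_add_right inner_diff_right[of ?D _ "grad_\<psi> i (x n $ i) - grad_\<psi> i (a n $ i)"] inner_sum_right)
      moreover have "inner ?D (M_adj i (C n i)) = inner (M i (x n $ i) - M i (a n $ i)) (C n i)"
        by (simp only: adjM(2)[OF da, symmetric] bounded_linear_between_diff[OF M subH m(1,2)])
      moreover have "inner ?D (L_adj k i (E n k)) = inner (L k i (x n $ i) - L k i (a n $ i)) (E n k)" for k
        by (simp only: adjL(2)[OF da, symmetric] bounded_linear_between_diff[OF L subH m(1,2)])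
      moreover have "(\<alpha> i + \<eta>) * (norm ?D)\<^sup>2 \<le> inner ?D (inverse (\<gamma> i n) *\<^sub>R ?D)"
        by (rule sq[OF le_inverse_if_mem_interval(2)[OF \<gamma> \<epsilon>]])
      moreover have "inner ?D (grad_\<psi> i (x n $ i) - grad_\<psi> i (a n $ i)) \<le> \<alpha> i * (norm ?D)\<^sup>2"
        by (rule inner_lipschitz_le[OF \<psi>(3) m(1,2)])
      ultimately show ?thesis by (simp add: distrib_right)
    qed
    \<comment> \<open>The increment of \<open>Q\<close> is kept here: \<open>X\<close> controls it
      only in the sum over all players, in \<open>Q_term\<close>.\<close>
    have Y_term: "(X i + \<eta>) * (norm (?dy i))\<^sup>2 - inner (?dy i) (Q (y n) $ i - Q (q n) $ i)
        - inner (?dy i) (C n i) + inner (?dy i) (ry i n)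
        \<le> inner (?dy i) (q_st n $ i)" for i
    proof -
      let ?D = "?dy i"
      have "q_st n $ i = inverse (\<mu> i n) *\<^sub>R ?D - (Q (y n) $ i - Q (q n) $ i) - C n i + ry i n"
        by (simp add: ry_def)
      hence "inner ?D (q_st n $ i) = inner ?D (inverse (\<mu> i n) *\<^sub>R ?D) - inner ?D (Q (y n) $ i - Q (q n) $ i)
          - inner ?D (C n i) + inner ?D (ry i n)"
        by (simp only: inner_add_right inner_diff_right[of ?D _ "C n i"] inner_diff_right[of ?D _ "Q (y n) $ i - Q (q n) $ i"])
      moreover have "(X i + \<eta>) * (norm ?D)\<^sup>2 \<le> inner ?D (inverse (\<mu> i n) *\<^sub>R ?D)"
        by (rule sq[OF le_inverse_if_mem_interval(2)[OF \<mu> \<epsilon>]])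
      ultimately show ?thesis by simp
    qed
    have Z_term: "\<eta> * (norm (?dz k))\<^sup>2 - inner (?dz k) (E n k)
        + inner (?dz k) (rz k n) \<le> inner (?dz k) (b_st n $ k)" for k
    proof -
      let ?D = "?dz k"
      have "b_st n $ k = inverse (\<nu> k n) *\<^sub>R ?D - (grad_h k (z n $ k) - grad_h k (b n $ k)) - E n k + rz k n"
        by (simp add: rz_def)
      hence "inner ?D (b_st n $ k) = inner ?D (inverse (\<nu> k n) *\<^sub>R ?D)
          - inner ?D (grad_h k (z n $ k) - grad_h k (b n $ k)) - inner ?D (E n k) + inner ?D (rz k n)"
        by (simp only: inner_add_right inner_diff_right[of ?D _ "E n k"]
            inner_diff_right[of ?D _ "grad_h k (z n $ k) - grad_h k (b n $ k)"])
      moreover have "(\<beta> k + \<eta>) * (norm ?D)\<^sup>2 \<le> inner ?D (inverse (\<nu> k n) *\<^sub>R ?D)"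
        by (rule sq[OF le_inverse_if_mem_interval(2)[OF \<nu> \<epsilon>]])
      moreover have "inner ?D (grad_h k (z n $ k) - grad_h k (b n $ k)) \<le> \<beta> k * (norm ?D)\<^sup>2"
        by (rule inner_lipschitz_le[OF h(3) m(3,4)])
      ultimately show ?thesis by (simp add: distrib_right)
    qed
    have U_term: "\<epsilon> * (norm (?dm i))\<^sup>2 + inner (?dm i) (ru i n)
        \<le> inner (?dm i) (C n i)" for i
    proof -
      have "C n i = \<sigma> i n *\<^sub>R (?dm i) + ru i n" by (simp add: ru_def)
      hence "inner (?dm i) (C n i) = inner (?dm i) (\<sigma> i n *\<^sub>R (?dm i)) + inner (?dm i) (ru i n)"
        by (simp only: inner_add_right)
      moreover have "\<epsilon> \<le> \<sigma> i n" using \<sigma>[of i n] by simp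
      from sq[OF this, of "?dm i"] have "\<epsilon> * (norm (?dm i))\<^sup>2 \<le> inner (?dm i) (\<sigma> i n *\<^sub>R (?dm i))" .
      ultimately show ?thesis by linarith
    qed
    have V_term: "\<epsilon> * (norm (?dl k))\<^sup>2 + inner (?dl k) (rv k n)
        \<le> inner (?dl k) (E n k)" for k
    proof -
      have "E n k = \<rho> k n *\<^sub>R (?dl k) + rv k n" by (simp add: rv_def)
      hence "inner (?dl k) (E n k) = inner (?dl k) (\<rho> k n *\<^sub>R (?dl k)) + inner (?dl k) (rv k n)"
        by (simp only: inner_add_right)
      moreover have "\<epsilon> \<le> \<rho> k n" using \<rho>[of k n] by simp
      from sq[OF this, of "?dl k"] have "\<epsilon> * (norm (?dl k))\<^sup>2 \<le> inner (?dl k) (\<rho> k n *\<^sub>R (?dl k))" .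
      ultimately show ?thesis by linarith
    qed
    have Q_term: "(\<Sum>i\<in>UNIV. inner (?dy i) (Q (y n) $ i - Q (q n) $ i))
        \<le> (\<Sum>i\<in>UNIV. X i * (norm (?dy i))\<^sup>2)"
      using X[OF w_components(3) p_components(3)] by (simp add: inner_vec_def)
    \<comment> \<open>The coupling through \<open>L\<close> arises player by player on the primal
      side and constraint by constraint on the dual side; exchanging the sums lets the two
      cancel.\<close>
    have swap: "(\<Sum>i\<in>UNIV. \<Sum>k\<in>UNIV. inner (L k i (x n $ i) - L k i (a n $ i)) (E n k))
        = (\<Sum>k\<in>UNIV. inner (Lv (x n) $ k - Lv (a n) $ k) (E n k))"
      by (subst sum.swap) (simp add: Lv_nth sum_subtractf inner_sum_left[symmetric])
    have 1: "\<eta> * (norm (?dx i))\<^sup>2 + (X i + \<eta>) * (norm (?dy i))\<^sup>2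
          + \<epsilon> * (norm (?dm i))\<^sup>2 - inner (?dy i) (Q (y n) $ i - Q (q n) $ i)
          + (\<Sum>k\<in>UNIV. inner (L k i (x n $ i) - L k i (a n $ i)) (E n k))
          + (inner (?dx i) (rx i n) + inner (?dy i) (ry i n)
              + inner (?dm i) (ru i n))
        \<le> inner (?dx i) (a_st n $ i) + inner (?dy i) (q_st n $ i)
          + inner (u n $ i - c_st n $ i) (c n $ i)" for i
    proof -
      have "inner (u n $ i - c_st n $ i) (c n $ i) = inner (M i (a n $ i) - q n $ i) (C n i)"
        unfolding C_def c by (simp add: inner_diff_left inner_diff_right inner_commute)
      \<comment> \<open>Paired with \<open>C n i\<close>, the differences \<open>M x - M a\<close>,
        \<open>q - y\<close> and \<open>M a - q\<close> telescope to \<open>M x - y\<close>.\<close>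
      hence "inner (M i (x n $ i) - M i (a n $ i)) (C n i) - inner (?dy i) (C n i)
          + inner (u n $ i - c_st n $ i) (c n $ i) = inner (?dm i) (C n i)"
        by (simp add: inner_diff_left)
      thus ?thesis using X_term[of i] Y_term[of i] U_term[of i] by linarith
    qed
    have 2: "\<eta> * (norm (?dz k))\<^sup>2 + \<epsilon> * (norm (?dl k))\<^sup>2
          - inner (Lv (x n) $ k - Lv (a n) $ k) (E n k)
          + (inner (?dz k) (rz k n) + inner (?dl k) (rv k n))
        \<le> inner (?dz k) (b_st n $ k) + inner (v n $ k - e_st n $ k) (e n $ k)" for k
    proof -
      have "inner (v n $ k - e_st n $ k) (e n $ k) = inner (Lv (a n) $ k - b n $ k) (E n k)"
        unfolding E_def e Lv_nth[symmetric] by (simp add: inner_diff_left inner_diff_right inner_commute)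
      \<comment> \<open>The same telescoping with \<open>E n k\<close>: \<open>Lv x - Lv a\<close>,
        \<open>b - z\<close> and \<open>Lv a - b\<close> add up to \<open>Lv x - z\<close>.\<close>
      hence "inner (Lv (x n) $ k - Lv (a n) $ k) (E n k) - inner (?dz k) (E n k)
          + inner (v n $ k - e_st n $ k) (e n $ k) = inner (?dl k) (E n k)"
        by (simp add: inner_diff_left)
      thus ?thesis using Z_term[of k] V_term[of k] by linarith
    qed
    have "inner (w n - p n) (s n)
        = (\<Sum>i\<in>UNIV. inner (x n $ i - a n $ i) (a_st n $ i) + inner (y n $ i - q n $ i) (q_st n $ i)
            + inner (u n $ i - c_st n $ i) (c n $ i))
          + (\<Sum>k\<in>UNIV. inner (z n $ k - b n $ k) (b_st n $ k) + inner (v n $ k - e_st n $ k) (e n $ k))"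
      by (simp add: w_def p_def s_def inner_vec_def sum.distrib)
    with sum_mono[OF 1, of "\<lambda>i. i" UNIV] sum_mono[OF 2, of "\<lambda>k. k" UNIV] Q_term swap
    show ?thesis
      unfolding sq_gap_def R_def distrib_right sum.distrib sum_subtractf by linarith
  qed
  ultimately show ?thesis by blast
qed

section \<open>Strong convergence of the residuals\<close>

lemma sq_gap_null: "null sq_gap"
proof -
  obtain R where R: "null R" "\<And>n. sq_gap n + R n \<le> inner (w n - p n) (s n)" using gap_ge by blast
  obtain C where C: "norm (s n) \<le> C" for n using Bseq_s by (auto simp: Bseq_def)
  have "0 \<le> sq_gap n" for n
    unfolding sq_gap_def using \<eta> \<epsilon> by (intro add_nonneg_nonneg sum_nonneg) auto
  \<comment> \<open>Boundedness of \<open>s\<close> turns the estimate by step lengths into a null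
    upper bound, which squeezes the nonnegative \<open>sq_gap\<close>.\<close>
  moreover have "sq_gap n \<le> norm (w (Suc n) - w n) * (C / \<epsilon>) - R n" for n
  proof -
    have "norm (w (Suc n) - w n) * norm (s n) / \<epsilon> \<le> norm (w (Suc n) - w n) * C / \<epsilon>"
      using C \<epsilon> by (intro divide_right_mono mult_left_mono) auto
    thus ?thesis using R(2)[of n] iteration_facts(3)[of n] by simp
  qed
  moreover have "null (\<lambda>n. norm (w (Suc n) - w n) * (C / \<epsilon>) - R n)"
    using tendsto_diff[OF tendsto_mult_left_zero[OF tendsto_norm_zero[OF iteration_facts(2)]] R(1), of "C / \<epsilon>"]
    by simp
  ultimately show ?thesis
    by (intro Lim_null_comparison[of sq_gap "\<lambda>n. norm (w (Suc n) - w n) * (C / \<epsilon>) - R n", OF always_eventually])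
       simp_all
qed

lemma sq_gap_components_null:
  "null (\<lambda>n. x n $ i - a n $ i)" "null (\<lambda>n. y n $ i - q n $ i)" "null (\<lambda>n. M i (x n $ i) - y n $ i)"
  "null (\<lambda>n. z n $ k - b n $ k)" "null (\<lambda>n. Lv (x n) $ k - z n $ k)"
proof -
  define A where "A n j = \<eta> * (norm (x n $ j - a n $ j))\<^sup>2 + \<eta> * (norm (y n $ j - q n $ j))\<^sup>2
        + \<epsilon> * (norm (M j (x n $ j) - y n $ j))\<^sup>2" for n j
  define D where "D n j = \<eta> * (norm (z n $ j - b n $ j))\<^sup>2 + \<epsilon> * (norm (Lv (x n) $ j - z n $ j))\<^sup>2" for n j
  have nonneg: "0 \<le> \<eta> * r\<^sup>2" "0 \<le> \<epsilon> * r\<^sup>2" for r :: real using \<eta> \<epsilon> by auto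
  have AD: "0 \<le> A n i" "0 \<le> D n k" for n i k unfolding A_def D_def by (intro add_nonneg_nonneg nonneg)+
  have "A n i \<le> (\<Sum>i\<in>UNIV. A n i)" "D n k \<le> (\<Sum>k\<in>UNIV. D n k)"
    "0 \<le> (\<Sum>i\<in>UNIV. A n i)" "0 \<le> (\<Sum>k\<in>UNIV. D n k)" for n i k
    by (intro member_le_sum sum_nonneg AD finite UNIV_I)+
  moreover have "sq_gap n = (\<Sum>i\<in>UNIV. A n i) + (\<Sum>k\<in>UNIV. D n k)" for n
    by (simp add: sq_gap_def A_def D_def)
  ultimately have le: "A n i \<le> sq_gap n" "D n k \<le> sq_gap n" for n i k
    by (metis add_increasing2 add_increasing)+
  have *: "\<eta> * (norm (x n $ i - a n $ i))\<^sup>2 \<le> sq_gap n" "\<eta> * (norm (y n $ i - q n $ i))\<^sup>2 \<le> sq_gap n"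
    "\<epsilon> * (norm (M i (x n $ i) - y n $ i))\<^sup>2 \<le> sq_gap n" "\<eta> * (norm (z n $ k - b n $ k))\<^sup>2 \<le> sq_gap n"
    "\<epsilon> * (norm (Lv (x n) $ k - z n $ k))\<^sup>2 \<le> sq_gap n" for n
    using le(1)[of n i] le(2)[of n k] nonneg(1)[of "norm (x n $ i - a n $ i)"] nonneg(1)[of "norm (y n $ i - q n $ i)"]
      nonneg(2)[of "norm (M i (x n $ i) - y n $ i)"] nonneg(1)[of "norm (z n $ k - b n $ k)"]
      nonneg(2)[of "norm (Lv (x n) $ k - z n $ k)"]
    unfolding A_def D_def by linarith+
  show "null (\<lambda>n. x n $ i - a n $ i)" "null (\<lambda>n. y n $ i - q n $ i)" "null (\<lambda>n. M i (x n $ i) - y n $ i)"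
    "null (\<lambda>n. z n $ k - b n $ k)" "null (\<lambda>n. Lv (x n) $ k - z n $ k)"
    by (rule null_if_sq_le[OF \<eta> *(1) sq_gap_null] null_if_sq_le[OF \<eta> *(2) sq_gap_null]
        null_if_sq_le[OF \<epsilon> *(3) sq_gap_null] null_if_sq_le[OF \<eta> *(4) sq_gap_null]
        null_if_sq_le[OF \<epsilon> *(5) sq_gap_null])+
qed

text \<open>Up to a null residual, the multiplier differences are bounded multiples of
  \<open>M x - y\<close> and \<open>L x - z\<close>, which \<open>sq_gap\<close> already
  controls.\<close>

lemma dual_null:
  "null (\<lambda>n. c_st n $ i - u n $ i)" "null (\<lambda>n. e_st n $ k - v n $ k)"
  using tendsto_add[OF u_residual[of i] null_scaleR[OF Bseq_step_sizes(3)[of i] sq_gap_components_null(3)[of i]]]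
    tendsto_add[OF v_residual[of k] null_scaleR[OF Bseq_step_sizes(5)[of k] sq_gap_components_null(5)[of k]]]
  by simp_all

lemma null_commute:
  fixes f1 f2 :: "nat \<Rightarrow> 'b::real_normed_vector"
  assumes "null (\<lambda>n. f1 n - f2 n)"
  shows "null (\<lambda>n. f2 n - f1 n)"
  using tendsto_minus[OF assms] by simp

lemma p_minus_w_null: "null (\<lambda>n. p n - w n)"
proof -
  have "null (\<lambda>n. a n - x n)" "null (\<lambda>n. b n - z n)" "null (\<lambda>n. q n - y n)"
    "null (\<lambda>n. c_st n - u n)" "null (\<lambda>n. e_st n - v n)"
    by (rule vec_tendstoI, simp add: null_commute[OF sq_gap_components_null(1)] null_commute[OF sq_gap_components_null(2)]
        null_commute[OF sq_gap_components_null(4)] dual_null)+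
  thus ?thesis unfolding p_def w_def diff_Pair zero_prod_def by (intro tendsto_Pair)
qed

text \<open>The first three rows are null residuals plus Lipschitz or bounded images of null
  differences. For \<open>c\<close> and \<open>e\<close>, the point \<open>M x\<close> or
  \<open>L x\<close> is inserted so that the constraint residuals appear.\<close>

lemma s_null: "null s"
proof -
  have "null (\<lambda>n. M_adj i (c_st n $ i) - M_adj i (u n $ i))" for i
    by (rule null_lipschitz[OF lip_M_adj p_components(4) w_components(9) dual_null(1)])
  moreover have "null (\<lambda>n. L_adj k i (e_st n $ k) - L_adj k i (v n $ k))" for i k
    by (rule null_lipschitz[OF lip_L_adj p_components(5) w_components(10) dual_null(2)])
  ultimately have adj: "null (\<lambda>n. M_adj i (c_st n $ i - u n $ i))"
      "null (\<lambda>n. L_adj k i (e_st n $ k - v n $ k))" for i k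
    using bounded_linear_between_diff[OF bounded_linear_between_adjoint_on[OF H M] subY p_components(4) w_components(9)]
      bounded_linear_between_diff[OF bounded_linear_between_adjoint_on[OF H L] subG p_components(5) w_components(10)]
    by simp_all
  have "null (\<lambda>n. a_st n $ i)" for i
  proof -
    have "(\<lambda>n. inverse (\<gamma> i n) *\<^sub>R (x n $ i - a n $ i) - (grad_\<psi> i (x n $ i) - grad_\<psi> i (a n $ i))
      + M_adj i (c_st n $ i - u n $ i) + (\<Sum>k\<in>UNIV. L_adj k i (e_st n $ k - v n $ k))) \<longlonglongrightarrow> 0 - 0 + 0 + 0"
      by (intro tendsto_add tendsto_diff tendsto_null_sum adj
          null_scaleR[OF Bseq_step_sizes(6) sq_gap_components_null(1)]
          null_lipschitz[OF lip_grad_\<psi> w_components(6) a_sub(1) sq_gap_components_null(1)])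
    from tendsto_add[OF x_residual[of i] this] show ?thesis by simp
  qed
  moreover have "null (\<lambda>n. b_st n $ k)" for k
  proof -
    have "(\<lambda>n. inverse (\<nu> k n) *\<^sub>R (z n $ k - b n $ k) - (grad_h k (z n $ k) - grad_h k (b n $ k))
      - (e_st n $ k - v n $ k)) \<longlonglongrightarrow> 0 - 0 - 0"
      by (intro tendsto_diff dual_null null_scaleR[OF Bseq_step_sizes(8) sq_gap_components_null(4)]
          null_lipschitz[OF lip_grad_h w_components(7) b_sub(1) sq_gap_components_null(4)])
    from tendsto_add[OF z_residual[of k] this] show ?thesis by simp
  qed
  moreover have "null (\<lambda>n. q_st n $ i)" for i
  proof -
    have qy: "null (\<lambda>n. q n - y n)"
      by (rule vec_tendstoI, simp add: null_commute[OF sq_gap_components_null(2)])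
    have "(\<lambda>n. (Q (q n) - Q (y n)) $ i) \<longlonglongrightarrow> 0 $ i"
      by (rule tendsto_vec_nth[OF null_lipschitz[OF Q(2) p_components(3) w_components(3) qy]])
    hence "null (\<lambda>n. Q (q n) $ i - Q (y n) $ i)" by simp
    hence "(\<lambda>n. Q (q n) $ i - Q (y n) $ i + inverse (\<mu> i n) *\<^sub>R (y n $ i - q n $ i)
      - (c_st n $ i - u n $ i)) \<longlonglongrightarrow> 0 + 0 - 0"
      by (intro tendsto_diff[OF tendsto_add] dual_null
          null_scaleR[OF Bseq_step_sizes(7) sq_gap_components_null(2)])
    from tendsto_add[OF y_residual[of i] this] show ?thesis by simp
  qed
  moreover have "null (\<lambda>n. c n $ i)" for i
  proof -
    have "(\<lambda>n. (M i (x n $ i) - M i (a n $ i)) - (M i (x n $ i) - y n $ i) - (y n $ i - q n $ i)) \<longlonglongrightarrow> 0 - 0 - 0"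
      by (intro tendsto_diff sq_gap_components_null
          null_lipschitz[OF lip_M w_components(6) a_sub(1) sq_gap_components_null(1)])
    thus ?thesis by (simp add: c)
  qed
  moreover have "null (\<lambda>n. e n $ k)" for k
  proof -
    have "(\<lambda>n. (Lv (x n) $ k - Lv (a n) $ k) - (Lv (x n) $ k - z n $ k) - (z n $ k - b n $ k)) \<longlonglongrightarrow> 0 - 0 - 0"
      by (intro tendsto_diff sq_gap_components_null
          Lv_null[OF w_components(1) p_components(1) sq_gap_components_null(1)])
    thus ?thesis by (simp add: e Lv_nth)
  qed
  ultimately have "null (\<lambda>n. a_st n)" "null (\<lambda>n. b_st n)" "null (\<lambda>n. q_st n)" "null (\<lambda>n. c n)" "null (\<lambda>n. e n)"
    by (auto intro!: vec_tendstoI)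
  hence "null (\<lambda>n. s n)" unfolding s_def zero_prod_def by (intro tendsto_Pair)
  thus ?thesis .
qed

theorem converges_to_nash_equilibrium:
  "\<exists>xbar. nash_equilibrium H \<phi> \<psi> f g h M L xbar \<and> weakly_converges_in (direct_sum H) x xbar"
proof -
  obtain l where l: "l \<in> SS" "- T l \<in> subdifferential_on SS F l" "weakly_converges_in SS w l"
    using iteration_facts(4)[OF p_minus_w_null s_null] by blast
  obtain lx lz ly lu lv where l_eq: "l = ((lx, lz), (ly, lu, lv))" by (rule tuple_cases)
  \<comment> \<open>The projection onto the strategy block is bounded and linear, hence weakly
    continuous.\<close>
  have "bounded_linear_between SS (direct_sum H) (\<lambda>p. fst (fst p))"
  proof -
    interpret bounded_linear "\<lambda>p :: (('h ^ 'i) \<times> ('g ^ 'k)) \<times> ('y ^ 'i) \<times> ('y ^ 'i) \<times> ('g ^ 'k). fst (fst p)"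
      by (intro bounded_linear_fst_comp bounded_linear_ident)
    obtain K where "norm (fst (fst p)) \<le> norm p * K"
      for p :: "(('h ^ 'i) \<times> ('g ^ 'k)) \<times> ('y ^ 'i) \<times> ('y ^ 'i) \<times> ('g ^ 'k)" using bounded by blast
    thus ?thesis
      unfolding bounded_linear_between_def
      by (intro conjI ballI allI exI[of _ K]) (auto simp: SS_def mult.commute[of K])
  qed
  from weakly_converges_in_linear_image[OF hilbert_SS this l(3)]
  have "weakly_converges_in (direct_sum H) x lx" by (simp add: w_def l_eq)
  moreover have "nash_equilibrium H \<phi> \<psi> f g h M L lx"
    using zero_imp_nash_equilibrium l(1,2) unfolding l_eq by blast
  ultimately show ?thesis by blast
qed

end

section \<open>Eliminating the activation sets\<close>

lemma last_activation:
  fixes A :: "nat \<Rightarrow> 'i set"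
  assumes "A 0 = UNIV" "\<And>n. (\<Union>j\<in>{n..n + P}. A j) = UNIV"
  shows "\<exists>r. \<forall>n. r n \<le> n \<and> n \<le> r n + P \<and> i \<in> A (r n) \<and>
    (\<forall>m. r n < m \<and> m \<le> n \<longrightarrow> i \<notin> A m)"
proof -
  define r where "r n = Max {j. j \<le> n \<and> i \<in> A j}" for n
  have fin: "finite {j. j \<le> n \<and> i \<in> A j}" for n by simp
  have ne: "{j. j \<le> n \<and> i \<in> A j} \<noteq> {}" for n using assms(1) by auto
  have r: "r n \<le> n" "i \<in> A (r n)" for n using Max_in[OF fin ne, of n] by (auto simp: r_def)
  have max: "j \<le> r n" if "j \<le> n" "i \<in> A j" for j n
    using Max_ge[OF fin, of j n] that by (simp add: r_def)
  show ?thesis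
  proof (intro exI[of _ r] allI conjI impI)
    fix n m
    show "r n \<le> n" "i \<in> A (r n)" by (rule r)+
    show "n \<le> r n + P"
    \<comment> \<open>For \<open>n < P\<close> the bound is immediate. Otherwise the window of
      indices from \<open>n - P\<close> to \<open>n\<close> contains an activation, and the last
      activation is no earlier.\<close>
    proof (cases "P \<le> n")
      case True
      have "i \<in> (\<Union>j\<in>{n - P..n - P + P}. A j)" using assms(2) by simp
      then obtain j where "n - P \<le> j" "j \<le> n - P + P" "i \<in> A j" by auto
      with max[of j n] True show ?thesis by simp
    qed simp
    show "i \<notin> A m" if "r n < m \<and> m \<le> n" using max[of m n] that by auto
  qed
qed

text \<open>The strict bound \<open>r < m\<close> makes \<open>m - 1\<close> a genuine predecessor,
  so truncated subtraction at 0 never interferes.\<close>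

lemma eq_if_kept:
  fixes f :: "nat \<Rightarrow> 'b"
  assumes "\<And>m. r < m \<Longrightarrow> m \<le> n \<Longrightarrow> f m = f (m - 1)" and "r \<le> n"
  shows "f n = f r"
  using assms(2,1)
proof (induction n rule: dec_induct)
  case (step n)
  have "f (Suc n) = f n" using step.prems[of "Suc n"] step.hyps by simp
  also have "f n = f r" using step.prems by (intro step.IH) simp
  finally show ?case .
qed simp

theorem theorem3p1:
  fixes H :: "'i::finite \<Rightarrow> 'h::real_inner set"
    and Y :: "'i \<Rightarrow> 'y::real_inner set"
    and G :: "'k::finite \<Rightarrow> 'g::real_inner set"
    and \<phi> :: "'i \<Rightarrow> 'h \<Rightarrow> ereal" and \<psi> :: "'i \<Rightarrow> 'h \<Rightarrow> real" and \<alpha> :: "'i \<Rightarrow> real"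
    and f :: "'i \<Rightarrow> 'y ^ 'i \<Rightarrow> real" and Q :: "'y ^ 'i \<Rightarrow> 'y ^ 'i" and X :: "'i \<Rightarrow> real"
    and g :: "'k \<Rightarrow> 'g \<Rightarrow> ereal" and h :: "'k \<Rightarrow> 'g \<Rightarrow> real" and \<beta> :: "'k \<Rightarrow> real"
    and M :: "'i \<Rightarrow> 'h \<Rightarrow> 'y" and L :: "'k \<Rightarrow> 'i \<Rightarrow> 'h \<Rightarrow> 'g"
    and \<eta> \<epsilon> :: real and lam :: "nat \<Rightarrow> real" and D P :: nat
    and \<tau> :: "'i \<Rightarrow> nat \<Rightarrow> nat" and \<gamma> \<mu> \<sigma> :: "'i \<Rightarrow> nat \<Rightarrow> real"
    and \<delta> :: "'k \<Rightarrow> nat \<Rightarrow> nat" and \<nu> \<rho> :: "'k \<Rightarrow> nat \<Rightarrow> real"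
    and I_seq :: "nat \<Rightarrow> 'i set" and K_seq :: "nat \<Rightarrow> 'k set"
    and x a x_st s_st a_st :: "nat \<Rightarrow> 'h ^ 'i"
    and y q u_st c_st c q_st :: "nat \<Rightarrow> 'y ^ 'i"
    and z v_st d_st b e_st b_st e :: "nat \<Rightarrow> 'g ^ 'k"
    and \<pi> \<theta> :: "nat \<Rightarrow> real"
  assumes H: "\<And>i. hilbert_subspace (H i)"
    and Y: "\<And>i. hilbert_subspace (Y i)"
    and G: "\<And>k. hilbert_subspace (G k)"
    \<comment> \<open>the problem data\<close>
    and \<phi>: "\<And>i. proper_lsc_convex (H i) (\<phi> i)"
    and \<alpha>: "\<And>i. 0 \<le> \<alpha> i"
    and \<psi>: "\<And>i. convex_on (H i) (\<psi> i)"
           "\<And>i. \<psi> i differentiable_on H i"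
           "\<And>i. (\<alpha> i)-lipschitz_on (H i) (gradient_on (H i) (\<psi> i))"
    and f: "\<And>i w. w \<in> direct_sum Y \<Longrightarrow> convex_on (Y i) (\<lambda>t. f i (subst_comp i t w))"
           "\<And>i w. w \<in> direct_sum Y \<Longrightarrow>
              gateaux_differentiable_on (Y i) (\<lambda>t. f i (subst_comp i t w))"
    and Q_def: "\<And>w. Q w = (\<chi> i. partial_gradient Y i (f i) w)"
    and Q: "monotone_operator_on (direct_sum Y) Q"
           "\<exists>B. B-lipschitz_on (direct_sum Y) Q"
    and X: "\<And>i. 0 < X i"
           "\<And>w w'. w \<in> direct_sum Y \<Longrightarrow> w' \<in> direct_sum Y \<Longrightarrow>
              inner (w - w') (Q w - Q w') \<le> (\<Sum>i\<in>UNIV. X i * (norm (w $ i - w' $ i))\<^sup>2)"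
    and g: "\<And>k. proper_lsc_convex (G k) (g k)"
    and \<beta>: "\<And>k. 0 \<le> \<beta> k"
    and h: "\<And>k. convex_on (G k) (h k)"
           "\<And>k. h k differentiable_on G k"
           "\<And>k. (\<beta> k)-lipschitz_on (G k) (gradient_on (G k) (h k))"
    and M: "\<And>i. bounded_linear_between (H i) (Y i) (M i)"
    and L: "\<And>k i. bounded_linear_between (H i) (G k) (L k i)"
    \<comment> \<open>the parameters of the algorithm\<close>
    and \<eta>: "0 < \<eta>"
    and \<epsilon>: "0 < \<epsilon>" "\<epsilon> < 1"
           "1 / \<epsilon> > Max (range (\<lambda>i. \<alpha> i + \<eta>) \<union> range (\<lambda>k. \<beta> k + \<eta>) \<union> range (\<lambda>i. X i + \<eta>))"
    and lam: "\<And>n. lam n \<in> {\<epsilon>..2 - \<epsilon>}"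
    and \<tau>: "\<And>i n. n \<le> \<tau> i n + D \<and> \<tau> i n \<le> n"
    and \<gamma>: "\<And>i n. \<gamma> i n \<in> {\<epsilon>..1 / (\<alpha> i + \<eta>)}"
    and \<mu>: "\<And>i n. \<mu> i n \<in> {\<epsilon>..1 / (X i + \<eta>)}"
    and \<sigma>: "\<And>i n. \<sigma> i n \<in> {\<epsilon>..1 / \<epsilon>}"
    and init_I: "x 0 \<in> direct_sum H" "y 0 \<in> direct_sum Y" "u_st 0 \<in> direct_sum Y"
    and \<delta>: "\<And>k n. n \<le> \<delta> k n + D \<and> \<delta> k n \<le> n"
    and \<nu>: "\<And>k n. \<nu> k n \<in> {\<epsilon>..1 / (\<beta> k + \<eta>)}"
    and \<rho>: "\<And>k n. \<rho> k n \<in> {\<epsilon>..1 / \<epsilon>}"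
    and init_K: "z 0 \<in> direct_sum G" "v_st 0 \<in> direct_sum G"
    and nonempty: "\<And>n. I_seq n \<noteq> {}" "\<And>n. K_seq n \<noteq> {}"
    and first: "I_seq 0 = UNIV" "K_seq 0 = UNIV"
    and sweep: "\<And>n. (\<Union>j\<in>{n..n + P}. I_seq j) = UNIV" "\<And>n. (\<Union>j\<in>{n..n + P}. K_seq j) = UNIV"
    \<comment> \<open>step 1\<close>
    and q_upd: "\<And>n i. i \<in> I_seq n \<Longrightarrow>
        q n $ i = y (\<tau> i n) $ i + \<mu> i (\<tau> i n) *\<^sub>R
          (u_st (\<tau> i n) $ i - partial_gradient Y i (f i) (y (\<tau> i n)))"
    and c_st_upd: "\<And>n i. i \<in> I_seq n \<Longrightarrow>
        c_st n $ i = u_st (\<tau> i n) $ i + \<sigma> i (\<tau> i n) *\<^sub>R (M i (x (\<tau> i n) $ i) - y (\<tau> i n) $ i)"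
    and x_st_upd: "\<And>n i. i \<in> I_seq n \<Longrightarrow>
        x_st n $ i = x (\<tau> i n) $ i - \<gamma> i (\<tau> i n) *\<^sub>R
          (gradient_on (H i) (\<psi> i) (x (\<tau> i n) $ i)
           + adjoint_on (H i) (M i) (u_st (\<tau> i n) $ i)
           + (\<Sum>k\<in>UNIV. adjoint_on (H i) (L k i) (v_st (\<tau> i n) $ k)))"
    and a_upd: "\<And>n i. i \<in> I_seq n \<Longrightarrow>
        a n $ i = prox_on (H i) (\<lambda>t. ereal (\<gamma> i (\<tau> i n)) * \<phi> i t) (x_st n $ i)"
    and s_st_upd: "\<And>n i. i \<in> I_seq n \<Longrightarrow>
        s_st n $ i = inverse (\<gamma> i (\<tau> i n)) *\<^sub>R (x_st n $ i - a n $ i)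
          + gradient_on (H i) (\<psi> i) (a n $ i) + adjoint_on (H i) (M i) (c_st n $ i)"
    and c_upd: "\<And>n i. i \<in> I_seq n \<Longrightarrow> c n $ i = q n $ i - M i (a n $ i)"
    \<comment> \<open>step 2\<close>
    and I_keep: "\<And>n i. i \<notin> I_seq n \<Longrightarrow>
        q n $ i = q (n - 1) $ i \<and> c_st n $ i = c_st (n - 1) $ i \<and> a n $ i = a (n - 1) $ i \<and>
        s_st n $ i = s_st (n - 1) $ i \<and> c n $ i = c (n - 1) $ i"
    \<comment> \<open>step 3\<close>
    and d_st_upd: "\<And>n k. k \<in> K_seq n \<Longrightarrow>
        d_st n $ k = z (\<delta> k n) $ k + \<nu> k (\<delta> k n) *\<^sub>R
          (v_st (\<delta> k n) $ k - gradient_on (G k) (h k) (z (\<delta> k n) $ k))"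
    and b_upd: "\<And>n k. k \<in> K_seq n \<Longrightarrow>
        b n $ k = prox_on (G k) (\<lambda>t. ereal (\<nu> k (\<delta> k n)) * g k t) (d_st n $ k)"
    and e_st_upd: "\<And>n k. k \<in> K_seq n \<Longrightarrow>
        e_st n $ k = v_st (\<delta> k n) $ k + \<rho> k (\<delta> k n) *\<^sub>R
          ((\<Sum>i\<in>UNIV. L k i (x (\<delta> k n) $ i)) - z (\<delta> k n) $ k)"
    and b_st_upd: "\<And>n k. k \<in> K_seq n \<Longrightarrow>
        b_st n $ k = inverse (\<nu> k (\<delta> k n)) *\<^sub>R (d_st n $ k - b n $ k)
          + gradient_on (G k) (h k) (b n $ k) - e_st n $ k"
    and e_upd: "\<And>n k. k \<in> K_seq n \<Longrightarrow> e n $ k = b n $ k - (\<Sum>i\<in>UNIV. L k i (a n $ i))"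
    \<comment> \<open>step 4\<close>
    and K_keep: "\<And>n k. k \<notin> K_seq n \<Longrightarrow>
        b n $ k = b (n - 1) $ k \<and> e_st n $ k = e_st (n - 1) $ k \<and>
        b_st n $ k = b_st (n - 1) $ k \<and> e n $ k = b n $ k - (\<Sum>i\<in>UNIV. L k i (a n $ i))"
    \<comment> \<open>step 5\<close>
    and a_st: "\<And>n i. a_st n $ i
        = s_st n $ i + (\<Sum>k\<in>UNIV. adjoint_on (H i) (L k i) (e_st n $ k))"
    and q_st: "\<And>n i. q_st n $ i = partial_gradient Y i (f i) (q n) - c_st n $ i"
    \<comment> \<open>step 6\<close>
    and \<pi>: "\<And>n. \<pi> n =
        (\<Sum>i\<in>UNIV. inner (a n $ i - x n $ i) (a_st n $ i) + inner (q n $ i - y n $ i) (q_st n $ i)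
                   + inner (c n $ i) (c_st n $ i - u_st n $ i))
        + (\<Sum>k\<in>UNIV. inner (b n $ k - z n $ k) (b_st n $ k)
                   + inner (e n $ k) (e_st n $ k - v_st n $ k))"
    \<comment> \<open>step 7\<close>
    and \<theta>: "\<And>n. \<pi> n < 0 \<Longrightarrow> \<theta> n = lam n * \<pi> n /
        ((\<Sum>i\<in>UNIV. (norm (a_st n $ i))\<^sup>2 + (norm (q_st n $ i))\<^sup>2 + (norm (c n $ i))\<^sup>2)
         + (\<Sum>k\<in>UNIV. (norm (b_st n $ k))\<^sup>2 + (norm (e n $ k))\<^sup>2))"
    and move_I: "\<And>n i. \<pi> n < 0 \<Longrightarrow>
        x (Suc n) $ i = x n $ i + \<theta> n *\<^sub>R a_st n $ i \<and>
        y (Suc n) $ i = y n $ i + \<theta> n *\<^sub>R q_st n $ i \<and>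
        u_st (Suc n) $ i = u_st n $ i + \<theta> n *\<^sub>R c n $ i"
    and move_K: "\<And>n k. \<pi> n < 0 \<Longrightarrow>
        z (Suc n) $ k = z n $ k + \<theta> n *\<^sub>R b_st n $ k \<and>
        v_st (Suc n) $ k = v_st n $ k + \<theta> n *\<^sub>R e n $ k"
    and stay_I: "\<And>n i. \<not> \<pi> n < 0 \<Longrightarrow>
        x (Suc n) $ i = x n $ i \<and> y (Suc n) $ i = y n $ i \<and> u_st (Suc n) $ i = u_st n $ i"
    and stay_K: "\<And>n k. \<not> \<pi> n < 0 \<Longrightarrow>
        z (Suc n) $ k = z n $ k \<and> v_st (Suc n) $ k = v_st n $ k"
    \<comment> \<open>existence of a Kuhn-Tucker point\<close>
    and hat: "\<exists>x_hat\<in>direct_sum H. \<exists>u_hat\<in>direct_sum Y. \<exists>v_hat\<in>direct_sum G.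
        (\<forall>i. u_hat $ i = partial_gradient Y i (f i) (\<chi> j. M j (x_hat $ j))) \<and>
        (\<forall>k. v_hat $ k \<in>
           (\<lambda>p. p + gradient_on (G k) (h k) (\<Sum>j\<in>UNIV. L k j (x_hat $ j))) `
             subdifferential_on (G k) (g k) (\<Sum>j\<in>UNIV. L k j (x_hat $ j))) \<and>
        (\<forall>i. - adjoint_on (H i) (M i) (u_hat $ i)
              - (\<Sum>k\<in>UNIV. adjoint_on (H i) (L k i) (v_hat $ k))
            \<in> (\<lambda>p. p + gradient_on (H i) (\<psi> i) (x_hat $ i)) `
                subdifferential_on (H i) (\<phi> i) (x_hat $ i))"
  shows "\<exists>xbar. nash_equilibrium H \<phi> \<psi> f g h M L xbar \<and>
                weakly_converges_in (direct_sum H) x xbar"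
proof -
  interpret np: nash_problem H Y G \<phi> \<psi> \<alpha> f Q g h \<beta> M L
    by unfold_locales (fact H Y G \<phi> \<psi> f Q_def Q g h M L)+
  have "\<forall>i. \<exists>r. (\<forall>n. r n \<le> n \<and> n \<le> r n + P \<and> i \<in> I_seq (r n) \<and>
      (\<forall>m. r n < m \<and> m \<le> n \<longrightarrow> i \<notin> I_seq m))"
    using last_activation[OF first(1) sweep(1)] by blast
  from choice[OF this] obtain rI where rI: "\<And>i n. rI i n \<le> n" "\<And>i n. n \<le> rI i n + P"
    "\<And>i n. i \<in> I_seq (rI i n)" "\<And>i n m. rI i n < m \<Longrightarrow> m \<le> n \<Longrightarrow> i \<notin> I_seq m" by blast
  have "\<forall>k. \<exists>r. (\<forall>n. r n \<le> n \<and> n \<le> r n + P \<and> k \<in> K_seq (r n) \<and>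
      (\<forall>m. r n < m \<and> m \<le> n \<longrightarrow> k \<notin> K_seq m))"
    using last_activation[OF first(2) sweep(2)] by blast
  from choice[OF this] obtain rK where rK: "\<And>k n. rK k n \<le> n" "\<And>k n. n \<le> rK k n + P"
    "\<And>k n. k \<in> K_seq (rK k n)" "\<And>k n m. rK k n < m \<Longrightarrow> m \<le> n \<Longrightarrow> k \<notin> K_seq m" by blast
  \<comment> \<open>The delay is read at the last activation. The idle period adds at most
    \<open>P\<close> and the delay at most \<open>D\<close>, so the total lag is at most
    \<open>D + P\<close>.\<close>
  define t where "t i n = \<tau> i (rI i n)" for i n
  define d where "d k n = \<delta> k (rK k n)" for k n
  have keep_I: "r n = r (rI i n)" if "\<And>m. i \<notin> I_seq m \<Longrightarrow> r m = r (m - 1)"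
    for r :: "nat \<Rightarrow> 'c" and i n
    by (rule eq_if_kept[OF _ rI(1), where f = r]) (rule that[OF rI(4)])
  have keep_K: "r n = r (rK k n)" if "\<And>m. k \<notin> K_seq m \<Longrightarrow> r m = r (m - 1)"
    for r :: "nat \<Rightarrow> 'c" and k n
    by (rule eq_if_kept[OF _ rK(1), where f = r]) (rule that[OF rK(4)])
  have kept_I: "q n $ i = q (rI i n) $ i" "c_st n $ i = c_st (rI i n) $ i" "a n $ i = a (rI i n) $ i"
    "s_st n $ i = s_st (rI i n) $ i" "c n $ i = c (rI i n) $ i" for n i
    by (rule keep_I[of i "\<lambda>n. q n $ i"] keep_I[of i "\<lambda>n. c_st n $ i"]
        keep_I[of i "\<lambda>n. a n $ i"] keep_I[of i "\<lambda>n. s_st n $ i"]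
        keep_I[of i "\<lambda>n. c n $ i"], use I_keep in blast)+
  have kept_K: "b n $ k = b (rK k n) $ k" "e_st n $ k = e_st (rK k n) $ k" "b_st n $ k = b_st (rK k n) $ k" for n k
    by (rule keep_K[of k "\<lambda>n. b n $ k"] keep_K[of k "\<lambda>n. e_st n $ k"]
        keep_K[of k "\<lambda>n. b_st n $ k"], use K_keep in blast)+
  have Q_nth: "Q w $ i = partial_gradient Y i (f i) w" for w i by (simp add: Q_def)
  define w where "w n = ((x n, z n), (y n, u_st n, v_st n))" for n
  define p where "p n = ((a n, b n), (q n, c_st n, e_st n))" for n
  define s where "s n = ((a_st n, b_st n), (q_st n, c n, e n))" for n
  have \<pi>_eq: "\<pi> n = inner (p n - w n) (s n)" for n
    by (simp add: \<pi> p_def w_def s_def inner_vec_def sum.distrib inner_commute)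
  have norm_s: "(\<Sum>i\<in>UNIV. (norm (a_st n $ i))\<^sup>2 + (norm (q_st n $ i))\<^sup>2 + (norm (c n $ i))\<^sup>2)
      + (\<Sum>k\<in>UNIV. (norm (b_st n $ k))\<^sup>2 + (norm (e n $ k))\<^sup>2) = (norm (s n))\<^sup>2" for n
    by (simp add: s_def power2_norm_eq_inner inner_vec_def sum.distrib)
  have step: "w (Suc n) = w n + (lam n * inner (p n - w n) (s n) / (norm (s n))\<^sup>2) *\<^sub>R s n"
    if "inner (p n - w n) (s n) < 0" for n
  proof -
    have "\<pi> n < 0" using that by (simp add: \<pi>_eq)
    have "w (Suc n) = w n + \<theta> n *\<^sub>R s n"
      using move_I[OF \<open>\<pi> n < 0\<close>] move_K[OF \<open>\<pi> n < 0\<close>] by (simp add: w_def s_def vec_eq_iff)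
    thus ?thesis using \<theta>[OF \<open>\<pi> n < 0\<close>] unfolding norm_s \<pi>_eq by simp
  qed
  have stay: "w (Suc n) = w n" if "\<not> inner (p n - w n) (s n) < 0" for n
    using stay_I[of n] stay_K[of n] that by (simp add: w_def \<pi>_eq vec_eq_iff)
  obtain x_hat u_hat v_hat where hat: "x_hat \<in> direct_sum H" "u_hat \<in> direct_sum Y" "v_hat \<in> direct_sum G"
    "\<And>i. u_hat $ i = Q (np.Mv x_hat) $ i"
    "\<And>k. v_hat $ k - np.grad_h k (np.Lv x_hat $ k) \<in> subdifferential_on (G k) (g k) (np.Lv x_hat $ k)"
    "\<And>i. - np.M_adj i (u_hat $ i) - (\<Sum>k\<in>UNIV. np.L_adj k i (v_hat $ k)) - np.grad_\<psi> i (x_hat $ i)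
      \<in> subdifferential_on (H i) (\<phi> i) (x_hat $ i)"
  proof -
    obtain x_hat u_hat v_hat where hat: "x_hat \<in> direct_sum H" "u_hat \<in> direct_sum Y" "v_hat \<in> direct_sum G"
      "\<And>i. u_hat $ i = partial_gradient Y i (f i) (\<chi> j. M j (x_hat $ j))"
      "\<And>k. v_hat $ k \<in> (\<lambda>p. p + np.grad_h k (\<Sum>j\<in>UNIV. L k j (x_hat $ j))) `
             subdifferential_on (G k) (g k) (\<Sum>j\<in>UNIV. L k j (x_hat $ j))"
      "\<And>i. - np.M_adj i (u_hat $ i) - (\<Sum>k\<in>UNIV. np.L_adj k i (v_hat $ k))
            \<in> (\<lambda>p. p + np.grad_\<psi> i (x_hat $ i)) ` subdifferential_on (H i) (\<phi> i) (x_hat $ i)"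
      using hat by blast
    have image_plus: "v \<in> (\<lambda>p. p + c) ` S \<Longrightarrow> v - c \<in> S" for v c :: "'b::real_inner" and S by auto
    show ?thesis
      using image_plus[OF hat(5)] image_plus[OF hat(6)] hat(1-4)
      by (intro that[of x_hat u_hat v_hat]) (simp_all add: np.Mv_def np.Lv_def Q_nth)
  qed
  have u_hat: "u_hat = Q (np.Mv x_hat)" using hat(4) by (simp add: vec_eq_iff)
  \<comment> \<open>Taking \<open>z\<close> and \<open>y\<close> as the images of
    \<open>x_hat\<close>, and \<open>u_hat\<close> as the value of \<open>Q\<close>, annihilates the
    last three rows of \<open>T\<close>; the remaining two are the Kuhn-Tucker inclusions.\<close>
  let ?p0 = "((x_hat, np.Lv x_hat), (np.Mv x_hat, u_hat, v_hat))"
  have p0: "?p0 \<in> np.SS" using hat(1-3) by (simp add: np.mem_SS np.Mv_mem np.Lv_mem)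
  have "- np.T ?p0 = ((- np.Tx x_hat u_hat v_hat, - np.Tz (np.Lv x_hat) v_hat), (0, 0, 0))"
    by (simp add: np.T_apply u_hat)
  moreover have "\<dots> \<in> subdifferential_on np.SS np.F ?p0"
  proof (rule np.subdifferential_F)
    show "(- np.Tx x_hat u_hat v_hat) $ i \<in> subdifferential_on (H i) (\<phi> i) (x_hat $ i)" for i
      using hat(6)[of i] by (simp add: np.Tx_def algebra_simps)
    show "(- np.Tz (np.Lv x_hat) v_hat) $ k \<in> subdifferential_on (G k) (g k) (np.Lv x_hat $ k)" for k
      using hat(5)[of k] by (simp add: np.Tz_def)
  qed
  ultimately have zero: "- np.T ?p0 \<in> subdifferential_on np.SS np.F ?p0" by simp
  have tau: "n \<le> t i n + (D + P)" "t i n \<le> n" for i n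
    using \<tau>[of "rI i n" i] rI(1)[of i n] rI(2)[of n i] by (auto simp: t_def)
  have delta: "n \<le> d k n + (D + P)" "d k n \<le> n" for k n
    using \<delta>[of "rK k n" k] rK(1)[of k n] rK(2)[of n k] by (auto simp: d_def)
  \<comment> \<open>The intermediate points \<open>x_st\<close> and \<open>d_st\<close> are not
    carried over by the algorithm, so they are read at the activation time itself; the step sizes
    are read at the delayed time.\<close>
  interpret it: nash_iteration H Y G \<phi> \<psi> \<alpha> f Q g h \<beta> M L X \<eta> \<epsilon> lam "D + P"
    t "\<lambda>i n. \<gamma> i (t i n)" "\<lambda>i n. \<mu> i (t i n)" "\<lambda>i n. \<sigma> i (t i n)"
    d "\<lambda>k n. \<nu> k (d k n)" "\<lambda>k n. \<rho> k (d k n)"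
    x a s_st a_st "\<lambda>i n. x_st (rI i n) $ i" y q u_st c_st c q_st z v_st b e_st b_st e "\<lambda>k n. d_st (rK k n) $ k"
    w p s
  proof unfold_locales
    fix n i k
    show "w n = ((x n, z n), (y n, u_st n, v_st n))" by (rule w_def)
    show "p n = ((a n, b n), (q n, c_st n, e_st n))" by (rule p_def)
    show "s n = ((a_st n, b_st n), (q_st n, c n, e n))" by (rule s_def)
    show "w 0 \<in> np.SS" using init_I init_K by (simp add: w_def np.mem_SS)
    show "q n $ i = y (t i n) $ i + \<mu> i (t i n) *\<^sub>R (u_st (t i n) $ i - Q (y (t i n)) $ i)"
      unfolding kept_I(1)[of n i] t_def Q_nth by (rule q_upd[OF rI(3)])
    show "c_st n $ i = u_st (t i n) $ i + \<sigma> i (t i n) *\<^sub>R (M i (x (t i n) $ i) - y (t i n) $ i)"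
      unfolding kept_I(2)[of n i] t_def by (rule c_st_upd[OF rI(3)])
    show "x_st (rI i n) $ i = x (t i n) $ i - \<gamma> i (t i n) *\<^sub>R
        (np.grad_\<psi> i (x (t i n) $ i) + np.M_adj i (u_st (t i n) $ i) + (\<Sum>k\<in>UNIV. np.L_adj k i (v_st (t i n) $ k)))"
      unfolding t_def by (rule x_st_upd[OF rI(3)])
    show "a n $ i = prox_on (H i) (\<lambda>\<xi>. ereal (\<gamma> i (t i n)) * \<phi> i \<xi>) (x_st (rI i n) $ i)"
      unfolding kept_I(3)[of n i] t_def by (rule a_upd[OF rI(3)])
    show "s_st n $ i = inverse (\<gamma> i (t i n)) *\<^sub>R (x_st (rI i n) $ i - a n $ i)
        + np.grad_\<psi> i (a n $ i) + np.M_adj i (c_st n $ i)"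
      unfolding kept_I(2,3,4)[of n i] t_def by (rule s_st_upd[OF rI(3)])
    show "c n $ i = q n $ i - M i (a n $ i)"
      unfolding kept_I(1,3,5)[of n i] by (rule c_upd[OF rI(3)])
    show "d_st (rK k n) $ k = z (d k n) $ k + \<nu> k (d k n) *\<^sub>R (v_st (d k n) $ k - np.grad_h k (z (d k n) $ k))"
      unfolding d_def by (rule d_st_upd[OF rK(3)])
    show "b n $ k = prox_on (G k) (\<lambda>\<xi>. ereal (\<nu> k (d k n)) * g k \<xi>) (d_st (rK k n) $ k)"
      unfolding kept_K(1)[of n k] d_def by (rule b_upd[OF rK(3)])
    show "e_st n $ k = v_st (d k n) $ k + \<rho> k (d k n) *\<^sub>R
        ((\<Sum>i\<in>UNIV. L k i (x (d k n) $ i)) - z (d k n) $ k)"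
      unfolding kept_K(2)[of n k] d_def by (rule e_st_upd[OF rK(3)])
    show "b_st n $ k = inverse (\<nu> k (d k n)) *\<^sub>R (d_st (rK k n) $ k - b n $ k)
        + np.grad_h k (b n $ k) - e_st n $ k"
      unfolding kept_K[of n k] d_def by (rule b_st_upd[OF rK(3)])
    \<comment> \<open>Unlike the other dual data, \<open>e\<close> is refreshed with the current
      \<open>a\<close> at every step, whether or not \<open>k\<close> is active.\<close>
    show "e n $ k = b n $ k - (\<Sum>i\<in>UNIV. L k i (a n $ i))"
      using e_upd[of k n] K_keep[of k n] by blast
    show "a_st n $ i = s_st n $ i + (\<Sum>k\<in>UNIV. np.L_adj k i (e_st n $ k))" by (rule a_st)
    show "q_st n $ i = Q (q n) $ i - c_st n $ i" unfolding Q_nth by (rule q_st)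
    \<comment> \<open>The Kuhn-Tucker point supplies the subgradients on which the existence of the
      proximal points rests.\<close>
    show "\<exists>\<xi>\<in>H i. subdifferential_on (H i) (\<phi> i) \<xi> \<noteq> {}"
      using hat(1,6) by (auto simp: mem_direct_sum)
    show "\<exists>\<xi>\<in>G k. subdifferential_on (G k) (g k) \<xi> \<noteq> {}"
      using np.Lv_mem[OF hat(1)] hat(5) by (auto simp: mem_direct_sum)
    show "\<exists>p0\<in>np.SS. - np.T p0 \<in> subdifferential_on np.SS np.F p0" using p0 zero by blast
  qed (fact X(2) \<eta> \<epsilon>(1) lam tau delta \<gamma> \<mu> \<sigma> \<nu> \<rho> step stay)+
  show ?thesis by (rule it.converges_to_nash_equilibrium)
qed

end
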